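(* Let $P\subseteq\mathbb{R}^n$ be a full-dimensional smooth and reflexive lattice polytope whose barycenter is the origin, and denote its facets by $P_1,\ldots,P_m$. For each facet $P_k$, let $v_k\in\mathbb{Z}^n$ be its primitive inner normal vector, and let $\operatorname{vol}(P_k)$ be its lattice volume with respect to the intersection of $\mathbb{Z}^n$ with the affine span of $P_k$. Then, for every nonempty proper affine subspace $A\subsetneq\mathbb{R}^n$, $$\frac{1}{\dim A+1}\sum_{k\,:\,v_k\in A}\operatorname{vol}(P_k)\;\leq\;\frac{1}{n+1}\sum_{k=1}^m\operatorname{vol}(P_k).$$ In addition, whenever equality holds for some such $A$, equality also holds for some affine subspace $A'$ of $\mathbb{R}^n$ complementary to $A$.
   Context: A lattice polytope in $\mathbb{R}^n$ is the convex hull of finitely many points of $\mathbb{Z}^n$; it is full-dimensional if its affine span is $\mathbb{R}^n$. Facets are codimension-one faces. Vectors $u$ in the space containing $P$ and normal vectors $v$ are paired by the standard pairing $\langle u,v\rangle$ (strictly speaking, $P$ lies in $M_{\mathbb{R}}=M\otimes_{\mathbb Z}\mathbb{R}$ with $M\cong\mathbb{Z}^n$, while the $v_k$ and $A$ lie in $N_{\mathbb{R}}=N\otimes_{\mathbb Z}\mathbb{R}$ for the dual lattice $N\cong\mathbb{Z}^n$). For a full-dimensional lattice polytope $P$ and a facet $P_k$, there are a unique primitive lattice vector $v_k$ (the primitive inner normal vector) and a unique integer $c_k$ such that $P_k=\{u\in P\mid\langle u,v_k\rangle=-c_k\}$ and $\langle u,v_k\rangle\geq-c_k$ for all $u\in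 P$. The polytope $P$ is reflexive if $c_k=1$ for all $k$. It is smooth if for each vertex $u$ of $P$ there are exactly $n$ edges containing $u$ and, denoting by $u_1,\ldots,u_n$ the next lattice points after $u$ on these edges, $\{u_1-u,\ldots,u_n-u\}$ is a $\mathbb{Z}$-basis of the lattice. The lattice volume $\operatorname{vol}(P_k)$ is the $(n-1)$-dimensional volume on the affine span of $P_k$ normalized by the lattice points contained in that affine span (a point has volume $1$ when $n=1$). Two affine subspaces $A,A'\subseteq\mathbb{R}^n$ are complementary if the linear spans of $A\times\{-1\}$ and $A'\times\{-1\}$ in $\mathbb{R}^{n}\oplus\mathbb{R}=\mathbb{R}^{n+1}$ are complementary linear subspaces, i.e. their direct sum is $\mathbb{R}^{n+1}$. *)

theory Defs
  imports "HOL-Analysis.Analysis"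
begin

text \<open>The lattices \<open>M\<close> and \<open>N\<close> are both identified with the integer points of \<open>real ^ 'n\<close>, and
  the pairing between them with the standard inner product.\<close>

definition int_lattice :: "(real ^ 'n) set" where
  "int_lattice = {x. \<forall>i. x $ i \<in> \<int>}"

definition lattice_polytope :: "(real ^ 'n) set \<Rightarrow> bool" where
  "lattice_polytope P \<longleftrightarrow> (\<exists>S. finite S \<and> S \<subseteq> int_lattice \<and> P = convex hull S)"

definition full_dimensional :: "(real ^ 'n) set \<Rightarrow> bool" where
  "full_dimensional P \<longleftrightarrow> affine hull P = UNIV"

definition Z_basis :: "(real ^ 'n) set \<Rightarrow> (real ^ 'n) set \<Rightarrow> bool" where
  "Z_basis B L \<longleftrightarrow>
     finite B \<and>
     (\<forall>c :: real ^ 'n \<Rightarrow> int. (\<Sum>b\<in>B. of_int (c b) *\<^sub>R b) = 0 \<longrightarrow> (\<forall>b\<in>B. c b = 0)) \<and>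
     L = {\<Sum>b\<in>B. of_int (c b) *\<^sub>R b | c :: real ^ 'n \<Rightarrow> int. True}"

definition primitive_vector :: "(real ^ 'n) set \<Rightarrow> real ^ 'n \<Rightarrow> bool" where
  "primitive_vector L v \<longleftrightarrow>
     v \<in> L \<and> v \<noteq> 0 \<and> (\<forall>w\<in>L. \<forall>k :: int. v = of_int k *\<^sub>R w \<longrightarrow> \<bar>k\<bar> = 1)"

text \<open>For a facet \<open>F\<close> of a full-dimensional lattice polytope \<open>P\<close>, there is exactly one pair
  \<open>(v, c)\<close> with the following property.\<close>

definition facet_presentation ::
  "(real ^ 'n) set \<Rightarrow> (real ^ 'n) set \<Rightarrow> real ^ 'n \<Rightarrow> int \<Rightarrow> bool" where
  "facet_presentation P F v c \<longleftrightarrow>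
     primitive_vector int_lattice v \<and>
     F = {u \<in> P. u \<bullet> v = - of_int c} \<and> (\<forall>u\<in>P. u \<bullet> v \<ge> - of_int c)"

definition inner_normal :: "(real ^ 'n) set \<Rightarrow> (real ^ 'n) set \<Rightarrow> real ^ 'n" where
  "inner_normal P F = (THE v. \<exists>c. facet_presentation P F v c)"

definition facet_constant :: "(real ^ 'n) set \<Rightarrow> (real ^ 'n) set \<Rightarrow> int" where
  "facet_constant P F = (THE c. \<exists>v. facet_presentation P F v c)"

definition reflexive_polytope :: "(real ^ 'n) set \<Rightarrow> bool" where
  "reflexive_polytope P \<longleftrightarrow> (\<forall>F. F facet_of P \<longrightarrow> facet_constant P F = 1)"

text \<open>Unique when \<open>e\<close> is an edge, with lattice endpoints, of which \<open>u\<close> is an endpoint.\<close>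

definition next_lattice_point :: "real ^ 'n \<Rightarrow> (real ^ 'n) set \<Rightarrow> real ^ 'n" where
  "next_lattice_point u e =
     (THE w. w \<in> e \<and> w \<in> int_lattice \<and> w \<noteq> u \<and> open_segment u w \<inter> int_lattice = {})"

definition smooth_polytope :: "(real ^ 'n) set \<Rightarrow> bool" where
  "smooth_polytope P \<longleftrightarrow>
     (\<forall>u. u extreme_point_of P \<longrightarrow>
        card {e. e edge_of P \<and> u \<in> e} = CARD('n) \<and>
        Z_basis ((\<lambda>e. next_lattice_point u e - u) ` {e. e edge_of P \<and> u \<in> e}) int_lattice)"

definition barycenter :: "(real ^ 'n) set \<Rightarrow> real ^ 'n" where
  "barycenter P = (1 / measure lborel P) *\<^sub>R (LINT x:P|lborel. x)"

text \<open>An origin \<open>p\<close> and vectors \<open>b 0, \<dots>, b (d - 1)\<close>, with \<open>d\<close> the dimension of \<open>S\<close>, giving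
  affine coordinates on the affine span of \<open>S\<close> in which its lattice points are the points with
  integer coordinates.\<close>

definition lattice_frame ::
  "(real ^ 'n) set \<Rightarrow> real ^ 'n \<Rightarrow> (nat \<Rightarrow> real ^ 'n) \<Rightarrow> bool" where
  "lattice_frame S p b \<longleftrightarrow>
     p \<in> affine hull S \<inter> int_lattice \<and>
     inj_on b {..<nat (aff_dim S)} \<and>
     Z_basis (b ` {..<nat (aff_dim S)}) {x - p | x. x \<in> affine hull S \<inter> int_lattice}"

text \<open>Lebesgue measure in lattice coordinates, so that a fundamental parallelepiped of the
  lattice in the affine span has volume 1. The value does not depend on the frame. In dimension 0
  the product measure is the unit mass on a point, so a lattice point has volume 1.\<close>

definition lattice_volume :: "(real ^ 'n) set \<Rightarrow> real" where
  "lattice_volume S =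
     (THE r. \<exists>p b. lattice_frame S p b \<and>
        r = measure (\<Pi>\<^sub>M i\<in>{..<nat (aff_dim S)}. lborel)
              {t \<in> space (\<Pi>\<^sub>M i\<in>{..<nat (aff_dim S)}. lborel).
                 p + (\<Sum>i<nat (aff_dim S). t i *\<^sub>R b i) \<in> S})"

definition complementary_subspaces :: "'a::real_vector set \<Rightarrow> 'a set \<Rightarrow> bool" where
  "complementary_subspaces U V \<longleftrightarrow>
     subspace U \<and> subspace V \<and> U \<inter> V = {0} \<and> {u + v | u v. u \<in> U \<and> v \<in> V} = UNIV"

definition complementary_affine :: "(real ^ 'n) set \<Rightarrow> (real ^ 'n) set \<Rightarrow> bool" where
  "complementary_affine A A' \<longleftrightarrow>
     complementary_subspaces (span (A \<times> {- 1 :: real})) (span (A' \<times> {- 1 :: real}))"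

end

theory Submission
  imports Defs "HOL-Probability.Distributions"
begin

text \<open>Write \<open>n\<close> for the dimension. Reflexivity says that \<open>P\<close> is the set of all \<open>x\<close> with \<open>v \<bullet> x \<ge> - 1\<close> for
  every inner normal \<open>v\<close>. The cone \<open>C\<close> over \<open>P\<close>, that is, the set of all \<open>(x, t)\<close> with
  \<open>(v, - 1) \<bullet> (x, t) \<ge> 0\<close> for every \<open>v\<close>, turns the affine problem into a linear one: an affine subspace
  \<open>A\<close> of normals becomes the linear subspace \<open>L = span (A \<times> {- 1})\<close>, of dimension \<open>dim A + 1\<close> in a space of
  dimension \<open>n + 1\<close>. Give \<open>C\<close> the weight \<open>exp t\<close>. Integrating over \<open>t\<close> leaves the density \<open>exp (m x)\<close> with
  \<open>m x\<close> the minimum of the \<open>v \<bullet> x\<close>, and the region where this minimum is attained by the normal of a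
  facet is the cone over that facet; its mass is \<open>(n - 1)!\<close> times the lattice volume of the facet
  (\<open>face_mass_eq_frame_volume\<close>). As the barycenter of \<open>P\<close> is the origin, the centroid of the weighted
  cone is \<open>p = (0, - (n + 1))\<close> (\<open>wt_linear_integral\<close>).

  Let \<open>M\<close> be the orthogonal complement of \<open>L\<close> and let \<open>f\<close> be the marginal of the weight along \<open>M\<close>,
  a function on the quotient by \<open>M\<close>, which has dimension \<open>dim A + 1\<close>. By Prekopa's theorem
  (\<open>log_concave_fiber_integral\<close>) \<open>f\<close> is log-concave. Contract the quotient towards \<open>p\<close> by the factor
  \<open>1 - e\<close>. Log-concavity gives \<open>f ((1 - e) y + e p) \<ge> f y (1 + e (ln (f p) - ln (f y)))\<close>, and
  \<open>ln (f p) - ln (f y) = s y - l \<bullet> (y - p)\<close> with \<open>l\<close> a supergradient of \<open>ln f\<close> at \<open>p\<close> and \<open>s \<ge> 0\<close>. The linear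
  term integrates to zero because \<open>p\<close> is the centroid. Hence the part of \<open>C\<close> over the contracted
  support has at least \<open>(1 - e)\<close> to the power \<open>dim A + 1\<close> of the total mass
  (\<open>contraction_inequality\<close>). On the other hand this part avoids a shell along each facet of \<open>C\<close> whose
  normal lies in \<open>L\<close>, and these shells have total mass about \<open>e (n + 1)\<close> times the mass of the regions
  belonging to the normals in \<open>A\<close>. Comparing the terms of first order in \<open>e\<close> proves the inequality
  (\<open>affine_concentration\<close>).

  If equality holds, then \<open>s\<close> vanishes, so \<open>f\<close> is the exponential of an affine function. Since \<open>C\<close> is a
  cone, its fibers over the quotient scale linearly, and a Laplace type argument shows that every
  fiber is a translate of \<open>C \<inter> M\<close>, with an apex that depends linearly on the fiber
  (\<open>exists_apex\<close>, \<open>fiber_is_translate\<close>). All vectors \<open>(v, - 1)\<close> with \<open>v \<notin> A\<close> are orthogonal to the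
  apices, which together with \<open>M\<close> span the whole space. Hence these vectors span a space of dimension
  at most \<open>n - dim A\<close> (\<open>dim_nonconstant_normals\<close>). Together with \<open>L\<close> they span everything, so that the
  affine hull \<open>A'\<close> of the normals outside \<open>A\<close> is complementary to \<open>A\<close>, and equality for \<open>A'\<close> follows by
  taking complements of masses (\<open>concentration_equality_complement\<close>).\<close>

section \<open>Integration along finitely many directions\<close>

definition fiber_integral ::
  "(nat \<Rightarrow> 'a::euclidean_space) \<Rightarrow> nat set \<Rightarrow> ('a \<Rightarrow> ennreal) \<Rightarrow> 'a \<Rightarrow> ennreal" where
  "fiber_integral b S \<phi> x = (\<integral>\<^sup>+ t. \<phi> (x + (\<Sum>i\<in>S. t i *\<^sub>R b i)) \<partial>(\<Pi>\<^sub>M i\<in>S. lborel))"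

interpretation lborel_PiM: product_sigma_finite "\<lambda>i::nat. lborel :: real measure"
  by standard

lemma sigma_finite_PiM_lborel:
  "finite (S::nat set) \<Longrightarrow> sigma_finite_measure (\<Pi>\<^sub>M i\<in>S. lborel :: real measure)"
  by (rule lborel_PiM.sigma_finite)

lemma fiber_integral_measurable:
  fixes b :: "nat \<Rightarrow> 'a::euclidean_space"
  assumes "finite S" and [measurable]: "\<phi> \<in> borel_measurable borel"
  shows "fiber_integral b S \<phi> \<in> borel_measurable borel"
proof -
  interpret sigma_finite_measure "\<Pi>\<^sub>M i\<in>S. lborel :: real measure"
    by (rule sigma_finite_PiM_lborel) fact
  have "(\<lambda>z. \<phi> (fst z + (\<Sum>i\<in>S. snd z i *\<^sub>R b i))) \<in> borel_measurable (borel \<Otimes>\<^sub>M (\<Pi>\<^sub>M i\<in>S. lborel))"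
    by measurable
  from borel_measurable_nn_integral_fst[OF this] show ?thesis
    unfolding fiber_integral_def by simp
qed

lemma fiber_integral_empty [simp]: "fiber_integral b {} \<phi> x = \<phi> x"
  unfolding fiber_integral_def by (subst lborel_PiM.nn_integral_empty) auto

text \<open>Fubini's theorem; in this form it also disintegrates a measure over the quotient by the span of
  the directions in \<open>S\<close>.\<close>

lemma fiber_integral_union:
  fixes b :: "nat \<Rightarrow> 'a::euclidean_space"
  assumes fin: "finite S" "finite T" and dj: "S \<inter> T = {}" and [measurable]: "\<phi> \<in> borel_measurable borel"
  shows "fiber_integral b (S \<union> T) \<phi> x = fiber_integral b T (fiber_integral b S \<phi>) x"
proof -
  let ?f = "\<lambda>t. \<phi> (x + (\<Sum>i\<in>T \<union> S. t i *\<^sub>R b i))"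
  have "fiber_integral b (S \<union> T) \<phi> x = integral\<^sup>N (\<Pi>\<^sub>M i\<in>T \<union> S. lborel) ?f"
    unfolding fiber_integral_def by (simp add: Un_commute)
  also have "\<dots> = (\<integral>\<^sup>+t. (\<integral>\<^sup>+u. ?f (merge T S (t, u)) \<partial>(\<Pi>\<^sub>M i\<in>S. lborel)) \<partial>(\<Pi>\<^sub>M i\<in>T. lborel))"
    using dj fin by (intro lborel_PiM.product_nn_integral_fold) (auto simp: Int_commute)
  also have "\<dots> = fiber_integral b T (fiber_integral b S \<phi>) x"
  proof -
    have "(\<Sum>i\<in>T \<union> S. merge T S (t, u) i *\<^sub>R b i) = (\<Sum>i\<in>T. t i *\<^sub>R b i) + (\<Sum>i\<in>S. u i *\<^sub>R b i)" for t u
    proof -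
      have "(\<Sum>i\<in>T \<union> S. merge T S (t, u) i *\<^sub>R b i)
          = (\<Sum>i\<in>T. merge T S (t, u) i *\<^sub>R b i) + (\<Sum>i\<in>S. merge T S (t, u) i *\<^sub>R b i)"
        using dj fin by (intro sum.union_disjoint) auto
      also have "(\<Sum>i\<in>T. merge T S (t, u) i *\<^sub>R b i) = (\<Sum>i\<in>T. t i *\<^sub>R b i)"
        by (intro sum.cong) (auto simp: merge_def)
      also have "(\<Sum>i\<in>S. merge T S (t, u) i *\<^sub>R b i) = (\<Sum>i\<in>S. u i *\<^sub>R b i)"
        using dj by (intro sum.cong) (auto simp: merge_def)
      finally show ?thesis .
    qed
    then show ?thesis unfolding fiber_integral_def by (simp add: add.assoc)
  qed
  finally show ?thesis .
qed

lemma fiber_integral_singleton: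
  fixes b :: "nat \<Rightarrow> 'a::euclidean_space"
  assumes [measurable]: "\<phi> \<in> borel_measurable borel"
  shows "fiber_integral b {i} \<phi> x = (\<integral>\<^sup>+ s. \<phi> (x + s *\<^sub>R b i) \<partial>lborel)"
proof -
  have "(\<lambda>s. \<phi> (x + s *\<^sub>R b i)) \<in> borel_measurable lborel" by measurable
  from lborel_PiM.product_nn_integral_singleton[of _ i, OF this] show ?thesis
    by (simp add: fiber_integral_def)
qed

lemma fiber_integral_insert:
  fixes b :: "nat \<Rightarrow> 'a::euclidean_space"
  assumes "finite S" "i \<notin> S" and [measurable]: "\<phi> \<in> borel_measurable borel"
  shows "fiber_integral b (insert i S) \<phi> x
       = fiber_integral b S (\<lambda>y. \<integral>\<^sup>+ s. \<phi> (y + s *\<^sub>R b i) \<partial>lborel) x"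
proof -
  have "fiber_integral b {i} \<phi> = (\<lambda>y. \<integral>\<^sup>+ s. \<phi> (y + s *\<^sub>R b i) \<partial>lborel)"
    by (rule ext) (rule fiber_integral_singleton, fact)
  then show ?thesis
    using fiber_integral_union[of "{i}" S \<phi> b x] assms by simp
qed

lemma measurable_line_integral:
  fixes e :: "'a::euclidean_space"
  assumes [measurable]: "\<phi> \<in> borel_measurable borel"
  shows "(\<lambda>y. \<integral>\<^sup>+ s. \<phi> (y + s *\<^sub>R e) \<partial>lborel) \<in> borel_measurable borel"
proof -
  have "fiber_integral (\<lambda>_. e) {0} \<phi> = (\<lambda>y. \<integral>\<^sup>+ s. \<phi> (y + s *\<^sub>R e) \<partial>lborel)"
    by (rule ext) (rule fiber_integral_singleton, fact)
  then show ?thesis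
    using fiber_integral_measurable[of "{0}" \<phi> "\<lambda>_. e"] assms by simp
qed

lemma fiber_integral_cong:
  assumes "\<And>t. \<phi> (x + (\<Sum>i\<in>S. t i *\<^sub>R b i)) = \<psi> (y + (\<Sum>i\<in>S. t i *\<^sub>R b i))"
  shows "fiber_integral b S \<phi> x = fiber_integral b S \<psi> y"
  unfolding fiber_integral_def using assms by simp

lemma fiber_integral_mono:
  assumes "\<And>t. \<phi> (x + (\<Sum>i\<in>S. t i *\<^sub>R b i)) \<le> \<psi> (y + (\<Sum>i\<in>S. t i *\<^sub>R b i))"
  shows "fiber_integral b S \<phi> x \<le> fiber_integral b S \<psi> y"
  unfolding fiber_integral_def using assms by (intro nn_integral_mono)

lemma fiber_integral_cmult:
  fixes b :: "nat \<Rightarrow> 'a::euclidean_space"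
  assumes [measurable]: "\<phi> \<in> borel_measurable borel"
  shows "fiber_integral b S (\<lambda>x. c * \<phi> x) x = c * fiber_integral b S \<phi> x"
  unfolding fiber_integral_def by (intro nn_integral_cmult) measurable

lemma fiber_integral_add:
  fixes b :: "nat \<Rightarrow> 'a::euclidean_space"
  assumes [measurable]: "\<phi> \<in> borel_measurable borel" "\<psi> \<in> borel_measurable borel"
  shows "fiber_integral b S (\<lambda>x. \<phi> x + \<psi> x) x = fiber_integral b S \<phi> x + fiber_integral b S \<psi> x"
  unfolding fiber_integral_def by (intro nn_integral_add) measurable

lemma fiber_integral_shift1:
  fixes b :: "nat \<Rightarrow> 'a::euclidean_space"
  assumes "finite S" "i \<in> S" and [measurable]: "\<phi> \<in> borel_measurable borel"
  shows "fiber_integral b S \<phi> (x + c *\<^sub>R b i) = fiber_integral b S \<phi> x"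
proof -
  let ?m = "\<lambda>y. \<integral>\<^sup>+ s. \<phi> (y + s *\<^sub>R b i) \<partial>lborel"
  have S: "S = insert i (S - {i})" using assms by auto
  have m: "?m (y + c *\<^sub>R b i) = ?m y" for y
    using nn_integral_real_affine[of "\<lambda>s. \<phi> (y + s *\<^sub>R b i)" 1 c]
    by (simp add: scaleR_add_left add.assoc)
  have "fiber_integral b S \<phi> (x + c *\<^sub>R b i) = fiber_integral b (S - {i}) ?m (x + c *\<^sub>R b i)"
    using assms by (subst S, subst fiber_integral_insert) auto
  also have "\<dots> = fiber_integral b (S - {i}) ?m x"
  proof (rule fiber_integral_cong)
    fix t :: "nat \<Rightarrow> real"
    let ?z = "\<Sum>i\<in>S - {i}. t i *\<^sub>R b i"
    have "x + c *\<^sub>R b i + ?z = (x + ?z) + c *\<^sub>R b i" by (simp add: add_ac)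
    then show "?m (x + c *\<^sub>R b i + ?z) = ?m (x + ?z)" by (simp only: m)
  qed
  also have "\<dots> = fiber_integral b S \<phi> x"
    using assms by (subst (2) S, subst fiber_integral_insert) auto
  finally show ?thesis .
qed

lemma fiber_integral_shift:
  fixes b :: "nat \<Rightarrow> 'a::euclidean_space"
  assumes S: "finite S" and v: "v \<in> span (b ` S)" and meas: "\<phi> \<in> borel_measurable borel"
  shows "fiber_integral b S \<phi> (x + v) = fiber_integral b S \<phi> x"
  using v
proof (induction arbitrary: x rule: span_induct_alt)
  case base show ?case by simp
next
  case (step c z y)
  then obtain i where "i \<in> S" "z = b i" by auto
  then show ?case
    using step.IH[of "x + c *\<^sub>R z"] fiber_integral_shift1[OF S, of i \<phi> b x c] meas
    by (simp add: add.assoc)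
qed

lemma fiber_integral_scale:
  fixes b :: "nat \<Rightarrow> 'a::euclidean_space"
  assumes S: "finite S" and r: "r > 0" and meas: "\<phi> \<in> borel_measurable borel"
  shows "fiber_integral b S \<phi> (r *\<^sub>R x)
       = ennreal (r ^ card S) * fiber_integral b S (\<lambda>y. \<phi> (r *\<^sub>R y)) x"
  using S meas
proof (induction S arbitrary: \<phi> x)
  case empty show ?case by simp
next
  case (insert i S)
  note insert.prems[measurable]
  have m: "(\<integral>\<^sup>+ s. \<phi> (r *\<^sub>R y + s *\<^sub>R b i) \<partial>lborel) = ennreal r * (\<integral>\<^sup>+ s. \<phi> (r *\<^sub>R (y + s *\<^sub>R b i)) \<partial>lborel)" for y
    using nn_integral_real_affine[of "\<lambda>s. \<phi> (r *\<^sub>R y + s *\<^sub>R b i)" r 0] r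
    by (simp add: scaleR_add_right)
  have "fiber_integral b (insert i S) \<phi> (r *\<^sub>R x)
     = ennreal (r ^ card S) * fiber_integral b S (\<lambda>y. \<integral>\<^sup>+ s. \<phi> (r *\<^sub>R y + s *\<^sub>R b i) \<partial>lborel) x"
    using insert by (simp add: fiber_integral_insert measurable_line_integral)
  also have "\<dots> = ennreal (r ^ card S) * (ennreal r * fiber_integral b S (\<lambda>y. (\<integral>\<^sup>+ s. \<phi> (r *\<^sub>R (y + s *\<^sub>R b i)) \<partial>lborel)) x)"
    unfolding m by (subst fiber_integral_cmult) (simp_all add: measurable_line_integral)
  also have "\<dots> = ennreal (r ^ card (insert i S)) * fiber_integral b (insert i S) (\<lambda>y. \<phi> (r *\<^sub>R y)) x"
    using insert r
    by (simp add: fiber_integral_insert ennreal_mult mult_ac)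
  finally show ?case .
qed

text \<open>A small box of parameters around \<open>0\<close> is mapped into \<open>U\<close>.\<close>

lemma fiber_integral_open_pos:
  fixes b :: "nat \<Rightarrow> 'a::euclidean_space"
  assumes S: "finite S" and U: "open U" "x \<in> U"
  shows "fiber_integral b S (indicator U) x > 0"
proof -
  obtain e where e: "e > 0" "ball x e \<subseteq> U" using U open_contains_ball by blast
  define B where "B = (\<Sum>i\<in>S. norm (b i)) + 1"
  have B: "B > 0" unfolding B_def by (smt (verit) norm_ge_zero sum_nonneg)
  define \<eta> where "\<eta> = e / B"
  have \<eta>: "\<eta> > 0" using e B by (simp add: \<eta>_def)
  let ?box = "PiE S (\<lambda>_. {-\<eta><..<\<eta>})"
  have inU: "x + (\<Sum>i\<in>S. t i *\<^sub>R b i) \<in> U" if t: "t \<in> ?box" for t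
  proof -
    have "norm (\<Sum>i\<in>S. t i *\<^sub>R b i) \<le> (\<Sum>i\<in>S. \<eta> * norm (b i))"
    proof (rule sum_norm_le)
      fix i assume "i \<in> S"
      then have "\<bar>t i\<bar> \<le> \<eta>" using t by (force simp: PiE_def Pi_def)
      then show "norm (t i *\<^sub>R b i) \<le> \<eta> * norm (b i)" by (simp add: mult_right_mono)
    qed
    also have "\<dots> = \<eta> * (B - 1)" by (simp add: B_def sum_distrib_left)
    also have "\<dots> < \<eta> * B" using \<eta> by simp
    also have "\<dots> = e" using B by (simp add: \<eta>_def)
    finally show ?thesis using e by (auto simp: dist_norm norm_minus_commute subset_iff)
  qed
  have "0 < (\<Prod>i\<in>S. emeasure lborel {-\<eta><..<\<eta>})" using \<eta> S
    by (simp add: prod_constant ennreal_power)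
  also have "\<dots> = emeasure (\<Pi>\<^sub>M i\<in>S. lborel) ?box"
    using S by (intro lborel_PiM.emeasure_PiM[symmetric]) auto
  also have "\<dots> = (\<integral>\<^sup>+t. indicator ?box t \<partial>(\<Pi>\<^sub>M i\<in>S. lborel))"
    using S by (intro nn_integral_indicator[symmetric] sets_PiM_I_finite) auto
  also have "\<dots> \<le> fiber_integral b S (indicator U) x"
    unfolding fiber_integral_def using inU by (intro nn_integral_mono) (auto split: split_indicator)
  finally show ?thesis .
qed

section \<open>Marginals of log-concave functions\<close>

text \<open>Both sides compute the area between the graph of \<open>f\<close> and the axis.\<close>

lemma nn_integral_layer_cake:
  fixes f :: "real \<Rightarrow> real"
  assumes [measurable]: "f \<in> borel_measurable borel" and "\<And>x. 0 \<le> f x"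
  shows "(\<integral>\<^sup>+ x. ennreal (f x) \<partial>lborel)
       = (\<integral>\<^sup>+ s. emeasure lborel {x. s < f x} * indicator {0..} s \<partial>lborel)"
proof -
  have 1: "ennreal (f x) = (\<integral>\<^sup>+ s. indicator {0..<f x} s \<partial>lborel)" for x
    using assms(2)[of x] by simp
  have "(\<integral>\<^sup>+ x. ennreal (f x) \<partial>lborel)
      = (\<integral>\<^sup>+ x. (\<integral>\<^sup>+ s. (\<lambda>(x, s). if 0 \<le> s \<and> s < f x then 1 else 0) (x, s) \<partial>lborel) \<partial>lborel)"
    unfolding 1 by (intro nn_integral_cong) (auto split: split_indicator)
  also have "\<dots> = (\<integral>\<^sup>+ s. (\<integral>\<^sup>+ x. (\<lambda>(x, s). if 0 \<le> s \<and> s < f x then 1 else 0) (x, s) \<partial>lborel) \<partial>lborel)"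
    by (rule lborel_pair.Fubini'[symmetric]) measurable
  also have "\<dots> = (\<integral>\<^sup>+ s. emeasure lborel {x. s < f x} * indicator {0..} s \<partial>lborel)"
  proof (rule nn_integral_cong)
    fix s :: real
    have [measurable]: "{x. s < f x} \<in> sets lborel" by measurable
    have "(\<integral>\<^sup>+ x. (\<lambda>(x, s). if 0 \<le> s \<and> s < f x then 1 else 0) (x, s) \<partial>lborel)
        = (\<integral>\<^sup>+ x. indicator {0..} s * indicator {x. s < f x} x \<partial>lborel)"
      by (intro nn_integral_cong) (auto split: split_indicator)
    also have "\<dots> = emeasure lborel {x. s < f x} * indicator {0..} s"
      by (subst nn_integral_cmult) (auto simp: mult.commute)
    finally show "(\<integral>\<^sup>+ x. (\<lambda>(x, s). if 0 \<le> s \<and> s < f x then 1 else 0) (x, s) \<partial>lborel)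
        = emeasure lborel {x. s < f x} * indicator {0..} s" .
  qed
  finally show ?thesis .
qed

lemma convex_real_between_Inf_Sup:
  fixes I :: "real set"
  assumes "convex I" "bounded I" "I \<noteq> {}"
  shows "{Inf I<..<Sup I} \<subseteq> I" "I \<subseteq> {Inf I..Sup I}"
proof -
  have bd: "bdd_above I" "bdd_below I" using assms(2) by (auto simp: bounded_imp_bdd_above bounded_imp_bdd_below)
  show "{Inf I<..<Sup I} \<subseteq> I"
  proof
    fix z assume "z \<in> {Inf I<..<Sup I}"
    then obtain a c where "a \<in> I" "a < z" "c \<in> I" "z < c"
      using cInf_less_iff[OF assms(3) bd(2)] less_cSup_iff[OF assms(3) bd(1)] by auto
    then show "z \<in> I" using assms(1) unfolding is_interval_convex_1[symmetric] is_interval_1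
      by (meson less_imp_le)
  qed
  show "I \<subseteq> {Inf I..Sup I}" using bd by (auto intro: cInf_lower cSup_upper)
qed

lemma between_real:
  fixes a c \<theta> :: real
  assumes "a < c" "0 < \<theta>" "\<theta> < 1"
  shows "a + \<theta> * (c - a) \<in> {a<..<c}"
proof -
  have "0 < \<theta> * (c - a)" "0 < (1 - \<theta>) * (c - a)" using assms by auto
  then show ?thesis by (auto simp: algebra_simps)
qed

text \<open>The one-dimensional Brunn--Minkowski inequality. Between intervals it is an equality of lengths,
  and no measurability of a Minkowski sum is at stake, as \<open>H\<close> only has to contain the open interval
  between the combined end points.\<close>

lemma emeasure_Minkowski_combination:
  fixes I J H :: "real set"
  assumes I: "convex I" "bounded I" "I \<noteq> {}" and J: "convex J" "bounded J" "J \<noteq> {}"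
    and H: "H \<in> sets borel" and u: "0 < u" "u < 1"
    and sub: "\<And>x y. x \<in> I \<Longrightarrow> y \<in> J \<Longrightarrow> (1 - u) * x + u * y \<in> H"
  shows "ennreal (1 - u) * emeasure lborel I + ennreal u * emeasure lborel J \<le> emeasure lborel H"
proof -
  let ?a = "Inf I" and ?c = "Sup I" and ?a' = "Inf J" and ?c' = "Sup J"
  note iI = convex_real_between_Inf_Sup[OF I] and iJ = convex_real_between_Inf_Sup[OF J]
  have le: "?a \<le> ?c" "?a' \<le> ?c'" using iI(2) I(3) iJ(2) J(3) by (auto intro: order_trans)
  have pick: "\<exists>x\<in>I. x = ?a + \<theta> * (?c - ?a)" if "0 < \<theta>" "\<theta> < 1" for \<theta>
  proof (cases "?a < ?c")
    case True
    then have "?a + \<theta> * (?c - ?a) \<in> {?a<..<?c}" using that by (rule between_real)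
    then show ?thesis using iI(1) by blast
  next
    case False
    then have "?a = ?c" using le by simp
    then have "I = {?a}" using iI(2) I(3) by auto
    then show ?thesis using \<open>?a = ?c\<close> by auto
  qed
  have pick': "\<exists>x\<in>J. x = ?a' + \<theta> * (?c' - ?a')" if "0 < \<theta>" "\<theta> < 1" for \<theta>
  proof (cases "?a' < ?c'")
    case True
    then have "?a' + \<theta> * (?c' - ?a') \<in> {?a'<..<?c'}" using that by (rule between_real)
    then show ?thesis using iJ(1) by blast
  next
    case False
    then have "?a' = ?c'" using le by simp
    then have "J = {?a'}" using iJ(2) J(3) by auto
    then show ?thesis using \<open>?a' = ?c'\<close> by auto
  qed
  let ?lo = "(1 - u) * ?a + u * ?a'" and ?hi = "(1 - u) * ?c + u * ?c'"
  have "{?lo<..<?hi} \<subseteq> H"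
  proof
    fix z assume z: "z \<in> {?lo<..<?hi}"
    define \<theta> where "\<theta> = (z - ?lo) / (?hi - ?lo)"
    have \<theta>: "0 < \<theta>" "\<theta> < 1" "z = ?lo + \<theta> * (?hi - ?lo)" using z by (auto simp: \<theta>_def)
    have "?a + \<theta> * (?c - ?a) \<in> I" "?a' + \<theta> * (?c' - ?a') \<in> J"
      using pick pick' \<theta>(1,2) by blast+
    from sub[OF this]
    have "(1 - u) * (?a + \<theta> * (?c - ?a)) + u * (?a' + \<theta> * (?c' - ?a')) \<in> H" .
    also have "(1 - u) * (?a + \<theta> * (?c - ?a)) + u * (?a' + \<theta> * (?c' - ?a')) = z"
      by (subst \<theta>(3)) (simp add: algebra_simps)
    finally show "z \<in> H" .
  qed
  then have "emeasure lborel {?lo<..<?hi} \<le> emeasure lborel H" by (rule emeasure_mono) (simp add: H)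
  moreover have "?lo \<le> ?hi" using le u by (intro add_mono mult_left_mono) auto
  ultimately have 1: "ennreal (?hi - ?lo) \<le> emeasure lborel H" by simp
  have "emeasure lborel I \<le> emeasure lborel {?a..?c}" using iI(2) by (rule emeasure_mono) simp
  then have 2: "emeasure lborel I \<le> ennreal (?c - ?a)" using le by simp
  have "emeasure lborel J \<le> emeasure lborel {?a'..?c'}" using iJ(2) by (rule emeasure_mono) simp
  then have 3: "emeasure lborel J \<le> ennreal (?c' - ?a')" using le by simp
  have "ennreal (1 - u) * emeasure lborel I + ennreal u * emeasure lborel J
      \<le> ennreal (1 - u) * ennreal (?c - ?a) + ennreal u * ennreal (?c' - ?a')"
    using 2 3 by (intro add_mono mult_left_mono) auto
  also have "\<dots> = ennreal (?hi - ?lo)"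
  proof -
    have "?hi - ?lo = (1 - u) * (?c - ?a) + u * (?c' - ?a')" by (simp add: algebra_simps)
    then show ?thesis using u le by (simp add: ennreal_mult ennreal_plus)
  qed
  finally show ?thesis using 1 by simp
qed

text \<open>When both suprema are \<open>1\<close>, the superlevel sets of \<open>f\<close> and \<open>g\<close> at every level below \<open>1\<close> are nonempty,
  and their Minkowski combination lies in the superlevel set of \<open>h\<close>. Integrating over the levels gives
  an arithmetic mean, which is stronger than the geometric mean of the general inequality.\<close>

lemma prekopa_leindler_normalized:
  fixes f g h :: "real \<Rightarrow> real"
  assumes meas [measurable]: "f \<in> borel_measurable borel" "g \<in> borel_measurable borel" "h \<in> borel_measurable borel"
    and nn: "\<And>x. 0 \<le> f x" "\<And>x. 0 \<le> g x" "\<And>x. 0 \<le> h x"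
    and le1: "\<And>x. f x \<le> 1" "\<And>x. g x \<le> 1"
    and sup1: "\<And>s. s < 1 \<Longrightarrow> \<exists>x. s < f x" "\<And>s. s < 1 \<Longrightarrow> \<exists>x. s < g x"
    and cvx: "\<And>s. 0 < s \<Longrightarrow> convex {x. s < f x}" "\<And>s. 0 < s \<Longrightarrow> convex {x. s < g x}"
    and bdd: "\<And>s. 0 < s \<Longrightarrow> bounded {x. s < f x}" "\<And>s. 0 < s \<Longrightarrow> bounded {x. s < g x}"
    and u: "0 < u" "u < 1"
    and fgh: "\<And>x y. f x powr (1 - u) * g y powr u \<le> h ((1 - u) * x + u * y)"
  shows "ennreal (1 - u) * (\<integral>\<^sup>+ x. f x \<partial>lborel) + ennreal u * (\<integral>\<^sup>+ x. g x \<partial>lborel) \<le> (\<integral>\<^sup>+ x. h x \<partial>lborel)"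
proof -
  have [measurable]: "(\<lambda>s. emeasure lborel {x. s < f x}) \<in> borel_measurable lborel"
      "(\<lambda>s. emeasure lborel {x. s < g x}) \<in> borel_measurable lborel"
    by measurable
  have "ennreal (1 - u) * (\<integral>\<^sup>+ x. f x \<partial>lborel) + ennreal u * (\<integral>\<^sup>+ x. g x \<partial>lborel)
    = (\<integral>\<^sup>+ s. ennreal (1 - u) * (emeasure lborel {x. s < f x} * indicator {0..} s)
           + ennreal u * (emeasure lborel {x. s < g x} * indicator {0..} s) \<partial>lborel)"
    unfolding nn_integral_layer_cake[OF meas(1) nn(1)] nn_integral_layer_cake[OF meas(2) nn(2)]
    by (simp add: nn_integral_add nn_integral_cmult)
  also have "\<dots> \<le> (\<integral>\<^sup>+ s. emeasure lborel {x. s < h x} * indicator {0..} s \<partial>lborel)"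
  proof (rule nn_integral_mono_AE)
    have "AE s in lborel. s \<noteq> (0::real)" by (rule AE_lborel_singleton)
    then show "AE s in lborel. ennreal (1 - u) * (emeasure lborel {x. s < f x} * indicator {0..} s)
           + ennreal u * (emeasure lborel {x. s < g x} * indicator {0..} s)
        \<le> emeasure lborel {x. s < h x} * indicator {0..} s"
    proof (rule AE_mp, intro AE_I2 impI)
      fix s :: real assume "s \<noteq> 0"
      show "ennreal (1 - u) * (emeasure lborel {x. s < f x} * indicator {0..} s)
           + ennreal u * (emeasure lborel {x. s < g x} * indicator {0..} s)
        \<le> emeasure lborel {x. s < h x} * indicator {0..} s"
      proof (cases "0 < s \<and> s < 1")
        case True
        have "ennreal (1 - u) * emeasure lborel {x. s < f x} + ennreal u * emeasure lborel {x. s < g x}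
            \<le> emeasure lborel {x. s < h x}"
        proof (rule emeasure_Minkowski_combination)
          fix x y assume xy: "x \<in> {x. s < f x}" "y \<in> {x. s < g x}"
          have "s = s powr (1 - u) * s powr u" using True by (simp add: powr_add[symmetric])
          also have "\<dots> < f x powr (1 - u) * g y powr u"
            using xy True u by (intro mult_strict_mono powr_less_mono2) auto
          also have "\<dots> \<le> h ((1 - u) * x + u * y)" by (rule fgh)
          finally show "(1 - u) * x + u * y \<in> {x. s < h x}" by simp
        qed (use True cvx bdd sup1 u in auto)
        then show ?thesis using True by simp
      next
        case False
        then have "s < 0 \<or> 1 \<le> s" using \<open>s \<noteq> 0\<close> by auto
        then show ?thesis
        proof
          assume "1 \<le> s"
          then have "{x. s < f x} = {}" "{x. s < g x} = {}" using le1 by (auto simp: not_less intro: order_trans)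
          then show ?thesis by simp
        qed simp
      qed
    qed
  qed
  also have "\<dots> = (\<integral>\<^sup>+ x. h x \<partial>lborel)"
    by (rule nn_integral_layer_cake[OF meas(3) nn(3), symmetric])
  finally show ?thesis .
qed

text \<open>Reduction to suprema \<open>1\<close> by homogeneity, followed by the inequality of the weighted means.\<close>

lemma prekopa_leindler_real:
  fixes f g h :: "real \<Rightarrow> real"
  assumes meas [measurable]: "f \<in> borel_measurable borel" "g \<in> borel_measurable borel" "h \<in> borel_measurable borel"
    and nn: "\<And>x. 0 \<le> f x" "\<And>x. 0 \<le> g x" "\<And>x. 0 \<le> h x"
    and bd: "bdd_above (range f)" "bdd_above (range g)"
    and cvx: "\<And>s. 0 < s \<Longrightarrow> convex {x. s < f x}" "\<And>s. 0 < s \<Longrightarrow> convex {x. s < g x}"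
    and bdd: "\<And>s. 0 < s \<Longrightarrow> bounded {x. s < f x}" "\<And>s. 0 < s \<Longrightarrow> bounded {x. s < g x}"
    and u: "0 < u" "u < 1"
    and fgh: "\<And>x y. f x powr (1 - u) * g y powr u \<le> h ((1 - u) * x + u * y)"
    and fin: "(\<integral>\<^sup>+ x. f x \<partial>lborel) < \<infinity>" "(\<integral>\<^sup>+ x. g x \<partial>lborel) < \<infinity>" "(\<integral>\<^sup>+ x. h x \<partial>lborel) < \<infinity>"
  shows "enn2real (\<integral>\<^sup>+ x. f x \<partial>lborel) powr (1 - u) * enn2real (\<integral>\<^sup>+ x. g x \<partial>lborel) powr u
       \<le> enn2real (\<integral>\<^sup>+ x. h x \<partial>lborel)"
proof -
  let ?F = "enn2real (\<integral>\<^sup>+ x. f x \<partial>lborel)" and ?G = "enn2real (\<integral>\<^sup>+ x. g x \<partial>lborel)"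
    and ?H = "enn2real (\<integral>\<^sup>+ x. h x \<partial>lborel)"
  define a where "a = Sup (range f)"
  define c where "c = Sup (range g)"
  have fa: "f x \<le> a" for x unfolding a_def using bd(1) by (auto intro: cSup_upper)
  have gc: "g x \<le> c" for x unfolding c_def using bd(2) by (auto intro: cSup_upper)
  have a0: "0 \<le> a" using fa nn(1) order_trans by blast
  have c0: "0 \<le> c" using gc nn(2) order_trans by blast
  show ?thesis
  proof (cases "a = 0 \<or> c = 0")
    case True
    then have "(\<forall>x. f x = 0) \<or> (\<forall>x. g x = 0)" using fa gc nn by (metis order_antisym)
    then show ?thesis by auto
  next
    case False
    then have a: "a > 0" and c: "c > 0" using a0 c0 by auto
    define m where "m = a powr (1 - u) * c powr u"
    have m: "m > 0" using a c by (simp add: m_def)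
    have supf: "\<exists>x. s < f x / a" if "s < 1" for s
    proof -
      have "s * a < Sup (range f)" using that a by (simp add: a_def[symmetric])
      then obtain y where "y \<in> range f" "s * a < y" using less_cSupD[of "range f"] by blast
      then show ?thesis using a by (auto simp: field_simps)
    qed
    have supg: "\<exists>x. s < g x / c" if "s < 1" for s
    proof -
      have "s * c < Sup (range g)" using that c by (simp add: c_def[symmetric])
      then obtain y where "y \<in> range g" "s * c < y" using less_cSupD[of "range g"] by blast
      then show ?thesis using c by (auto simp: field_simps)
    qed
    have lev: "{x. s < f x / a} = {x. s * a < f x}" "{x. s < g x / c} = {x. s * c < g x}" for s
      using a c by (auto simp: field_simps)
    have "ennreal (1 - u) * (\<integral>\<^sup>+ x. f x / a \<partial>lborel) + ennreal u * (\<integral>\<^sup>+ x. g x / c \<partial>lborel) \<le> (\<integral>\<^sup>+ x. h x / m \<partial>lborel)"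
    proof (rule prekopa_leindler_normalized)
      fix x y
      have "(f x / a) powr (1 - u) * (g y / c) powr u = (f x powr (1 - u) * g y powr u) / m"
        using a c nn by (simp add: m_def powr_divide)
      also have "\<dots> \<le> h ((1 - u) * x + u * y) / m" using fgh m by (intro divide_right_mono) auto
      finally show "(f x / a) powr (1 - u) * (g y / c) powr u \<le> h ((1 - u) * x + u * y) / m" .
    qed (use a c m nn fa gc supf supg cvx bdd u in \<open>auto simp: lev\<close>)
    moreover have "(\<integral>\<^sup>+ x. f x / a \<partial>lborel) = ennreal (?F / a)"
      using a fin(1) by (simp add: divide_ennreal[symmetric] nn nn_integral_divide ennreal_enn2real_if less_top)
    moreover have "(\<integral>\<^sup>+ x. g x / c \<partial>lborel) = ennreal (?G / c)"
      using c fin(2) by (simp add: divide_ennreal[symmetric] nn nn_integral_divide ennreal_enn2real_if less_top)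
    moreover have "(\<integral>\<^sup>+ x. h x / m \<partial>lborel) = ennreal (?H / m)"
      using m fin(3) by (simp add: divide_ennreal[symmetric] nn nn_integral_divide ennreal_enn2real_if less_top)
    ultimately have "ennreal ((1 - u) * (?F / a) + u * (?G / c)) \<le> ennreal (?H / m)"
      using a c u by (simp add: ennreal_mult ennreal_plus del: times_divide_eq_right)
    then have key: "(1 - u) * (?F / a) + u * (?G / c) \<le> ?H / m"
      using m by (subst (asm) ennreal_le_iff) auto
    have "(?F / a) powr (1 - u) * (?G / c) powr u \<le> (1 - u) * (?F / a) + u * (?G / c)"
    proof (cases "?F = 0 \<or> ?G = 0")
      case True
      then show ?thesis using a c u by auto
    next
      case False
      then have "?F / a > 0" "?G / c > 0" using a c by (auto simp: less_le)
      then show ?thesis using u Youngs_inequality_0[of "1 - u" u "?F / a" "?G / c"] by simp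
    qed
    with key have "(?F / a) powr (1 - u) * (?G / c) powr u \<le> ?H / m" by simp
    then have "(?F powr (1 - u) * ?G powr u) / m \<le> ?H / m"
      using a c by (simp add: m_def powr_divide)
    then show ?thesis using m by (simp add: divide_le_cancel)
  qed
qed

definition log_concave :: "('a::real_vector \<Rightarrow> real) \<Rightarrow> bool" where
  "log_concave \<phi> \<longleftrightarrow> (\<forall>x. 0 \<le> \<phi> x) \<and>
     (\<forall>x y u. 0 < u \<and> u < 1 \<longrightarrow> \<phi> x powr (1 - u) * \<phi> y powr u \<le> \<phi> ((1 - u) *\<^sub>R x + u *\<^sub>R y))"

lemma log_concaveD:
  assumes "log_concave \<phi>"
  shows "0 \<le> \<phi> x"
    and "0 < u \<Longrightarrow> u < 1 \<Longrightarrow> \<phi> x powr (1 - u) * \<phi> y powr u \<le> \<phi> ((1 - u) *\<^sub>R x + u *\<^sub>R y)"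
  using assms unfolding log_concave_def by blast+

lemma log_concave_superlevel_convex:
  assumes \<phi>: "log_concave \<phi>" and s: "0 \<le> s"
  shows "convex {x. s < \<phi> x}"
proof (rule convexI)
  fix x y and v u :: real
  assume xy: "x \<in> {x. s < \<phi> x}" "y \<in> {x. s < \<phi> x}" and vu: "0 \<le> v" "0 \<le> u" "v + u = 1"
  show "v *\<^sub>R x + u *\<^sub>R y \<in> {x. s < \<phi> x}"
  proof (cases "u = 0 \<or> v = 0")
    case True then show ?thesis using xy vu by auto
  next
    case False
    then have u: "0 < u" "u < 1" "v = 1 - u" using vu by auto
    let ?m = "min (\<phi> x) (\<phi> y)"
    have m: "s < ?m" "0 < ?m" using xy s by auto
    have "?m = ?m powr (1 - u) * ?m powr u" using m by (simp add: powr_add[symmetric])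
    also have "\<dots> \<le> \<phi> x powr (1 - u) * \<phi> y powr u"
      using m u by (intro mult_mono powr_mono2) auto
    also have "\<dots> \<le> \<phi> (v *\<^sub>R x + u *\<^sub>R y)" using log_concaveD(2)[OF \<phi> u(1,2)] u(3) by simp
    finally have "?m \<le> \<phi> (v *\<^sub>R x + u *\<^sub>R y)" .
    with m(1) have "s < \<phi> (v *\<^sub>R x + u *\<^sub>R y)" by (rule less_le_trans)
    then show ?thesis by simp
  qed
qed

text \<open>Decay along every coset of the span of the directions \<open>b i\<close>, with constants that may depend on the
  coset. This weak form passes to marginals; it keeps the integrals finite and the superlevel sets on
  each line bounded.\<close>

definition exp_decay :: "(nat \<Rightarrow> 'a::real_vector) \<Rightarrow> nat set \<Rightarrow> ('a \<Rightarrow> real) \<Rightarrow> bool" where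
  "exp_decay b S \<phi> \<longleftrightarrow>
     (\<forall>x. \<exists>B c. c > 0 \<and> (\<forall>t. \<phi> (x + (\<Sum>i\<in>S. t i *\<^sub>R b i)) \<le> B * exp (- c * (\<Sum>i\<in>S. \<bar>t i\<bar>))))"

lemma nn_integral_exp_abs_finite:
  assumes c: "c > (0::real)"
  shows "(\<integral>\<^sup>+ s. ennreal (exp (- c * \<bar>s\<bar>)) \<partial>lborel) < \<infinity>"
proof -
  let ?e = "\<lambda>x::real. ennreal (x ^ 0 * exp (- x)) * indicator {0..} x"
  have 1: "(\<integral>\<^sup>+ s. ?e s \<partial>lborel) = 1"
    using nn_intergal_power_times_exp_Ici[of 0] by simp
  have 2: "ennreal c * (\<integral>\<^sup>+ s. ?e (c * s) \<partial>lborel) = 1"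
    using nn_integral_real_affine[of ?e c 0] c 1 by simp
  have 3: "ennreal c * (\<integral>\<^sup>+ s. ?e (- c * s) \<partial>lborel) = 1"
    using nn_integral_real_affine[of ?e "- c" 0] c 1 by simp
  have "(\<integral>\<^sup>+ s. ennreal (exp (- c * \<bar>s\<bar>)) \<partial>lborel) \<le> (\<integral>\<^sup>+ s. ?e (c * s) + ?e (- c * s) \<partial>lborel)"
    using c by (intro nn_integral_mono) (auto split: split_indicator simp: abs_if zero_le_mult_iff mult_le_0_iff)
  also have "\<dots> = (\<integral>\<^sup>+ s. ?e (c * s) \<partial>lborel) + (\<integral>\<^sup>+ s. ?e (- c * s) \<partial>lborel)"
    by (rule nn_integral_add) measurable
  also have "\<dots> < \<infinity>"
  proof -
    have "(\<integral>\<^sup>+ s. ?e (c * s) \<partial>lborel) \<noteq> \<infinity>" 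
    proof
      assume "(\<integral>\<^sup>+ s. ?e (c * s) \<partial>lborel) = \<infinity>"
      then show False using 2 c by (simp add: ennreal_mult_top)
    qed
    moreover have "(\<integral>\<^sup>+ s. ?e (- c * s) \<partial>lborel) \<noteq> \<infinity>"
    proof
      assume "(\<integral>\<^sup>+ s. ?e (- c * s) \<partial>lborel) = \<infinity>"
      then show False using 3 c by (simp add: ennreal_mult_top)
    qed
    ultimately show ?thesis by (simp add: less_top[symmetric])
  qed
  finally show ?thesis .
qed

lemma bounded_superlevel_of_decay:
  fixes f :: "real \<Rightarrow> real"
  assumes c: "c > 0" and f: "\<And>t. f t \<le> B * exp (- c * \<bar>t\<bar>)" and s: "0 < s"
  shows "bounded {t. s < f t}"
proof -
  have "\<bar>t\<bar> \<le> ln (B / s) / c" if "s < f t" for t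
  proof -
    have 1: "s < B * exp (- c * \<bar>t\<bar>)" using that f[of t] by simp
    then have B: "B > 0" using s by (smt (verit) exp_gt_zero mult_nonpos_nonneg)
    have "exp (c * \<bar>t\<bar>) < B / s" using 1 s by (simp add: exp_minus field_simps)
    then have "c * \<bar>t\<bar> < ln (B / s)" using B s by (metis divide_pos_pos exp_less_cancel_iff exp_ln)
    then show ?thesis using c by (simp add: field_simps)
  qed
  then show ?thesis unfolding bounded_iff by auto
qed

text \<open>Prekopa's theorem. The directions are integrated out one at a time, and each step is the
  one-dimensional inequality of Prekopa and Leindler on three parallel lines.\<close>

lemma log_concave_fiber_integral:
  fixes b :: "nat \<Rightarrow> 'a::euclidean_space"
  assumes "finite S" "\<phi> \<in> borel_measurable borel" "log_concave \<phi>" "exp_decay b S \<phi>"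
  shows "(\<forall>x. fiber_integral b S (\<lambda>y. ennreal (\<phi> y)) x < \<infinity>)
       \<and> log_concave (\<lambda>x. enn2real (fiber_integral b S (\<lambda>y. ennreal (\<phi> y)) x))"
  using assms
proof (induction S arbitrary: \<phi>)
  case empty
  then show ?case by (simp add: log_concaveD)
next
  case (insert i S)
  note [measurable] = insert.prems(1)
  note nn = log_concaveD(1)[OF insert.prems(2)]
  define \<Psi> where "\<Psi> y = (\<integral>\<^sup>+ s. ennreal (\<phi> (y + s *\<^sub>R b i)) \<partial>lborel)" for y
  define \<psi> where "\<psi> y = enn2real (\<Psi> y)" for y
  have [measurable]: "\<Psi> \<in> borel_measurable borel"
    unfolding \<Psi>_def by (rule measurable_line_integral) measurable
  then have \<psi>_meas: "\<psi> \<in> borel_measurable borel" unfolding \<psi>_def by measurable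
  \<comment> \<open>The parameter of the direction \<open>b i\<close> is split off from the others.\<close>
  have sum_upd: "(\<Sum>j\<in>insert i S. (t(i := s)) j *\<^sub>R b j) = (\<Sum>j\<in>S. t j *\<^sub>R b j) + s *\<^sub>R b i" for t s
  proof -
    have "(\<Sum>j\<in>S. (t(i := s)) j *\<^sub>R b j) = (\<Sum>j\<in>S. t j *\<^sub>R b j)"
      using insert.hyps by (intro sum.cong) auto
    then show ?thesis using insert.hyps by (simp add: add.commute)
  qed
  have abs_upd: "(\<Sum>j\<in>insert i S. \<bar>(t(i := s)) j\<bar>) = (\<Sum>j\<in>S. \<bar>t j\<bar>) + \<bar>s\<bar>" for t :: "nat \<Rightarrow> real" and s
  proof -
    have "(\<Sum>j\<in>S. \<bar>(t(i := s)) j\<bar>) = (\<Sum>j\<in>S. \<bar>t j\<bar>)"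
      using insert.hyps by (intro sum.cong) auto
    then show ?thesis using insert.hyps by (simp add: add.commute)
  qed
  have dec: "\<exists>B c. c > 0 \<and> (\<forall>t s. \<phi> (x + (\<Sum>j\<in>S. t j *\<^sub>R b j) + s *\<^sub>R b i) \<le> B * exp (- c * (\<Sum>j\<in>S. \<bar>t j\<bar>)) * exp (- c * \<bar>s\<bar>))" for x
  proof -
    obtain B c where c: "c > 0" and
      *: "\<And>t. \<phi> (x + (\<Sum>j\<in>insert i S. t j *\<^sub>R b j)) \<le> B * exp (- c * (\<Sum>j\<in>insert i S. \<bar>t j\<bar>))"
      using insert.prems(3) unfolding exp_decay_def by meson
    have "\<phi> (x + (\<Sum>j\<in>S. t j *\<^sub>R b j) + s *\<^sub>R b i) \<le> B * exp (- c * (\<Sum>j\<in>S. \<bar>t j\<bar>)) * exp (- c * \<bar>s\<bar>)" for t s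
      using *[of "t(i := s)"] unfolding sum_upd abs_upd
      by (simp add: add.assoc distrib_left exp_add mult.assoc exp_diff divide_inverse exp_minus)
    then show ?thesis using c by blast
  qed
  have line: "\<exists>B c. c > 0 \<and> (\<forall>s. \<phi> (x + s *\<^sub>R b i) \<le> B * exp (- c * \<bar>s\<bar>))" for x
  proof -
    obtain B c where "c > 0" and
      *: "\<And>t s. \<phi> (x + (\<Sum>j\<in>S. t j *\<^sub>R b j) + s *\<^sub>R b i) \<le> B * exp (- c * (\<Sum>j\<in>S. \<bar>t j\<bar>)) * exp (- c * \<bar>s\<bar>)"
      using dec[of x] by metis
    moreover have "\<phi> (x + s *\<^sub>R b i) \<le> B * exp (- c * \<bar>s\<bar>)" for s
      using *[of "\<lambda>_. 0" s] by simp
    ultimately show ?thesis by blast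
  qed
  have le_int: "\<Psi> y \<le> ennreal B * (\<integral>\<^sup>+ s. ennreal (exp (- c * \<bar>s\<bar>)) \<partial>lborel)"
    if "\<And>s. \<phi> (y + s *\<^sub>R b i) \<le> B * exp (- c * \<bar>s\<bar>)" for y B c
  proof -
    have "0 \<le> B" using that[of 0] nn[of y] by simp
    have "\<Psi> y \<le> (\<integral>\<^sup>+ s. ennreal B * ennreal (exp (- c * \<bar>s\<bar>)) \<partial>lborel)"
      unfolding \<Psi>_def using that \<open>0 \<le> B\<close>
      by (intro nn_integral_mono) (simp add: ennreal_mult[symmetric] ennreal_leI)
    then show ?thesis by (simp add: nn_integral_cmult)
  qed
  have \<Psi>_fin: "\<Psi> y < \<infinity>" for y
  proof -
    obtain B c where "c > 0" "\<And>s. \<phi> (y + s *\<^sub>R b i) \<le> B * exp (- c * \<bar>s\<bar>)" using line by metis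
    then have "\<Psi> y \<le> ennreal B * (\<integral>\<^sup>+ s. ennreal (exp (- c * \<bar>s\<bar>)) \<partial>lborel)"
        and "(\<integral>\<^sup>+ s. ennreal (exp (- c * \<bar>s\<bar>)) \<partial>lborel) < \<infinity>"
      using le_int[of y B c] nn_integral_exp_abs_finite[of c] by auto
    then show ?thesis by (simp add: ennreal_mult_less_top le_less_trans)
  qed
  have \<Psi>_eq: "\<Psi> y = ennreal (\<psi> y)" for y using \<Psi>_fin[of y] by (simp add: \<psi>_def)
  have "log_concave \<psi>"
    unfolding log_concave_def
  proof (intro conjI allI impI)
    show "0 \<le> \<psi> x" for x by (simp add: \<psi>_def)
    fix x y u assume u: "0 < u \<and> u < (1::real)"
    obtain B c where c: "c > 0" and B: "\<And>s. \<phi> (x + s *\<^sub>R b i) \<le> B * exp (- c * \<bar>s\<bar>)" using line by metis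
    obtain B' c' where c': "c' > 0" and B': "\<And>s. \<phi> (y + s *\<^sub>R b i) \<le> B' * exp (- c' * \<bar>s\<bar>)" using line by metis
    have bdd: "bdd_above (range f)" if "\<And>s. f s \<le> B * exp (- c * \<bar>s\<bar>)" "c > 0" "\<And>s. 0 \<le> f s" for f :: "real \<Rightarrow> real" and B c
    proof (rule bdd_aboveI2)
      fix s
      have "0 \<le> B" using that(1)[of 0] that(3)[of 0] by simp
      then have "B * exp (- c * \<bar>s\<bar>) \<le> B * 1" using that(2) by (intro mult_left_mono) auto
      then show "f s \<le> B" using that(1)[of s] by simp
    qed
    have cvx: "convex {s. r < \<phi> (z + s *\<^sub>R b i)}" if "0 < r" for r z
    proof (rule convexI)
      fix s s' v w :: real
      assume *: "s \<in> {s. r < \<phi> (z + s *\<^sub>R b i)}" "s' \<in> {s. r < \<phi> (z + s *\<^sub>R b i)}" "0 \<le> v" "0 \<le> w" "v + w = 1"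
      have "v *\<^sub>R (z + s *\<^sub>R b i) + w *\<^sub>R (z + s' *\<^sub>R b i) \<in> {x. r < \<phi> x}"
        using log_concave_superlevel_convex[OF insert.prems(2), of r] that *
        unfolding convex_def by auto
      moreover have "v *\<^sub>R (z + s *\<^sub>R b i) + w *\<^sub>R (z + s' *\<^sub>R b i) = z + (v * s + w * s') *\<^sub>R b i"
        using *(5) by (simp add: algebra_simps scaleR_add_left[symmetric] flip: scaleR_add_left)
      ultimately show "v *\<^sub>R s + w *\<^sub>R s' \<in> {s. r < \<phi> (z + s *\<^sub>R b i)}" by simp
    qed
    show "\<psi> x powr (1 - u) * \<psi> y powr u \<le> \<psi> ((1 - u) *\<^sub>R x + u *\<^sub>R y)"
      unfolding \<psi>_def \<Psi>_def
    proof (rule prekopa_leindler_real)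
      fix s s' :: real
      have "(1 - u) *\<^sub>R (x + s *\<^sub>R b i) + u *\<^sub>R (y + s' *\<^sub>R b i)
          = (1 - u) *\<^sub>R x + u *\<^sub>R y + ((1 - u) * s + u * s') *\<^sub>R b i"
        by (simp add: algebra_simps)
      then show "\<phi> (x + s *\<^sub>R b i) powr (1 - u) * \<phi> (y + s' *\<^sub>R b i) powr u
          \<le> \<phi> ((1 - u) *\<^sub>R x + u *\<^sub>R y + ((1 - u) * s + u * s') *\<^sub>R b i)"
        using log_concaveD(2)[OF insert.prems(2), of u] u by metis
    next
      show "bounded {s'. s < \<phi> (x + s' *\<^sub>R b i)}" if "0 < s" for s
        by (rule bounded_superlevel_of_decay[OF c B that])
      show "bounded {s'. s < \<phi> (y + s' *\<^sub>R b i)}" if "0 < s" for s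
        by (rule bounded_superlevel_of_decay[OF c' B' that])
      show "bdd_above (range (\<lambda>s. \<phi> (x + s *\<^sub>R b i)))" by (rule bdd[OF B c]) (rule nn)
      show "bdd_above (range (\<lambda>s. \<phi> (y + s *\<^sub>R b i)))" by (rule bdd[OF B' c']) (rule nn)
    qed (use cvx u nn \<Psi>_fin[unfolded \<Psi>_def] in auto)
  qed
  moreover have "exp_decay b S \<psi>"
    unfolding exp_decay_def
  proof
    fix x
    obtain B c where c: "c > 0" and
      *: "\<And>t s. \<phi> (x + (\<Sum>j\<in>S. t j *\<^sub>R b j) + s *\<^sub>R b i) \<le> B * exp (- c * (\<Sum>j\<in>S. \<bar>t j\<bar>)) * exp (- c * \<bar>s\<bar>)"
      using dec[of x] by metis
    define I where "I = enn2real (\<integral>\<^sup>+ s. ennreal (exp (- c * \<bar>s\<bar>)) \<partial>lborel)"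
    have I: "(\<integral>\<^sup>+ s. ennreal (exp (- c * \<bar>s\<bar>)) \<partial>lborel) = ennreal I"
      using nn_integral_exp_abs_finite[OF c] by (simp add: I_def)
    have B: "0 \<le> B" using *[of "\<lambda>_. 0" 0] nn[of x] by simp
    have "\<psi> (x + (\<Sum>j\<in>S. t j *\<^sub>R b j)) \<le> B * I * exp (- c * (\<Sum>j\<in>S. \<bar>t j\<bar>))" for t
    proof -
      have "\<Psi> (x + (\<Sum>j\<in>S. t j *\<^sub>R b j)) \<le> ennreal (B * exp (- c * (\<Sum>j\<in>S. \<bar>t j\<bar>))) * ennreal I"
        using le_int[OF *[of t]] unfolding I .
      then show ?thesis unfolding \<psi>_def
        using B by (simp add: ennreal_mult[symmetric] I_def mult_ac enn2real_leI)
    qed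
    then show "\<exists>B c. 0 < c \<and> (\<forall>t. \<psi> (x + (\<Sum>i\<in>S. t i *\<^sub>R b i)) \<le> B * exp (- c * (\<Sum>i\<in>S. \<bar>t i\<bar>)))"
      using c by blast
  qed
  moreover have "fiber_integral b (insert i S) (\<lambda>y. ennreal (\<phi> y)) = fiber_integral b S (\<lambda>y. ennreal (\<psi> y))"
    using insert.hyps by (intro ext) (simp add: fiber_integral_insert \<Psi>_eq[symmetric] \<Psi>_def)
  ultimately show ?case using insert.IH[OF \<psi>_meas] by simp
qed

lemma log_concave_ln_ge:
  assumes f: "log_concave f" and u: "0 < u" "u < 1" and pos: "f x > 0" "f y > 0"
  shows "f ((1 - u) *\<^sub>R x + u *\<^sub>R y) > 0"
    and "(1 - u) * ln (f x) + u * ln (f y) \<le> ln (f ((1 - u) *\<^sub>R x + u *\<^sub>R y))"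
proof -
  have le: "f x powr (1 - u) * f y powr u \<le> f ((1 - u) *\<^sub>R x + u *\<^sub>R y)"
    by (rule log_concaveD(2)[OF f u])
  have lt: "0 < f x powr (1 - u) * f y powr u" using pos by simp
  show 1: "f ((1 - u) *\<^sub>R x + u *\<^sub>R y) > 0" using le lt by linarith
  have "(1 - u) * ln (f x) + u * ln (f y) = ln (f x powr (1 - u) * f y powr u)"
    using pos by (simp add: ln_mult ln_powr)
  also have "\<dots> \<le> ln (f ((1 - u) *\<^sub>R x + u *\<^sub>R y))" using le lt by simp
  finally show "(1 - u) * ln (f x) + u * ln (f y) \<le> ln (f ((1 - u) *\<^sub>R x + u *\<^sub>R y))" .
qed

text \<open>Separate the point \<open>(p, ln (f p))\<close> from the convex set below the graph of \<open>ln f\<close>. The separating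
  hyperplane is not vertical because \<open>f\<close> is positive near \<open>p\<close>.\<close>

lemma log_concave_supergradient:
  fixes f :: "'a::euclidean_space \<Rightarrow> real"
  assumes f: "log_concave f" and U: "open U" "p \<in> U" and pos: "\<And>x. x \<in> U \<Longrightarrow> f x > 0"
  shows "\<exists>l. \<forall>y. f y > 0 \<longrightarrow> ln (f y) \<le> ln (f p) + l \<bullet> (y - p)"
proof -
  define H where "H = {(x, s). f x > 0 \<and> s < ln (f x)}"
  have "convex H"
  proof (rule convexI)
    fix z w :: "'a \<times> real" and v u :: real
    assume zw: "z \<in> H" "w \<in> H" and vu: "0 \<le> v" "0 \<le> u" "v + u = 1"
    show "v *\<^sub>R z + u *\<^sub>R w \<in> H"
    proof (cases "u = 0 \<or> v = 0")
      case True then show ?thesis using zw vu by auto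
    next
      case False
      then have u: "0 < u" "u < 1" "v = 1 - u" using vu by auto
      obtain x s y t where z: "z = (x, s)" "w = (y, t)" by fastforce
      have *: "f x > 0" "s < ln (f x)" "f y > 0" "t < ln (f y)" using zw by (auto simp: H_def z)
      have "(1 - u) * s + u * t < (1 - u) * ln (f x) + u * ln (f y)"
        using * u by (intro add_strict_mono mult_strict_left_mono) auto
      with log_concave_ln_ge[OF f u(1,2) *(1,3)] show ?thesis
        by (auto simp: H_def z u(3))
    qed
  qed
  moreover have pp: "f p > 0" using U pos by auto
  then have "(p, ln (f p) - 1) \<in> H" by (simp add: H_def)
  moreover have "H \<inter> {(p, ln (f p))} = {}" by (auto simp: H_def)
  ultimately have "\<exists>a b. a \<noteq> 0 \<and> (\<forall>x\<in>H. inner a x \<le> b) \<and> (\<forall>x\<in>{(p, ln (f p))}. inner a x \<ge> b)"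
    by (intro separating_hyperplane_sets) auto
  then obtain a b where a: "a \<noteq> 0" "\<forall>x\<in>H. inner a x \<le> b" "\<forall>x\<in>{(p, ln (f p))}. inner a x \<ge> b"
    by blast
  obtain a1 a2 where aa: "a = (a1, a2)" by fastforce
  have le: "a1 \<bullet> x + a2 * s \<le> a1 \<bullet> p + a2 * ln (f p)" if "f x > 0" "s < ln (f x)" for x s
    using a(2,3) that by (force simp: aa H_def)
  have a2: "a2 \<ge> 0" using le[of p "ln (f p) - 1"] pp by (simp add: algebra_simps)
  have "a2 \<noteq> 0"
  proof
    assume 0: "a2 = 0"
    then have a1: "a1 \<noteq> 0" using a(1) by (auto simp: aa zero_prod_def)
    obtain e where e: "e > 0" "ball p e \<subseteq> U" using U open_contains_ball by blast
    define x where "x = p + (e / (2 * norm a1)) *\<^sub>R a1"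
    have "norm ((e / (2 * norm a1)) *\<^sub>R a1) = e / 2" using e a1 by simp
    then have "x \<in> U" using e unfolding x_def by (intro subsetD[OF e(2)]) (simp add: dist_norm)
    from le[OF pos[OF this], of "ln (f x) - 1"] have "a1 \<bullet> (x - p) \<le> 0"
      by (simp add: 0 inner_diff_right)
    moreover have "a1 \<bullet> (x - p) = (e / (2 * norm a1)) * (a1 \<bullet> a1)" by (simp add: x_def)
    moreover have "(e / (2 * norm a1)) * (a1 \<bullet> a1) > 0" using e a1 by simp
    ultimately show False by linarith
  qed
  with a2 have a2: "a2 > 0" by simp
  have "ln (f y) \<le> ln (f p) + (- (1 / a2) *\<^sub>R a1) \<bullet> (y - p)" if y: "f y > 0" for y
  proof (rule field_le_epsilon)
    fix e :: real assume "e > 0"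
    then have "a1 \<bullet> y + a2 * (ln (f y) - e) \<le> a1 \<bullet> p + a2 * ln (f p)" using le[OF y, of "ln (f y) - e"] by simp
    moreover have "a2 * (ln (f p) + (a1 \<bullet> (p - y)) / a2) = a2 * ln (f p) + (a1 \<bullet> p - a1 \<bullet> y)"
      using a2 by (simp add: distrib_left inner_diff_right)
    ultimately have "a2 * (ln (f y) - e) \<le> a2 * (ln (f p) + (a1 \<bullet> (p - y)) / a2)" by linarith
    then have "ln (f y) - e \<le> ln (f p) + (a1 \<bullet> (p - y)) / a2" using a2 by simp
    also have "(a1 \<bullet> (p - y)) / a2 = (- (1 / a2) *\<^sub>R a1) \<bullet> (y - p)"
      using a2 by (simp add: inner_diff_right field_simps)
    finally show "ln (f y) \<le> ln (f p) + (- (1 / a2) *\<^sub>R a1) \<bullet> (y - p) + e" by linarith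
  qed
  then show ?thesis by blast
qed

section \<open>Contraction of a weighted cone towards its centroid\<close>

text \<open>A polyhedral cone, cut out by the vectors in \<open>V\<close>, with the weight \<open>exp (- (\<tau> \<bullet> x))\<close>, whose centroid is
  \<open>p\<close>, and a basis \<open>b\<close> whose first \<open>k\<close> vectors are the directions of the marginal. The assumption
  \<open>disint\<close> is the change of variables to the coordinates of this basis.\<close>

locale marginal_setting =
  fixes b :: "nat \<Rightarrow> 'a::euclidean_space" and k :: nat and V :: "'a set"
    and \<tau> p :: 'a and c r :: real
  assumes indep: "independent (b ` {..<DIM('a)})" and inj: "inj_on b {..<DIM('a)}"
    and k: "k \<le> DIM('a)"
    and c: "c > 0"
    and disint: "\<And>g. g \<in> borel_measurable borel \<Longrightarrow>
        (\<integral>\<^sup>+ x. g x \<partial>lborel) = ennreal c * fiber_integral b {..<DIM('a)} g 0"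
    and finV: "finite V"
    and r: "r > 0" and decay: "\<And>x. (\<forall>v\<in>V. 0 \<le> v \<bullet> x) \<Longrightarrow> r * norm x \<le> \<tau> \<bullet> x"
    and p: "\<And>v. v \<in> V \<Longrightarrow> 0 < v \<bullet> p"
    and centroid: "\<And>l. has_bochner_integral lborel
        (\<lambda>x. (if \<forall>v\<in>V. 0 \<le> v \<bullet> x then exp (- (\<tau> \<bullet> x)) else 0) * (l \<bullet> (x - p))) 0"
begin

definition cone :: "'a set" where "cone = {x. \<forall>v\<in>V. 0 \<le> v \<bullet> x}"
definition open_cone :: "'a set" where "open_cone = {x. \<forall>v\<in>V. 0 < v \<bullet> x}"
definition weight :: "'a \<Rightarrow> real" where "weight x = (if x \<in> cone then exp (- (\<tau> \<bullet> x)) else 0)"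
text \<open>The marginal along \<open>M\<close>. Integrals are computed with this extended form, logarithms are taken of the
  real form \<open>marg\<close> below.\<close>

definition fib :: "'a \<Rightarrow> ennreal" where "fib = fiber_integral b {..<k} (\<lambda>x. ennreal (weight x))"
definition marg :: "'a \<Rightarrow> real" where "marg x = enn2real (fib x)"
definition M :: "'a set" where "M = span (b ` {..<k})"

lemma weight_alt: "weight x = (if \<forall>v\<in>V. 0 \<le> v \<bullet> x then exp (- (\<tau> \<bullet> x)) else 0)"
  by (simp add: weight_def cone_def)

lemma closed_cone: "closed cone"
proof -
  have "cone = (\<Inter>v\<in>V. {x. 0 \<le> v \<bullet> x})" by (auto simp: cone_def)
  then show ?thesis by (auto intro!: closed_INT closed_halfspace_ge)
qed

lemma cone_sets [measurable]: "cone \<in> sets borel"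
  using closed_cone by (rule borel_closed)

lemma cone_add: "x \<in> cone \<Longrightarrow> y \<in> cone \<Longrightarrow> x + y \<in> cone"
  by (auto simp: cone_def inner_add_right)

lemma cone_scale: "0 \<le> s \<Longrightarrow> x \<in> cone \<Longrightarrow> s *\<^sub>R x \<in> cone"
  by (auto simp: cone_def)

lemma cone_scale_iff: "0 < s \<Longrightarrow> s *\<^sub>R x \<in> cone \<longleftrightarrow> x \<in> cone"
  by (auto simp: cone_def zero_le_mult_iff)

lemma open_open_cone: "open open_cone"
proof -
  have "open_cone = (\<Inter>v\<in>V. {x. 0 < v \<bullet> x})" by (auto simp: open_cone_def)
  then show ?thesis using finV by (auto intro!: open_INT open_halfspace_gt)
qed

lemma open_cone_subset: "open_cone \<subseteq> cone"
  by (auto simp: open_cone_def cone_def less_imp_le)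

lemma p_in: "p \<in> open_cone" using p by (simp add: open_cone_def)

lemma convex_open_cone: "convex open_cone"
proof -
  have "open_cone = (\<Inter>v\<in>V. {x. 0 < v \<bullet> x})" by (auto simp: open_cone_def)
  then show ?thesis by (auto intro!: convex_INT convex_halfspace_gt)
qed

lemma weight_nonneg: "0 \<le> weight x" by (simp add: weight_def)

lemma weight_measurable [measurable]: "weight \<in> borel_measurable borel"
  unfolding weight_def[abs_def] by measurable

lemma weight_log_concave: "log_concave weight"
  unfolding log_concave_def
proof (intro conjI allI impI weight_nonneg)
  fix x y u assume u: "0 < u \<and> u < (1::real)"
  show "weight x powr (1 - u) * weight y powr u \<le> weight ((1 - u) *\<^sub>R x + u *\<^sub>R y)"
  proof (cases "x \<in> cone \<and> y \<in> cone")
    case True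
    then have "(1 - u) *\<^sub>R x + u *\<^sub>R y \<in> cone" using u by (intro cone_add cone_scale) auto
    then show ?thesis using True
      by (simp add: weight_def powr_def exp_add[symmetric] inner_add_right algebra_simps)
  next
    case False
    then show ?thesis using weight_nonneg by (auto simp: weight_def)
  qed
qed

lemma weight_exp_decay:
  assumes S: "S \<subseteq> {..<DIM('a)}"
  shows "exp_decay b S weight"
proof -
  have fS: "finite S" using S finite_subset by blast
  have "\<exists>g. \<forall>j\<in>{..<DIM('a)}. g \<bullet> b j = (if i = j then 1 else (0::real))" if "i < DIM('a)" for i
  proof -
    obtain h :: "'a \<Rightarrow> real" where h: "linear h" "\<forall>x\<in>b ` {..<DIM('a)}. h x = (if x = b i then 1 else 0)"
      using linear_independent_extend[OF indep, of "\<lambda>x. if x = b i then 1 else (0::real)"] by blast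
    have "h x = adjoint h 1 \<bullet> x" for x using adjoint_works[OF h(1), of x 1] by (simp add: inner_commute)
    moreover have "h (b j) = (if i = j then 1 else 0)" if "j < DIM('a)" for j
      using h(2) that \<open>i < DIM('a)\<close> inj by (auto simp: inj_on_def)
    ultimately show ?thesis by (metis lessThan_iff)
  qed
  then obtain g where g: "\<And>i j. i < DIM('a) \<Longrightarrow> j < DIM('a) \<Longrightarrow> g i \<bullet> b j = (if i = j then 1 else (0::real))"
    by (metis lessThan_iff)
  define N where "N = (\<Sum>i\<in>S. norm (g i)) + 1"
  have N: "N > 0" unfolding N_def by (smt (verit) norm_ge_zero sum_nonneg)
  have sum_le: "(\<Sum>i\<in>S. \<bar>t i\<bar>) \<le> N * norm (\<Sum>i\<in>S. t i *\<^sub>R b i)" for t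
  proof -
    let ?y = "\<Sum>i\<in>S. t i *\<^sub>R b i"
    have "\<bar>t i\<bar> \<le> norm (g i) * norm ?y" if "i \<in> S" for i
    proof -
      have "g i \<bullet> ?y = (\<Sum>j\<in>S. if i = j then t j else 0)"
        unfolding inner_sum_right using S that by (intro sum.cong) (auto simp: g subset_iff)
      also have "\<dots> = t i" using that fS by simp
      finally show ?thesis using Cauchy_Schwarz_ineq2[of "g i" ?y] by simp
    qed
    then have "(\<Sum>i\<in>S. \<bar>t i\<bar>) \<le> (\<Sum>i\<in>S. norm (g i) * norm ?y)" by (rule sum_mono)
    also have "\<dots> = (N - 1) * norm ?y" by (simp add: N_def sum_distrib_right)
    also have "\<dots> \<le> N * norm ?y" by (simp add: mult_right_mono)
    finally show ?thesis .
  qed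
  show ?thesis unfolding exp_decay_def
  proof
    fix x
    have "weight (x + (\<Sum>i\<in>S. t i *\<^sub>R b i)) \<le> exp (r * norm x) * exp (- (r / N) * (\<Sum>i\<in>S. \<bar>t i\<bar>))" for t
    proof (cases "x + (\<Sum>i\<in>S. t i *\<^sub>R b i) \<in> cone")
      case True
      let ?y = "\<Sum>i\<in>S. t i *\<^sub>R b i"
      have 1: "r * norm (x + ?y) \<le> \<tau> \<bullet> (x + ?y)" using decay True by (simp add: cone_def)
      have "r / N * (\<Sum>i\<in>S. \<bar>t i\<bar>) \<le> r / N * (N * norm ?y)" using sum_le[of t] r N by (intro mult_left_mono) auto
      also have "\<dots> = r * norm ?y" using N by simp
      also have "\<dots> \<le> r * (norm (x + ?y) + norm x)"
        using r norm_triangle_ineq4[of "x + ?y" x] by (intro mult_left_mono) auto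
      finally have "- (\<tau> \<bullet> (x + ?y)) \<le> r * norm x + (- (r / N) * (\<Sum>i\<in>S. \<bar>t i\<bar>))"
        using 1 by (simp add: algebra_simps)
      then show ?thesis using True by (simp add: weight_def exp_add[symmetric] del: mult_minus_left)
    qed (simp add: weight_def)
    then show "\<exists>B c. 0 < c \<and> (\<forall>t. weight (x + (\<Sum>i\<in>S. t i *\<^sub>R b i)) \<le> B * exp (- c * (\<Sum>i\<in>S. \<bar>t i\<bar>)))"
      using r N by (intro exI[of _ "exp (r * norm x)"] exI[of _ "r / N"]) auto
  qed
qed

lemma fib_measurable [measurable]: "fib \<in> borel_measurable borel"
  unfolding fib_def by (rule fiber_integral_measurable) auto

lemma marg_measurable [measurable]: "marg \<in> borel_measurable borel"
  unfolding marg_def[abs_def] by measurable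

lemma fib_finite: "fib x < \<infinity>" and marg_log_concave: "log_concave marg"
  using log_concave_fiber_integral[OF _ _ weight_log_concave weight_exp_decay, of "{..<k}"] k
  by (auto simp: fib_def marg_def[abs_def])

lemma fib_eq: "fib x = ennreal (marg x)"
  using fib_finite[of x] by (simp add: marg_def)

lemma marg_nonneg: "0 \<le> marg x" by (simp add: marg_def)

lemma subspace_M: "subspace M" by (simp add: M_def)

lemma fib_shift: "v \<in> M \<Longrightarrow> fib (x + v) = fib x"
  unfolding fib_def M_def by (rule fiber_integral_shift) auto

lemma marg_shift: "v \<in> M \<Longrightarrow> marg (x + v) = marg x"
  by (simp add: marg_def fib_shift)

lemma marg_pos: "x \<in> open_cone \<Longrightarrow> marg x > 0"
proof -
  assume x: "x \<in> open_cone"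
  define U where "U = open_cone \<inter> {y. \<tau> \<bullet> y < \<tau> \<bullet> x + 1}"
  have U: "open U" "x \<in> U" unfolding U_def using x open_open_cone by (auto intro: open_halfspace_lt)
  from U(1) have [measurable]: "U \<in> sets borel" by (rule borel_open)
  have "0 < ennreal (exp (- (\<tau> \<bullet> x + 1))) * fiber_integral b {..<k} (indicator U) x"
    using fiber_integral_open_pos[OF _ U, of "{..<k}" b] by (simp add: ennreal_zero_less_mult_iff)
  also have "\<dots> = fiber_integral b {..<k} (\<lambda>y. ennreal (exp (- (\<tau> \<bullet> x + 1))) * indicator U y) x"
    by (rule fiber_integral_cmult[symmetric]) measurable
  also have "\<dots> \<le> fib x" unfolding fib_def
    by (rule fiber_integral_mono)
       (use open_cone_subset in \<open>auto simp: U_def weight_def split: split_indicator\<close>)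
  finally show ?thesis using fib_eq by simp
qed

text \<open>Functions that are constant along \<open>M\<close> can be integrated against the marginal.\<close>

lemma disintegrate_weight:
  assumes [measurable]: "g \<in> borel_measurable borel" and inv: "\<And>x v. v \<in> M \<Longrightarrow> g (x + v) = g x"
  shows "(\<integral>\<^sup>+ x. ennreal (weight x) * g x \<partial>lborel)
       = ennreal c * fiber_integral b {k..<DIM('a)} (\<lambda>y. fib y * g y) 0"
proof -
  have "fiber_integral b {..<k} (\<lambda>x. ennreal (weight x) * g x) y = fib y * g y" for y
  proof -
    have "(\<Sum>i<k. t i *\<^sub>R b i) \<in> M" for t
      unfolding M_def by (intro span_sum span_scale span_base) auto
    then have "fiber_integral b {..<k} (\<lambda>x. ennreal (weight x) * g x) y
        = fiber_integral b {..<k} (\<lambda>x. g y * ennreal (weight x)) y"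
      by (intro fiber_integral_cong) (simp add: inv mult.commute)
    then show ?thesis by (simp add: fiber_integral_cmult fib_def mult.commute)
  qed
  then have "fiber_integral b {..<k} (\<lambda>x. ennreal (weight x) * g x) = (\<lambda>y. fib y * g y)" by blast
  moreover have I: "{..<DIM('a)} = {..<k} \<union> {k..<DIM('a)}" using k by auto
  moreover have "fiber_integral b ({..<k} \<union> {k..<DIM('a)}) (\<lambda>x. ennreal (weight x) * g x) 0
     = fiber_integral b {k..<DIM('a)} (fiber_integral b {..<k} (\<lambda>x. ennreal (weight x) * g x)) 0"
    by (rule fiber_integral_union) auto
  moreover have "(\<integral>\<^sup>+ x. ennreal (weight x) * g x \<partial>lborel)
      = ennreal c * fiber_integral b {..<DIM('a)} (\<lambda>x. ennreal (weight x) * g x) 0"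
    by (rule disint) measurable
  ultimately show ?thesis by (simp only:)
qed

end

lemma enn2real_inject_finite:
  "x \<noteq> \<infinity> \<Longrightarrow> y \<noteq> \<infinity> \<Longrightarrow> enn2real x = enn2real y \<Longrightarrow> x = y"
  by (cases x; cases y) auto

context marginal_setting
begin

lemma M_decomp: "\<exists>u\<in>M. \<exists>w\<in>span (b ` {k..<DIM('a)}). x = u + w"
proof -
  have "card (b ` {..<DIM('a)}) = DIM('a)" using inj by (simp add: card_image)
  then have "span (b ` {..<DIM('a)}) = UNIV"
    using card_ge_dim_independent[of "b ` {..<DIM('a)}" UNIV] indep by auto
  moreover have "b ` {..<DIM('a)} = b ` {..<k} \<union> b ` {k..<DIM('a)}" using k by (auto simp: image_Un[symmetric])
  ultimately have "x \<in> span (b ` {..<k} \<union> b ` {k..<DIM('a)})" by auto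
  then show ?thesis unfolding span_Un M_def by auto
qed

lemma b_in_M: "i < k \<Longrightarrow> b i \<in> M"
  unfolding M_def by (intro span_base) auto

lemma M_orth: assumes "\<And>i. i < k \<Longrightarrow> l \<bullet> b i = 0" "v \<in> M" shows "l \<bullet> v = 0"
  using assms(2) unfolding M_def
  by (induction rule: span_induct_alt) (auto simp: inner_add_right assms(1))

text \<open>The contraction towards \<open>p\<close> acts on the quotient by \<open>M\<close> only, so that its Jacobian is a power of
  \<open>1 - e\<close> with exponent the codimension of \<open>M\<close>.\<close>

lemma contraction_integral:
  assumes e: "0 < e" "e < 1" and [measurable]: "K \<in> sets borel"
    and inv: "\<And>x v. v \<in> M \<Longrightarrow> x + v \<in> K \<longleftrightarrow> x \<in> K"
  shows "ennreal c * fiber_integral b {k..<DIM('a)} (\<lambda>y. fib ((1 - e) *\<^sub>R y + e *\<^sub>R p) * indicator K y) 0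
     = ennreal ((1 / (1 - e)) ^ (DIM('a) - k))
        * (\<integral>\<^sup>+ x. ennreal (weight x) * indicator K ((1 / (1 - e)) *\<^sub>R (x - e *\<^sub>R p)) \<partial>lborel)"
proof -
  let ?J = "{k..<DIM('a)}"
  let ?r = "1 - e"
  have r: "0 < ?r" using e by simp
  define h where "h x = indicator K ((1 / ?r) *\<^sub>R (x - e *\<^sub>R p)) * (1::ennreal)" for x
  have [measurable]: "h \<in> borel_measurable borel" unfolding h_def by measurable
  have h_inv: "h (x + v) = h x" if "v \<in> M" for x v
  proof -
    have "(1 / ?r) *\<^sub>R (x + v - e *\<^sub>R p) = (1 / ?r) *\<^sub>R (x - e *\<^sub>R p) + (1 / ?r) *\<^sub>R v"
      by (simp add: algebra_simps)
    then show ?thesis using inv[of "(1 / ?r) *\<^sub>R v"] that subspace_M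
      by (simp add: h_def indicator_def subspace_scale)
  qed
  define g where "g x = fib x * h x" for x
  have [measurable]: "g \<in> borel_measurable borel" unfolding g_def by measurable
  have g_inv: "g (x + v) = g x" if "v \<in> M" for x v using that by (simp add: g_def h_inv fib_shift)
  obtain u w where uw: "u \<in> M" "w \<in> span (b ` ?J)" "e *\<^sub>R p = u + w" using M_decomp by blast
  have "fiber_integral b ?J g 0 = fiber_integral b ?J g u"
  proof (rule fiber_integral_cong)
    show "g (0 + (\<Sum>i\<in>?J. t i *\<^sub>R b i)) = g (u + (\<Sum>i\<in>?J. t i *\<^sub>R b i))" for t
      using g_inv[OF uw(1), of "\<Sum>i\<in>?J. t i *\<^sub>R b i"] by (simp add: add.commute)
  qed
  also have "\<dots> = fiber_integral b ?J g (e *\<^sub>R p)"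
    unfolding uw(3) using uw(2) by (intro fiber_integral_shift[symmetric]) auto
  also have "\<dots> = fiber_integral b ?J (\<lambda>y. g (y + e *\<^sub>R p)) (?r *\<^sub>R 0)"
    by (rule fiber_integral_cong) (simp add: add.commute)
  also have "\<dots> = ennreal (?r ^ card ?J) * fiber_integral b ?J (\<lambda>y. g (?r *\<^sub>R y + e *\<^sub>R p)) 0"
    by (rule fiber_integral_scale) (use r in auto)
  also have "fiber_integral b ?J (\<lambda>y. g (?r *\<^sub>R y + e *\<^sub>R p)) 0
      = fiber_integral b ?J (\<lambda>y. fib (?r *\<^sub>R y + e *\<^sub>R p) * indicator K y) 0"
    by (rule fiber_integral_cong) (use r in \<open>simp add: g_def h_def\<close>)
  finally have 1: "fiber_integral b ?J g 0
      = ennreal (?r ^ card ?J) * fiber_integral b ?J (\<lambda>y. fib (?r *\<^sub>R y + e *\<^sub>R p) * indicator K y) 0" .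
  have 2: "(\<integral>\<^sup>+ x. ennreal (weight x) * h x \<partial>lborel) = ennreal c * fiber_integral b ?J g 0"
    unfolding g_def by (rule disintegrate_weight) (auto simp: h_inv)
  have "ennreal ((1 / ?r) ^ (DIM('a) - k)) * (\<integral>\<^sup>+ x. ennreal (weight x) * h x \<partial>lborel)
      = ennreal ((1 / ?r) ^ card ?J) * ennreal (?r ^ card ?J) *
         (ennreal c * fiber_integral b ?J (\<lambda>y. fib (?r *\<^sub>R y + e *\<^sub>R p) * indicator K y) 0)"
    unfolding 2 1 by (simp add: mult_ac)
  also have "ennreal ((1 / ?r) ^ card ?J) * ennreal (?r ^ card ?J) = 1"
    using r by (simp add: ennreal_mult[symmetric] power_mult_distrib[symmetric])
  finally show ?thesis by (simp add: h_def)
qed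

text \<open>The centroid condition for the linear form \<open>l\<close>, split into positive and negative part, in the form
  in which it can be cancelled from an inequality of nonnegative integrals.\<close>

lemma integral_parts:
  "(\<integral>\<^sup>+ x. ennreal (weight x) * ennreal (l \<bullet> (x - p)) \<partial>lborel)
     = (\<integral>\<^sup>+ x. ennreal (weight x) * ennreal (- (l \<bullet> (x - p))) \<partial>lborel)"
  "(\<integral>\<^sup>+ x. ennreal (weight x) * ennreal (l \<bullet> (x - p)) \<partial>lborel) < \<infinity>"
proof -
  let ?f = "\<lambda>x. weight x * (l \<bullet> (x - p))"
  have hb: "has_bochner_integral lborel ?f 0" using centroid[of l] by (simp add: weight_alt)
  then have int: "integrable lborel ?f" and zero: "integral\<^sup>L lborel ?f = 0"
    by (auto simp: has_bochner_integral_iff)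
  have A: "ennreal (weight x) * ennreal (l \<bullet> (x - p)) = ennreal (?f x)"
    "ennreal (weight x) * ennreal (- (l \<bullet> (x - p))) = ennreal (- ?f x)" for x
    using ennreal_mult'[OF weight_nonneg[of x], of "l \<bullet> (x - p)"]
      ennreal_mult'[OF weight_nonneg[of x], of "- (l \<bullet> (x - p))"] by simp_all
  have fin: "(\<integral>\<^sup>+ x. ennreal (?f x) \<partial>lborel) \<noteq> \<infinity>" "(\<integral>\<^sup>+ x. ennreal (- ?f x) \<partial>lborel) \<noteq> \<infinity>"
    using int by (auto simp: real_integrable_def)
  have "enn2real (\<integral>\<^sup>+ x. ennreal (?f x) \<partial>lborel) = enn2real (\<integral>\<^sup>+ x. ennreal (- ?f x) \<partial>lborel)"
    using zero real_lebesgue_integral_def[OF int] by simp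
  then show "(\<integral>\<^sup>+ x. ennreal (weight x) * ennreal (l \<bullet> (x - p)) \<partial>lborel)
     = (\<integral>\<^sup>+ x. ennreal (weight x) * ennreal (- (l \<bullet> (x - p))) \<partial>lborel)"
    unfolding A by (rule enn2real_inject_finite[OF fin])
  show "(\<integral>\<^sup>+ x. ennreal (weight x) * ennreal (l \<bullet> (x - p)) \<partial>lborel) < \<infinity>"
    unfolding A using fin by (simp add: less_top)
qed

text \<open>Log-concavity on the segment from \<open>y\<close> to \<open>p\<close> bounds the marginal at the contracted point from below
  by its value at \<open>y\<close> times \<open>1 + e (s y - l \<bullet> (y - p))\<close>, where \<open>s\<close> is the defect of concavity of the
  logarithm with respect to its tangent at \<open>p\<close>. After integration the linear term disappears. On the
  other side, a normal that is constant along \<open>M\<close> is nonnegative on the support of the marginal, hence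
  at least \<open>e (v \<bullet> p)\<close> on the contracted support. The term with \<open>s\<close> is kept for the case of equality.\<close>

theorem contraction_inequality:
  obtains l s where "\<And>i. i < k \<Longrightarrow> l \<bullet> b i = 0" and "s \<in> borel_measurable borel" and "\<And>x. 0 \<le> s x"
    and "\<And>x. marg x > 0 \<Longrightarrow> ln (marg x) = ln (marg p) + l \<bullet> (x - p) - s x"
    and "\<And>e. 0 < e \<Longrightarrow> e < 1 \<Longrightarrow>
      (\<integral>\<^sup>+ x. ennreal (weight x) \<partial>lborel) + ennreal e * (\<integral>\<^sup>+ x. ennreal (weight x) * ennreal (s x) \<partial>lborel)
      \<le> ennreal ((1 / (1 - e)) ^ (DIM('a) - k)) *
         (\<integral>\<^sup>+ x. ennreal (weight x) *
           indicator {x. \<forall>v\<in>V. (\<forall>i<k. v \<bullet> b i = 0) \<longrightarrow> e * (v \<bullet> p) \<le> v \<bullet> x} x \<partial>lborel)"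
proof -
  have pp: "marg p > 0" using p_in by (rule marg_pos)
  obtain l where l: "\<And>y. marg y > 0 \<Longrightarrow> ln (marg y) \<le> ln (marg p) + l \<bullet> (y - p)"
    using log_concave_supergradient[OF marg_log_concave open_open_cone p_in marg_pos] by blast
  \<comment> \<open>The marginal is constant along \<open>M\<close>, hence so is every supergradient.\<close>
  have lb: "l \<bullet> b i = 0" if "i < k" for i
  proof -
    have *: "0 \<le> l \<bullet> (t *\<^sub>R b i)" for t
      using l[of "p + t *\<^sub>R b i"] marg_shift[of "t *\<^sub>R b i" p] b_in_M[OF that] subspace_M pp
      by (simp add: subspace_scale)
    show ?thesis using *[of 1] *[of "-1"] by simp
  qed
  have l_inv: "l \<bullet> (x + v - p) = l \<bullet> (x - p)" if "v \<in> M" for x v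
    using M_orth[OF lb that] by (simp add: inner_add_right inner_diff_right)
  define s where "s x = (if marg x > 0 then ln (marg p) + l \<bullet> (x - p) - ln (marg x) else 0)" for x
  have s0: "0 \<le> s x" for x using l[of x] by (simp add: s_def)
  have s_meas [measurable]: "s \<in> borel_measurable borel" unfolding s_def[abs_def] by measurable
  have s_inv: "s (x + v) = s x" if "v \<in> M" for x v using that by (simp add: s_def l_inv marg_shift)
  define K where "K = {x. marg x > 0}"
  have [measurable]: "K \<in> sets borel" unfolding K_def by measurable
  let ?J = "{k..<DIM('a)}"
  have main: "(\<integral>\<^sup>+ x. ennreal (weight x) \<partial>lborel) + ennreal e * (\<integral>\<^sup>+ x. ennreal (weight x) * ennreal (s x) \<partial>lborel)
      \<le> ennreal ((1 / (1 - e)) ^ (DIM('a) - k)) *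
         (\<integral>\<^sup>+ x. ennreal (weight x) *
           indicator {x. \<forall>v\<in>V. (\<forall>i<k. v \<bullet> b i = 0) \<longrightarrow> e * (v \<bullet> p) \<le> v \<bullet> x} x \<partial>lborel)"
    if e: "0 < e" "e < 1" for e
  proof -
    \<comment> \<open>The linear term changes sign, so its positive and negative parts are put on different sides.\<close>
    let ?lp = "\<lambda>y. ennreal (l \<bullet> (y - p))" and ?lm = "\<lambda>y. ennreal (- (l \<bullet> (y - p)))"
    have pointwise: "fib y * 1 + (ennreal e * (fib y * ennreal (s y)) + ennreal e * (fib y * ?lm y))
        \<le> fib ((1 - e) *\<^sub>R y + e *\<^sub>R p) * indicator K y + ennreal e * (fib y * ?lp y)" for y
    proof (cases "marg y > 0")
      case False
      then have "fib y = 0" using marg_nonneg[of y] by (simp add: fib_eq)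
      then show ?thesis by simp
    next
      case True
      let ?z = "(1 - e) *\<^sub>R y + e *\<^sub>R p"
      let ?d = "ln (marg p) - ln (marg y)"
      have z: "marg ?z > 0" and le: "(1 - e) * ln (marg y) + e * ln (marg p) \<le> ln (marg ?z)"
        using log_concave_ln_ge[OF marg_log_concave e True pp] by auto
      have "marg y * (1 + e * ?d) \<le> marg y * exp (e * ?d)"
        using True exp_ge_add_one_self[of "e * ?d"] by (intro mult_left_mono) auto
      also have "\<dots> = exp (ln (marg y) + e * ?d)" using True by (simp add: exp_add)
      also have "\<dots> \<le> exp (ln (marg ?z))" using le by (simp add: algebra_simps)
      also have "\<dots> = marg ?z" using z by simp
      finally have 1: "marg y * (1 + e * ?d) \<le> marg ?z" .
      have d: "?d = s y - l \<bullet> (y - p)" using True by (simp add: s_def)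
      have q: "max 0 (l \<bullet> (y - p)) - max 0 (- (l \<bullet> (y - p))) = l \<bullet> (y - p)" by auto
      have "marg y + (e * (marg y * s y) + e * (marg y * max 0 (- (l \<bullet> (y - p)))))
          = marg y * (1 + e * ?d) + e * (marg y * (l \<bullet> (y - p) + max 0 (- (l \<bullet> (y - p)))))"
        unfolding d by (simp add: algebra_simps)
      also have "\<dots> \<le> marg ?z + e * (marg y * max 0 (l \<bullet> (y - p)))"
        using 1 q by (simp add: max_def split: if_splits)
      finally have "ennreal (marg y + (e * (marg y * s y) + e * (marg y * max 0 (- (l \<bullet> (y - p))))))
         \<le> ennreal (marg ?z + e * (marg y * max 0 (l \<bullet> (y - p))))" by (rule ennreal_leI)
      moreover have "?lp y = ennreal (max 0 (l \<bullet> (y - p)))" "?lm y = ennreal (max 0 (- (l \<bullet> (y - p))))"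
        by (auto simp: max_def ennreal_neg)
      ultimately show ?thesis
        using e True s0[of y] marg_nonneg[of ?z]
        by (simp add: fib_eq K_def ennreal_plus ennreal_mult)
    qed
    have [measurable]: "?lp \<in> borel_measurable borel" "?lm \<in> borel_measurable borel" by measurable
    have D1: "(\<integral>\<^sup>+ x. ennreal (weight x) * 1 \<partial>lborel) = ennreal c * fiber_integral b ?J (\<lambda>y. fib y * 1) 0"
      by (rule disintegrate_weight) auto
    have D2: "(\<integral>\<^sup>+ x. ennreal (weight x) * ennreal (s x) \<partial>lborel) = ennreal c * fiber_integral b ?J (\<lambda>y. fib y * ennreal (s y)) 0"
      by (rule disintegrate_weight) (auto simp: s_inv)
    have D3: "(\<integral>\<^sup>+ x. ennreal (weight x) * ?lp x \<partial>lborel) = ennreal c * fiber_integral b ?J (\<lambda>y. fib y * ?lp y) 0"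
      by (rule disintegrate_weight) (auto simp: l_inv)
    have D4: "(\<integral>\<^sup>+ x. ennreal (weight x) * ?lm x \<partial>lborel) = ennreal c * fiber_integral b ?J (\<lambda>y. fib y * ?lm y) 0"
      by (rule disintegrate_weight) (auto simp: l_inv)
    have D5: "ennreal c * fiber_integral b ?J (\<lambda>y. fib ((1 - e) *\<^sub>R y + e *\<^sub>R p) * indicator K y) 0
     = ennreal ((1 / (1 - e)) ^ (DIM('a) - k))
        * (\<integral>\<^sup>+ x. ennreal (weight x) * indicator K ((1 / (1 - e)) *\<^sub>R (x - e *\<^sub>R p)) \<partial>lborel)"
      by (rule contraction_integral) (use e in \<open>auto simp: K_def marg_shift\<close>)
    have "ennreal c * fiber_integral b ?J (\<lambda>y. fib y * 1 + (ennreal e * (fib y * ennreal (s y)) + ennreal e * (fib y * ?lm y))) 0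
        \<le> ennreal c * fiber_integral b ?J (\<lambda>y. fib ((1 - e) *\<^sub>R y + e *\<^sub>R p) * indicator K y + ennreal e * (fib y * ?lp y)) 0"
      by (intro mult_left_mono fiber_integral_mono pointwise) auto
    then have sum_le: "(\<integral>\<^sup>+ x. ennreal (weight x) * 1 \<partial>lborel)
        + (ennreal e * (\<integral>\<^sup>+ x. ennreal (weight x) * ennreal (s x) \<partial>lborel) + ennreal e * (\<integral>\<^sup>+ x. ennreal (weight x) * ?lm x \<partial>lborel))
      \<le> ennreal ((1 / (1 - e)) ^ (DIM('a) - k))
        * (\<integral>\<^sup>+ x. ennreal (weight x) * indicator K ((1 / (1 - e)) *\<^sub>R (x - e *\<^sub>R p)) \<partial>lborel)
        + ennreal e * (\<integral>\<^sup>+ x. ennreal (weight x) * ?lp x \<partial>lborel)"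
      unfolding D1 D2 D3 D4 D5[symmetric]
      by (simp add: fiber_integral_add fiber_integral_cmult distrib_left mult_ac)
    have "(\<integral>\<^sup>+ x. ennreal (weight x) \<partial>lborel) + ennreal e * (\<integral>\<^sup>+ x. ennreal (weight x) * ennreal (s x) \<partial>lborel)
      \<le> ennreal ((1 / (1 - e)) ^ (DIM('a) - k))
        * (\<integral>\<^sup>+ x. ennreal (weight x) * indicator K ((1 / (1 - e)) *\<^sub>R (x - e *\<^sub>R p)) \<partial>lborel)"
    proof -
      let ?L = "ennreal e * (\<integral>\<^sup>+ x. ennreal (weight x) * ?lp x \<partial>lborel)"
      have "?L \<noteq> \<infinity>" using integral_parts(2)[of l] by (simp add: ennreal_mult_eq_top_iff)
      moreover from sum_le
      have "?L + ((\<integral>\<^sup>+ x. ennreal (weight x) \<partial>lborel) + ennreal e * (\<integral>\<^sup>+ x. ennreal (weight x) * ennreal (s x) \<partial>lborel))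
         \<le> ?L + ennreal ((1 / (1 - e)) ^ (DIM('a) - k))
        * (\<integral>\<^sup>+ x. ennreal (weight x) * indicator K ((1 / (1 - e)) *\<^sub>R (x - e *\<^sub>R p)) \<partial>lborel)"
        unfolding integral_parts(1)[of l, symmetric] by (simp only: add_ac mult_1_right)
      ultimately show ?thesis by (simp only: ennreal_add_left_cancel_le) blast
    qed
    also have "\<dots> \<le> ennreal ((1 / (1 - e)) ^ (DIM('a) - k)) *
         (\<integral>\<^sup>+ x. ennreal (weight x) *
           indicator {x. \<forall>v\<in>V. (\<forall>i<k. v \<bullet> b i = 0) \<longrightarrow> e * (v \<bullet> p) \<le> v \<bullet> x} x \<partial>lborel)"
    proof (rule mult_left_mono, rule nn_integral_mono)
      fix x
      have "e * (v \<bullet> p) \<le> v \<bullet> x"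
        if K: "(1 / (1 - e)) *\<^sub>R (x - e *\<^sub>R p) \<in> K" and v: "v \<in> V" "\<forall>i<k. v \<bullet> b i = 0" for v
      proof -
        let ?y = "(1 / (1 - e)) *\<^sub>R (x - e *\<^sub>R p)"
        have "\<exists>t. ?y + (\<Sum>i<k. t i *\<^sub>R b i) \<in> cone"
        proof (rule ccontr)
          assume "\<not> ?thesis"
          then have "fib ?y = 0" unfolding fib_def fiber_integral_def by (simp add: weight_def)
          then show False using K by (simp add: K_def marg_def)
        qed
        then obtain t where "?y + (\<Sum>i<k. t i *\<^sub>R b i) \<in> cone" by blast
        then have "0 \<le> v \<bullet> (?y + (\<Sum>i<k. t i *\<^sub>R b i))" using v by (simp add: cone_def)
        also have "\<dots> = v \<bullet> ?y" using v(2) by (simp add: inner_add_right inner_sum_right)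
        finally show ?thesis using e by (simp add: inner_diff_right zero_le_divide_iff)
      qed
      then show "ennreal (weight x) * indicator K ((1 / (1 - e)) *\<^sub>R (x - e *\<^sub>R p))
          \<le> ennreal (weight x) * indicator {x. \<forall>v\<in>V. (\<forall>i<k. v \<bullet> b i = 0) \<longrightarrow> e * (v \<bullet> p) \<le> v \<bullet> x} x"
        by (auto simp: indicator_def)
    qed auto
    finally show ?thesis .
  qed
  show thesis
    by (rule that[of l s]) (use lb s_meas s0 main in \<open>auto simp: s_def\<close>)
qed

section \<open>Equality: exponential marginals of a cone\<close>

text \<open>The cone contains the translate of its trace on \<open>M\<close> by any of its points.\<close>

lemma fib_ge_translate: "w \<in> cone \<Longrightarrow> ennreal (exp (- (\<tau> \<bullet> w))) * fib 0 \<le> fib w"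
proof -
  assume w: "w \<in> cone"
  have "ennreal (exp (- (\<tau> \<bullet> w))) * fib 0
      = fiber_integral b {..<k} (\<lambda>y. ennreal (exp (- (\<tau> \<bullet> w))) * ennreal (weight y)) 0"
    unfolding fib_def by (rule fiber_integral_cmult[symmetric]) measurable
  also have "\<dots> \<le> fib w" unfolding fib_def
  proof (rule fiber_integral_mono)
    fix t
    let ?y = "\<Sum>i<k. t i *\<^sub>R b i"
    show "ennreal (exp (- (\<tau> \<bullet> w))) * ennreal (weight (0 + ?y)) \<le> ennreal (weight (w + ?y))"
      using cone_add[OF w, of ?y]
      by (simp add: weight_def ennreal_mult[symmetric] exp_add[symmetric] inner_add_right)
  qed
  finally show ?thesis .
qed

lemma fib_scale: "0 < s \<Longrightarrow> fib (s *\<^sub>R x) = ennreal (s ^ k) * fiber_integral b {..<k} (\<lambda>y. ennreal (weight (s *\<^sub>R y))) x"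
  unfolding fib_def using fiber_integral_scale[of "{..<k}" s "\<lambda>x. ennreal (weight x)" b x] by simp

lemma ball_exists_scale:
  assumes "open U" "y \<in> (U :: 'a set)"
  shows "\<exists>h>0. y + h *\<^sub>R x \<in> U"
proof -
  obtain e where e: "e > 0" "ball y e \<subseteq> U" using assms open_contains_ball by blast
  define N where "N = norm x + 1"
  have N: "N > 0" "norm x \<le> N" using norm_ge_zero[of x] unfolding N_def by linarith+
  define h where "h = e / (2 * N)"
  have h: "h > 0" using e N by (simp add: h_def)
  have "norm (h *\<^sub>R x) = h * norm x" using h by simp
  also have "\<dots> \<le> h * N" using h N by (intro mult_left_mono) auto
  also have "\<dots> < e" using e N by (simp add: h_def)
  finally have "y + h *\<^sub>R x \<in> U" by (intro subsetD[OF e(2)]) (simp add: dist_norm)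
  then show ?thesis using h by blast
qed

end

text \<open>In the case of equality the logarithm of the marginal is a linear form plus a constant on the open
  cone.\<close>

locale exponential_marginal = marginal_setting +
  fixes l :: 'a and c0 :: real
  assumes l_orth: "\<And>i. i < k \<Longrightarrow> l \<bullet> b i = 0" and c0: "c0 > 0"
    and marg_exp: "\<And>x. x \<in> open_cone \<Longrightarrow> marg x = c0 * exp (l \<bullet> x)"
begin

text \<open>The linear form that compares the exponent of the marginal with that of the weight. It turns out to
  be nonnegative on the cone; its zeros are the apices of the fibers.\<close>

definition \<Lambda> :: "'a \<Rightarrow> real" where "\<Lambda> x = (l + \<tau>) \<bullet> x"

lemma l_M: "v \<in> M \<Longrightarrow> l \<bullet> v = 0" using M_orth l_orth by blast

lemma marg_exp': assumes "x \<in> open_cone" "w - x \<in> M" shows "marg w = c0 * exp (l \<bullet> w)"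
proof -
  have "marg w = marg x" using marg_shift[OF assms(2), of x] by simp
  moreover have "l \<bullet> w = l \<bullet> x" using l_M[OF assms(2)] by (simp add: inner_diff_right)
  ultimately show ?thesis using marg_exp[OF assms(1)] by simp
qed

text \<open>The fibers through \<open>s p\<close>, translated back by \<open>s p\<close>, decrease to the trace of the cone on \<open>M\<close> as \<open>s\<close>
  decreases to \<open>0\<close>.\<close>

lemma marg_zero: "marg 0 = c0"
proof -
  let ?s = "\<lambda>n. inverse (real (Suc n))"
  let ?g = "\<lambda>n t. ennreal (exp (?s n * (\<tau> \<bullet> p))) * ennreal (weight (?s n *\<^sub>R p + (\<Sum>i<k. t i *\<^sub>R b i)))"
  have g_eq: "?g n t = (if ?s n *\<^sub>R p + (\<Sum>i<k. t i *\<^sub>R b i) \<in> cone then ennreal (exp (- (\<tau> \<bullet> (\<Sum>i<k. t i *\<^sub>R b i)))) else 0)" for n t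
    by (simp add: weight_def ennreal_mult[symmetric] exp_add[symmetric] inner_add_right)
  have pc: "p \<in> cone" using p_in open_cone_subset by blast
  have int: "(\<integral>\<^sup>+ t. ?g n t \<partial>(\<Pi>\<^sub>M i\<in>{..<k}. lborel)) = ennreal (c0 * exp (?s n * ((l + \<tau>) \<bullet> p)))" for n
  proof -
    have "?s n *\<^sub>R p \<in> open_cone" using p_in by (auto simp: open_cone_def)
    then have "fib (?s n *\<^sub>R p) = ennreal (c0 * exp (?s n * (l \<bullet> p)))" by (simp add: fib_eq marg_exp)
    then show ?thesis
      using c0 by (subst nn_integral_cmult)
        (simp_all add: fib_def fiber_integral_def ennreal_mult[symmetric] mult.left_commute exp_add[symmetric]
          inner_add_left distrib_left add.commute)
  qed
  have dec: "decseq ?g"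
  proof (rule decseq_SucI, rule le_funI)
    fix n t
    have "?s n *\<^sub>R p + y \<in> cone" if "?s (Suc n) *\<^sub>R p + y \<in> cone" for y
    proof -
      have "?s n *\<^sub>R p + y = (?s (Suc n) *\<^sub>R p + y) + (?s n - ?s (Suc n)) *\<^sub>R p" by (simp add: algebra_simps)
      moreover have "0 \<le> ?s n - ?s (Suc n)" by simp
      ultimately show ?thesis using that pc cone_add cone_scale by metis
    qed
    then show "?g (Suc n) t \<le> ?g n t" unfolding g_eq by (simp del: of_nat_Suc)
  qed
  have INF: "(INF n. ?g n t) = ennreal (weight (0 + (\<Sum>i<k. t i *\<^sub>R b i)))" for t
  proof (cases "(\<Sum>i<k. t i *\<^sub>R b i) \<in> cone")
    case True
    then have "?s n *\<^sub>R p + (\<Sum>i<k. t i *\<^sub>R b i) \<in> cone" for n by (intro cone_add cone_scale pc) auto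
    then show ?thesis unfolding g_eq using True by (simp add: weight_def)
  next
    case False
    let ?y = "\<Sum>i<k. t i *\<^sub>R b i"
    have "(\<lambda>n. ?s n *\<^sub>R p + ?y) \<longlonglongrightarrow> 0 *\<^sub>R p + ?y"
      by (intro tendsto_intros LIMSEQ_inverse_real_of_nat)
    then have "\<exists>n. ?s n *\<^sub>R p + ?y \<notin> cone"
      using closed_sequentially[OF closed_cone, of "\<lambda>n. ?s n *\<^sub>R p + ?y"] False by auto
    then obtain n where n: "?s n *\<^sub>R p + ?y \<notin> cone" by blast
    have "(INF n. ?g n t) \<le> ?g n t" by (rule INF_lower) simp
    also have "\<dots> = 0" unfolding g_eq using n by simp
    finally have "(INF n. ?g n t) \<le> 0" .
    then show ?thesis using False by (simp add: weight_def)
  qed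
  have "(\<integral>\<^sup>+ t. (INF n. ?g n t) \<partial>(\<Pi>\<^sub>M i\<in>{..<k}. lborel)) = (INF n. \<integral>\<^sup>+ t. ?g n t \<partial>(\<Pi>\<^sub>M i\<in>{..<k}. lborel))"
  proof (rule nn_integral_monotone_convergence_INF_decseq[OF dec])
    show "?g n \<in> borel_measurable (\<Pi>\<^sub>M i\<in>{..<k}. lborel)" for n by measurable
    show "(\<integral>\<^sup>+ t. ?g 0 t \<partial>(\<Pi>\<^sub>M i\<in>{..<k}. lborel)) < \<infinity>" unfolding int by simp
  qed
  then have "fib 0 = (INF n. ennreal (c0 * exp (?s n * ((l + \<tau>) \<bullet> p))))"
    unfolding INF int by (simp add: fib_def fiber_integral_def)
  moreover have "(\<lambda>n. \<integral>\<^sup>+ t. ?g n t \<partial>(\<Pi>\<^sub>M i\<in>{..<k}. lborel)) \<longlonglongrightarrow> (INF n. \<integral>\<^sup>+ t. ?g n t \<partial>(\<Pi>\<^sub>M i\<in>{..<k}. lborel))"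
    by (intro LIMSEQ_INF decseq_SucI nn_integral_mono) (rule le_funD[OF decseq_SucD[OF dec]])
  ultimately have "(\<lambda>n. ennreal (c0 * exp (?s n * ((l + \<tau>) \<bullet> p)))) \<longlonglongrightarrow> fib 0" unfolding int by simp
  moreover have "(\<lambda>n. ennreal (c0 * exp (?s n * ((l + \<tau>) \<bullet> p)))) \<longlonglongrightarrow> ennreal (c0 * exp (0 * ((l + \<tau>) \<bullet> p)))"
    by (intro tendsto_ennrealI tendsto_intros LIMSEQ_inverse_real_of_nat)
  ultimately have "fib 0 = ennreal c0" using LIMSEQ_unique by fastforce
  then show ?thesis using c0 by (simp add: marg_def)
qed

text \<open>The fiber through \<open>w\<close> contains the translate of the trace on \<open>M\<close> by \<open>w\<close>.\<close>

lemma \<Lambda>_nonneg: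
  assumes "x \<in> open_cone" "w - x \<in> M" "w \<in> cone"
  shows "0 \<le> \<Lambda> w"
proof -
  have "ennreal (exp (- (\<tau> \<bullet> w))) * ennreal c0 \<le> ennreal (c0 * exp (l \<bullet> w))"
    using fib_ge_translate[OF assms(3)] marg_exp'[OF assms(1,2)] by (simp add: fib_eq marg_zero)
  then have "exp (- (\<tau> \<bullet> w)) * c0 \<le> c0 * exp (l \<bullet> w)" using c0 by (simp add: ennreal_mult[symmetric])
  then have "exp (- (\<tau> \<bullet> w)) \<le> exp (l \<bullet> w)" using c0 by (simp add: mult.commute)
  then show ?thesis by (simp add: \<Lambda>_def inner_add_left)
qed

text \<open>The fiber through \<open>s x\<close> is \<open>s\<close> times the fiber through \<open>x\<close>. If \<open>\<Lambda>\<close> had a positive lower bound on the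
  fiber through \<open>x\<close>, then the marginal at \<open>s x\<close> would be exponentially smaller than its value
  \<open>c0 * exp (s * (l \<bullet> x))\<close> for large \<open>s\<close>. So the infimum of \<open>\<Lambda>\<close> is zero, and by compactness it is
  attained.\<close>

lemma exists_apex:
  assumes x: "x \<in> open_cone"
  shows "\<exists>w\<in>cone. w - x \<in> M \<and> \<Lambda> w = 0"
proof -
  \<comment> \<open>On the fiber \<open>l\<close> is constant, so that a bound on \<open>\<Lambda>\<close> bounds \<open>\<tau>\<close> and with it the norm.\<close>
  define A where "A = {w \<in> cone. w - x \<in> M \<and> \<Lambda> w \<le> \<Lambda> x}"
  have "closed ((\<lambda>w. w - x) -` M)"
    by (intro closed_vimage closed_subspace subspace_M continuous_intros)
  moreover have "closed {w. \<Lambda> w \<le> \<Lambda> x}" unfolding \<Lambda>_def by (rule closed_halfspace_le)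
  moreover have "A = cone \<inter> ((\<lambda>w. w - x) -` M) \<inter> {w. \<Lambda> w \<le> \<Lambda> x}" by (auto simp: A_def)
  ultimately have "closed A" using closed_cone by auto
  moreover have "bounded A"
  proof -
    have "norm w \<le> (\<tau> \<bullet> x) / r" if "w \<in> A" for w
    proof -
      have "l \<bullet> w = l \<bullet> x" using l_M[of "w - x"] that by (simp add: A_def inner_diff_right)
      then have "\<tau> \<bullet> w \<le> \<tau> \<bullet> x" using that by (simp add: A_def \<Lambda>_def inner_add_left)
      moreover have "r * norm w \<le> \<tau> \<bullet> w" using decay that by (simp add: A_def cone_def)
      ultimately show ?thesis using r by (simp add: field_simps)
    qed
    then show ?thesis unfolding bounded_iff by blast
  qed
  moreover have xA: "x \<in> A" using x open_cone_subset subspace_M by (auto simp: A_def subspace_0)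
  moreover have "continuous_on A \<Lambda>" unfolding \<Lambda>_def by (intro continuous_intros)
  ultimately obtain w where w: "w \<in> A" "\<And>y. y \<in> A \<Longrightarrow> \<Lambda> w \<le> \<Lambda> y"
    using continuous_attains_inf[of A \<Lambda>] by (auto simp: compact_eq_bounded_closed)
  have wmin: "\<Lambda> w \<le> \<Lambda> y" if "y \<in> cone" "y - x \<in> M" for y
    using w(2)[of y] w(2)[OF xA] that by (cases "\<Lambda> y \<le> \<Lambda> x") (auto simp: A_def)
  have "0 \<le> \<Lambda> w" using \<Lambda>_nonneg[OF x] w(1) by (simp add: A_def)
  moreover have "\<not> 0 < \<Lambda> w"
  proof
    assume \<eta>: "0 < \<Lambda> w"
    let ?\<eta> = "\<Lambda> w"
    have ineq: "1 \<le> s ^ k * exp (- ((s - 1) * ?\<eta>))" if s: "1 \<le> s" for s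
    proof -
      let ?C = "exp (s * (l \<bullet> x)) * exp (- ((s - 1) * ?\<eta>)) * exp (- (l \<bullet> x))"
      have sx: "s *\<^sub>R x \<in> open_cone" using x s by (auto simp: open_cone_def)
      have "fib (s *\<^sub>R x) = ennreal (s ^ k) * fiber_integral b {..<k} (\<lambda>y. ennreal (weight (s *\<^sub>R y))) x"
        using s by (intro fib_scale) auto
      also have "fiber_integral b {..<k} (\<lambda>y. ennreal (weight (s *\<^sub>R y))) x
          \<le> fiber_integral b {..<k} (\<lambda>y. ennreal ?C * ennreal (weight y)) x"
      proof (rule fiber_integral_mono)
        fix t
        let ?y = "x + (\<Sum>i<k. t i *\<^sub>R b i)"
        have yM: "?y - x \<in> M" by (simp add: M_def) (intro span_sum span_scale span_base, auto)
        show "ennreal (weight (s *\<^sub>R ?y)) \<le> ennreal ?C * ennreal (weight ?y)"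
        proof (cases "?y \<in> cone")
          case True
          have ly: "l \<bullet> ?y = l \<bullet> x" using l_M[OF yM] by (simp add: inner_add_right)
          have "(s - 1) * ?\<eta> \<le> (s - 1) * \<Lambda> ?y" using wmin[OF True yM] s by (intro mult_left_mono) auto
          also have "\<dots> = (s - 1) * (l \<bullet> x) + (s - 1) * (\<tau> \<bullet> ?y)"
            by (simp add: \<Lambda>_def inner_add_left[of l] ly distrib_left)
          finally have "- (s * (\<tau> \<bullet> ?y)) \<le> s * (l \<bullet> x) + - ((s - 1) * ?\<eta>) + - (l \<bullet> x) + - (\<tau> \<bullet> ?y)"
            by (simp add: left_diff_distrib)
          then have "exp (- (s * (\<tau> \<bullet> ?y))) \<le> ?C * exp (- (\<tau> \<bullet> ?y))"
            by (simp only: exp_add[symmetric] exp_le_cancel_iff)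
          then show ?thesis using True cone_scale[of s ?y] s
            by (simp only: weight_def ennreal_mult[symmetric] if_True inner_scaleR_right) (simp add: ennreal_mult[symmetric])
        next
          case False
          then show ?thesis using s by (simp add: weight_def cone_scale_iff)
        qed
      qed
      also have "fiber_integral b {..<k} (\<lambda>y. ennreal ?C * ennreal (weight y)) x = ennreal ?C * fib x"
        unfolding fib_def by (rule fiber_integral_cmult) measurable
      finally have "ennreal (c0 * exp (s * (l \<bullet> x))) \<le> ennreal (s ^ k) * (ennreal ?C * ennreal (c0 * exp (l \<bullet> x)))"
        using marg_exp[OF sx] marg_exp[OF x] by (simp add: fib_eq mult_left_mono)
      also have "\<dots> = ennreal (s ^ k * (?C * (c0 * exp (l \<bullet> x))))"
        using s c0 by (simp add: ennreal_mult)
      finally have "c0 * exp (s * (l \<bullet> x)) \<le> s ^ k * (?C * (c0 * exp (l \<bullet> x)))"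
        using s c0 by (subst (asm) ennreal_le_iff) auto
      also have "\<dots> = c0 * exp (s * (l \<bullet> x)) * (s ^ k * exp (- ((s - 1) * ?\<eta>)))"
        by (simp add: exp_minus field_simps)
      finally show ?thesis using c0 by simp
    qed
    have lim: "((\<lambda>u. u ^ k / exp u) \<longlongrightarrow> 0) (at_top :: real filter)" by (rule tendsto_power_div_exp_0)
    have "eventually (\<lambda>u. u ^ k / exp u < ?\<eta> ^ k * exp (- ?\<eta>)) at_top"
      using order_tendstoD(2)[OF lim, of "?\<eta> ^ k * exp (- ?\<eta>)"] \<eta> by simp
    moreover have "eventually (\<lambda>u. u \<ge> ?\<eta>) at_top" by (rule eventually_ge_at_top)
    ultimately have "eventually (\<lambda>u. u ^ k / exp u < ?\<eta> ^ k * exp (- ?\<eta>) \<and> u \<ge> ?\<eta>) at_top"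
      by (rule eventually_conj)
    then obtain u where u: "u ^ k / exp u < ?\<eta> ^ k * exp (- ?\<eta>)" "u \<ge> ?\<eta>"
      using eventually_happens by fastforce
    have "1 \<le> (u / ?\<eta>) ^ k * exp (- ((u / ?\<eta> - 1) * ?\<eta>))" using u \<eta> by (intro ineq) simp
    also have "(u / ?\<eta> - 1) * ?\<eta> = u - ?\<eta>" using \<eta> by (simp add: left_diff_distrib)
    also have "(u / ?\<eta>) ^ k * exp (- (u - ?\<eta>)) = (u ^ k / exp u) / (?\<eta> ^ k * exp (- ?\<eta>))"
      by (simp add: power_divide exp_diff exp_minus divide_inverse mult_ac power_mult_distrib power_inverse)
    also have "\<dots> < 1" using u(1) \<eta> by (subst divide_less_eq_1_pos) auto
    finally show False by simp
  qed
  ultimately have "\<Lambda> w = 0" by simp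
  then show ?thesis using w(1) by (auto simp: A_def)
qed

text \<open>At an apex \<open>w\<close> the fiber has the same mass as the translate by \<open>w\<close> of the trace on \<open>M\<close> that it
  contains. A point of the fiber outside this translate would come with an open set of such points,
  obtained by moving towards the interior point \<open>x\<close>, and hence with additional mass.\<close>

lemma fiber_is_translate:
  assumes x: "x \<in> open_cone" and w: "w \<in> cone" "w - x \<in> M" "\<Lambda> w = 0"
    and z: "z \<in> cone" "z - x \<in> M"
  shows "z - w \<in> cone"
proof (rule ccontr)
  assume nz: "z - w \<notin> cone"
  have "open (- cone)" using closed_cone by (simp add: open_Compl)
  obtain e where e: "e > 0" "ball (z - w) e \<subseteq> - cone"
    using \<open>open (- cone)\<close> nz open_contains_ball by blast
  define N where "N = norm (x - z) + 1"
  have N: "N > 0" "norm (x - z) \<le> N" using norm_ge_zero[of "x - z"] unfolding N_def by linarith+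
  define h where "h = min (1/2) (e / (2 * N))"
  have h: "h > 0" "h < 1" "h \<le> e / (2 * N)" using e N by (auto simp: h_def)
  have "norm (h *\<^sub>R (x - z)) = h * norm (x - z)" using h by simp
  also have "\<dots> \<le> e / (2 * N) * N" using h N e by (intro mult_mono) auto
  also have "\<dots> < e" using e N by simp
  finally have q1: "(z - w) + h *\<^sub>R (x - z) \<notin> cone"
    using subsetD[OF e(2), of "(z - w) + h *\<^sub>R (x - z)"] by (auto simp: dist_norm)
  define q where "q = (z - w) + h *\<^sub>R (x - z)"
  have qc: "q \<notin> cone" using q1 by (simp add: q_def)
  have "w + q = (1 - h) *\<^sub>R z + h *\<^sub>R x" by (simp add: q_def algebra_simps)
  also have "\<dots> \<in> open_cone"
    using z(1) x h by (auto simp: open_cone_def cone_def inner_add_right intro!: add_nonneg_pos)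
  finally have wq: "w + q \<in> open_cone" .
  have zw: "z - w \<in> M" using subspace_diff[OF subspace_M z(2) w(2)] by simp
  have qM: "q \<in> M" unfolding q_def
    using subspace_M zw z(2)
    by (metis minus_diff_eq subspace_add subspace_neg subspace_scale)
  \<comment> \<open>The last condition bounds the weight on \<open>U\<close> from below.\<close>
  define U where "U = ((\<lambda>v. w + v) -` open_cone) \<inter> (- cone) \<inter> {v. \<tau> \<bullet> v < \<tau> \<bullet> q + 1}"
  have "open U" unfolding U_def
    by (intro open_Int open_vimage open_open_cone \<open>open (- cone)\<close> open_halfspace_lt continuous_intros)
  then have [measurable]: "U \<in> sets borel" by (rule borel_open)
  have qU: "q \<in> U" using wq qc by (simp add: U_def)
  have "0 < fiber_integral b {..<k} (indicator U) q"
    by (rule fiber_integral_open_pos) (use \<open>open U\<close> qU in auto)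
  also have "\<dots> = fiber_integral b {..<k} (indicator U) 0"
    using fiber_integral_shift[of "{..<k}" q b "indicator U" 0] qM by (simp add: M_def)
  finally have pos: "0 < fiber_integral b {..<k} (indicator U) 0" .
  let ?C = "exp (- (\<tau> \<bullet> w))"
  let ?D = "exp (- (\<tau> \<bullet> q + 1))"
  have "ennreal ?C * (ennreal c0 + ennreal ?D * fiber_integral b {..<k} (indicator U) 0)
      = fiber_integral b {..<k} (\<lambda>v. ennreal ?C * (ennreal (weight v) + ennreal ?D * indicator U v)) 0"
  proof -
    have "ennreal c0 = fib 0" by (simp add: fib_eq marg_zero)
    then show ?thesis unfolding fib_def by (simp add: fiber_integral_cmult fiber_integral_add)
  qed
  also have "\<dots> \<le> fib w" unfolding fib_def
  proof (rule fiber_integral_mono)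
    fix t
    let ?v = "\<Sum>i<k. t i *\<^sub>R b i"
    show "ennreal ?C * (ennreal (weight (0 + ?v)) + ennreal ?D * indicator U (0 + ?v)) \<le> ennreal (weight (w + ?v))"
    proof (cases "?v \<in> U")
      case True
      then have "?v \<notin> cone" "w + ?v \<in> cone" "\<tau> \<bullet> ?v \<le> \<tau> \<bullet> q + 1"
        using open_cone_subset by (auto simp: U_def)
      then show ?thesis using True
        by (simp add: weight_def ennreal_mult[symmetric] exp_add[symmetric] inner_add_right)
    next
      case False
      then show ?thesis using cone_add[OF w(1), of ?v]
        by (simp add: weight_def ennreal_mult[symmetric] exp_add[symmetric] inner_add_right)
    qed
  qed
  also have "fib w = ennreal (c0 * exp (l \<bullet> w))" using marg_exp'[OF x w(2)] by (simp add: fib_eq)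
  also have "\<dots> = ennreal ?C * ennreal c0"
  proof -
    have "l \<bullet> w = - (\<tau> \<bullet> w)" using w(3) by (simp add: \<Lambda>_def inner_add_left)
    then show ?thesis using c0 by (simp add: ennreal_mult mult.commute)
  qed
  finally have "ennreal ?C * (ennreal c0 + ennreal ?D * fiber_integral b {..<k} (indicator U) 0) \<le> ennreal ?C * ennreal c0" .
  then have "ennreal c0 + ennreal ?D * fiber_integral b {..<k} (indicator U) 0 \<le> ennreal c0 + 0"
    by (simp add: ennreal_mult_le_mult_iff)
  then have "ennreal ?D * fiber_integral b {..<k} (indicator U) 0 \<le> 0"
    by (simp only: ennreal_add_left_cancel_le) simp
  then show False using pos by (simp add: ennreal_zero_less_mult_iff)
qed

text \<open>Since \<open>v\<close> is not constant along \<open>M\<close>, the point \<open>x0\<close> of the facet of \<open>v\<close> can be moved along \<open>M\<close> into the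
  open cone. Its fiber is the translate of the trace on \<open>M\<close> by the apex \<open>w\<close>, so \<open>v\<close> vanishes at \<open>w\<close>.
  Moving the fiber slightly against \<open>\<sigma>\<close> and adding \<open>\<sigma>\<close> back to the new apex gives an apex of the original
  fiber, which is \<open>w\<close> by uniqueness. Hence \<open>v\<close> vanishes at both summands.\<close>

lemma nonconstant_normals_vanish:
  assumes v: "v \<in> V" "\<exists>i<k. v \<bullet> b i \<noteq> 0" and x0: "v \<bullet> x0 = 0" "\<And>u. u \<in> V - {v} \<Longrightarrow> 0 < u \<bullet> x0"
    and \<sigma>: "\<sigma> \<in> cone" "\<Lambda> \<sigma> = 0"
  shows "v \<bullet> \<sigma> = 0"
proof -
  obtain i where i: "i < k" "v \<bullet> b i \<noteq> 0" using v(2) by blast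
  \<comment> \<open>Near \<open>x0\<close> only \<open>v\<close> matters, and moving along \<open>b i\<close> makes it positive.\<close>
  define U where "U = (\<Inter>u\<in>V - {v}. {x. 0 < u \<bullet> x})"
  have "open U" unfolding U_def using finV by (auto intro!: open_INT open_halfspace_gt)
  moreover have "x0 \<in> U" using x0(2) by (auto simp: U_def)
  ultimately obtain h where h: "h > 0" "x0 + h *\<^sub>R (sgn (v \<bullet> b i) *\<^sub>R b i) \<in> U"
    using ball_exists_scale by blast
  define y where "y = x0 + h *\<^sub>R (sgn (v \<bullet> b i) *\<^sub>R b i)"
  have "v \<bullet> y = h * \<bar>v \<bullet> b i\<bar>" by (simp add: y_def inner_add_right x0 abs_sgn mult.commute)
  then have "0 < v \<bullet> y" using h i by simp
  then have y: "y \<in> open_cone" using h(2) unfolding y_def[symmetric] by (force simp: U_def open_cone_def)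
  have yx0: "x0 - y \<in> M" unfolding y_def using subspace_M b_in_M[OF i(1)]
    by (simp add: subspace_neg subspace_scale)
  obtain w where w: "w \<in> cone" "w - y \<in> M" "\<Lambda> w = 0" using exists_apex[OF y] by blast
  have "0 \<le> u \<bullet> x0" if "u \<in> V" for u
    using x0 that by (cases "u = v") (auto intro: less_imp_le)
  then have "x0 \<in> cone" by (simp add: cone_def)
  then have "x0 - w \<in> cone" using fiber_is_translate[OF y w _ yx0] by blast
  then have vw: "v \<bullet> w = 0" using v(1) w(1) x0(1) by (force simp: cone_def inner_diff_right)
  obtain g where g: "g > 0" "y + g *\<^sub>R (- \<sigma>) \<in> open_cone"
    using ball_exists_scale[OF open_open_cone y] by blast
  obtain w' where w': "w' \<in> cone" "w' - (y + g *\<^sub>R (- \<sigma>)) \<in> M" "\<Lambda> w' = 0" using exists_apex[OF g(2)] by blast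
  define z where "z = w' + g *\<^sub>R \<sigma>"
  have zc: "z \<in> cone" unfolding z_def using w'(1) \<sigma>(1) g(1) by (intro cone_add cone_scale) auto
  have zM: "z - y \<in> M" using w'(2) by (simp add: z_def algebra_simps)
  have "z - w \<in> cone" using fiber_is_translate[OF y w zc zM] .
  moreover have "\<tau> \<bullet> (z - w) = 0"
  proof -
    have "z - w \<in> M" using subspace_diff[OF subspace_M zM w(2)] by simp
    then have "l \<bullet> (z - w) = 0" by (rule l_M)
    moreover have "\<Lambda> (z - w) = 0" using w(3) w'(3) \<sigma>(2) by (simp add: z_def \<Lambda>_def inner_diff_right inner_add_right)
    ultimately show ?thesis by (simp add: \<Lambda>_def inner_add_left)
  qed
  ultimately have "r * norm (z - w) \<le> 0" using decay[of "z - w"] by (simp add: cone_def)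
  then have "z = w" using r by (simp add: mult_le_0_iff)
  then have "v \<bullet> z = 0" using vw by simp
  then have "v \<bullet> w' + g * (v \<bullet> \<sigma>) = 0" by (simp add: z_def inner_add_right)
  moreover have "0 \<le> v \<bullet> w'" "0 \<le> v \<bullet> \<sigma>" using w'(1) \<sigma>(1) v(1) by (auto simp: cone_def)
  ultimately show ?thesis using g(1) by (smt (verit) mult_pos_pos)
qed

text \<open>The apices and \<open>M\<close> together span the whole space, and the normals that are not constant along \<open>M\<close>
  vanish at the apices.\<close>

theorem dim_nonconstant_normals:
  assumes "\<And>v. v \<in> V \<Longrightarrow> \<exists>i<k. v \<bullet> b i \<noteq> 0 \<Longrightarrow> \<exists>x. v \<bullet> x = 0 \<and> (\<forall>u\<in>V - {v}. 0 < u \<bullet> x)"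
  shows "dim {v \<in> V. \<exists>i<k. v \<bullet> b i \<noteq> 0} \<le> k"
proof -
  define \<Sigma> where "\<Sigma> = span {\<sigma> \<in> cone. \<Lambda> \<sigma> = 0}"
  let ?T = "{v \<in> V. \<exists>i<k. v \<bullet> b i \<noteq> 0}"
  have vanish: "v \<bullet> \<sigma> = 0" if "v \<in> ?T" "\<sigma> \<in> \<Sigma>" for v \<sigma>
    using that(2) unfolding \<Sigma>_def
  proof (induction rule: span_induct_alt)
    case (step c x y)
    have "\<exists>x. v \<bullet> x = 0 \<and> (\<forall>u\<in>V - {v}. 0 < u \<bullet> x)" using assms[of v] that(1) by simp
    then obtain x0 where "v \<bullet> x0 = 0" "\<forall>u\<in>V - {v}. 0 < u \<bullet> x0" by blast
    then have "v \<bullet> x = 0" using nonconstant_normals_vanish[of v x0 x] that(1) step by auto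
    then show ?case using step by (simp add: inner_add_right)
  qed simp
  have sub: "open_cone \<subseteq> {x + y |x y. x \<in> M \<and> y \<in> \<Sigma>}"
  proof
    fix x assume "x \<in> open_cone"
    then obtain w where w: "w \<in> cone" "w - x \<in> M" "\<Lambda> w = 0" using exists_apex by blast
    have "x = - (w - x) + w" by simp
    moreover have "- (w - x) \<in> M" using subspace_neg[OF subspace_M w(2)] .
    moreover have "w \<in> \<Sigma>" using w by (simp add: \<Sigma>_def span_base)
    ultimately show "x \<in> {x + y |x y. x \<in> M \<and> y \<in> \<Sigma>}" by blast
  qed
  have "dim {x + y |x y. x \<in> M \<and> y \<in> \<Sigma>} \<ge> DIM('a)"
  proof -
    have "open_cone \<noteq> {}" using p_in by blast
    then have "dim open_cone = DIM('a)" using dim_openin[of UNIV open_cone] open_open_cone by simp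
    then show ?thesis using dim_subset[OF sub] by simp
  qed
  moreover have "dim {x + y |x y. x \<in> M \<and> y \<in> \<Sigma>} \<le> dim M + dim \<Sigma>"
    using dim_sums_Int[OF subspace_M, of \<Sigma>] by (simp add: \<Sigma>_def)
  moreover have "dim M \<le> k"
  proof -
    have "dim M \<le> card (b ` {..<k})" unfolding M_def using dim_le_card[of "b ` {..<k}" "b ` {..<k}"] by (simp add: span_superset)
    also have "\<dots> \<le> k" using card_image_le[of "{..<k}" b] by simp
    finally show ?thesis .
  qed
  moreover have "dim ?T + dim \<Sigma> \<le> DIM('a)"
  proof -
    have "dim ?T \<le> dim {y \<in> UNIV. \<forall>x\<in>\<Sigma>. orthogonal x y}"
      by (rule dim_subset) (use vanish in \<open>auto simp: orthogonal_def inner_commute\<close>)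
    then show ?thesis
      using dim_subspace_orthogonal_to_vectors[of \<Sigma> UNIV] by (simp add: \<Sigma>_def)
  qed
  ultimately show ?thesis by linarith
qed

end

context marginal_setting
begin

text \<open>The defect \<open>s\<close> is continuous on the open cone, where the logarithm of the marginal is concave and
  finite. So it vanishes identically there as soon as its integral is zero.\<close>

theorem rigidity:
  assumes l: "\<And>i. i < k \<Longrightarrow> l \<bullet> b i = 0" and [measurable]: "s \<in> borel_measurable borel" and s: "\<And>x. 0 \<le> s x"
    and ln_marg: "\<And>x. marg x > 0 \<Longrightarrow> ln (marg x) = ln (marg p) + l \<bullet> (x - p) - s x"
    and zero: "(\<integral>\<^sup>+ x. ennreal (weight x) * ennreal (s x) \<partial>lborel) = 0"
    and facet: "\<And>v. v \<in> V \<Longrightarrow> \<exists>i<k. v \<bullet> b i \<noteq> 0 \<Longrightarrow> \<exists>x. v \<bullet> x = 0 \<and> (\<forall>u\<in>V - {v}. 0 < u \<bullet> x)"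
  shows "dim {v \<in> V. \<exists>i<k. v \<bullet> b i \<noteq> 0} \<le> k"
proof -
  have "convex_on open_cone (\<lambda>x. - ln (marg x))"
  proof (rule convex_onI)
    fix u :: real and x y assume u: "0 < u" "u < 1" and xy: "x \<in> open_cone" "y \<in> open_cone"
    show "- ln (marg ((1 - u) *\<^sub>R x + u *\<^sub>R y)) \<le> (1 - u) * - ln (marg x) + u * - ln (marg y)"
      using log_concave_ln_ge(2)[OF marg_log_concave u marg_pos[OF xy(1)] marg_pos[OF xy(2)]] by simp
  qed (rule convex_open_cone)
  then have "continuous_on open_cone (\<lambda>x. - ln (marg x))" by (rule convex_on_continuous[OF open_open_cone])
  then have "continuous_on open_cone (\<lambda>x. ln (marg p) + l \<bullet> (x - p) + - ln (marg x))"
    by (intro continuous_on_add[OF _ \<open>continuous_on open_cone (\<lambda>x. - ln (marg x))\<close>] continuous_intros)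
  moreover have "s x = ln (marg p) + l \<bullet> (x - p) + - ln (marg x)" if "x \<in> open_cone" for x
    using ln_marg[OF marg_pos[OF that]] by simp
  ultimately have cont: "continuous_on open_cone s" by (simp cong: continuous_on_cong)
  define N where "N = open_cone \<inter> s -` (- {0})"
  have "open N" unfolding N_def
    using continuous_open_preimage[OF cont open_open_cone, of "- {0}"] by auto
  have "AE x in lborel. ennreal (weight x) * ennreal (s x) = 0"
    using zero by (subst (asm) nn_integral_0_iff_AE) auto
  then have "AE x in lborel. x \<notin> N"
  proof (rule AE_mp, intro AE_I2 impI notI)
    fix x assume "ennreal (weight x) * ennreal (s x) = 0" "x \<in> N"
    then show False using s[of x] open_cone_subset by (auto simp: N_def weight_def ennreal_eq_0_iff)
  qed
  moreover have "N \<in> sets borel" using \<open>open N\<close> by (rule borel_open)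
  ultimately have "N \<in> null_sets lborel" by (simp add: AE_iff_null_sets)
  then have "negligible N" by (simp add: negligible_iff_null_sets null_sets_completionI)
  then have "N = {}" using \<open>open N\<close> open_not_negligible by blast
  then have s0: "s x = 0" if "x \<in> open_cone" for x using that by (auto simp: N_def)
  interpret exponential_marginal b k V \<tau> p c r l "marg p * exp (- (l \<bullet> p))"
  proof unfold_locales
    show "marg x = marg p * exp (- (l \<bullet> p)) * exp (l \<bullet> x)" if "x \<in> open_cone" for x
    proof -
      have "marg x = exp (ln (marg x))" using marg_pos[OF that] by simp
      also have "\<dots> = exp (ln (marg p) + (l \<bullet> x - l \<bullet> p))"
        using ln_marg[OF marg_pos[OF that]] s0[OF that] by (simp add: inner_diff_right)
      also have "\<dots> = marg p * exp (- (l \<bullet> p)) * exp (l \<bullet> x)"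
        using marg_pos[OF p_in] by (simp add: exp_add exp_diff exp_minus field_simps)
      finally show ?thesis .
    qed
  qed (use l marg_pos[OF p_in] in auto)
  show ?thesis by (rule dim_nonconstant_normals) (rule facet)
qed

end

section \<open>Lebesgue measure in linear coordinates\<close>

lemma Basis_cart: "(Basis :: (real ^ 'n) set) = range (\<lambda>i. axis i 1)"
  by (auto simp: Basis_vec_def)

lemma prod_Basis_cart: "(\<Prod>b\<in>(Basis :: (real ^ 'n) set). f b) = (\<Prod>i\<in>UNIV. f (axis i 1))"
  unfolding Basis_cart by (subst prod.reindex) (auto simp: inj_on_def axis_eq_axis)

lemma lborel_eq_distr_PiM:
  fixes e :: "'n::finite \<Rightarrow> nat"
  assumes e: "bij_betw e UNIV {..<CARD('n)}"
  shows "(lborel :: (real ^ 'n) measure)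
       = distr (\<Pi>\<^sub>M i\<in>{..<CARD('n)}. lborel) borel (\<lambda>t. \<chi> j. t (e j))"
proof (rule lborel_eqI)
  let ?P = "\<Pi>\<^sub>M i\<in>{..<CARD('n)}. lborel :: real measure"
  let ?f = "\<lambda>t. (\<chi> j. t (e j)) :: real ^ 'n"
  have eN: "e j < CARD('n)" for j using e by (auto simp: bij_betw_def)
  have f_eq: "?f t = (\<Sum>j\<in>UNIV. t (e j) *\<^sub>R axis j 1)" for t
    by (simp add: vec_eq_iff axis_def if_distrib cong: if_cong)
  have comp: "(\<lambda>t. t (e j)) \<in> borel_measurable ?P" for j
    using measurable_component_singleton[of "e j" "{..<CARD('n)}" "\<lambda>_. lborel :: real measure"] eN by simp
  have meas [measurable]: "?f \<in> borel_measurable ?P"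
    unfolding f_eq by (intro borel_measurable_sum borel_measurable_scaleR comp borel_measurable_const)
  fix l u :: "real ^ 'n" assume lu: "\<And>b. b \<in> Basis \<Longrightarrow> l \<bullet> b \<le> u \<bullet> b"
  let ?g = "inv_into UNIV e"
  have g: "?g (e j) = j" for j using e by (simp add: bij_betw_def)
  have ge: "e (?g i) = i" if "i < CARD('n)" for i
    using e that by (intro f_inv_into_f) (auto simp: bij_betw_def)
  have le: "l $ j \<le> u $ j" for j using lu[of "axis j 1"] by (simp add: Basis_cart inner_axis)
  have "?f -` box l u \<inter> space ?P = (PiE {..<CARD('n)} (\<lambda>i. {l $ ?g i<..<u $ ?g i}))"
  proof (intro set_eqI iffI)
    fix t assume t: "t \<in> ?f -` box l u \<inter> space ?P"
    then have *: "l $ j < t (e j) \<and> t (e j) < u $ j" for j by (auto simp: mem_box_cart)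
    have "t i \<in> {l $ ?g i<..<u $ ?g i}" if "i < CARD('n)" for i
      using *[of "?g i"] ge[OF that] by simp
    moreover have "t \<in> extensional {..<CARD('n)}" using t by (simp add: space_PiM PiE_def)
    ultimately show "t \<in> PiE {..<CARD('n)} (\<lambda>i. {l $ ?g i<..<u $ ?g i})"
      by (auto simp: PiE_def)
  next
    fix t assume t: "t \<in> PiE {..<CARD('n)} (\<lambda>i. {l $ ?g i<..<u $ ?g i})"
    then have "t (e j) \<in> {l $ ?g (e j)<..<u $ ?g (e j)}" for j using eN[of j] by (auto simp: PiE_def Pi_def)
    then show "t \<in> ?f -` box l u \<inter> space ?P" using t by (auto simp: mem_box_cart g space_PiM PiE_def)
  qed
  then have "emeasure (distr ?P borel ?f) (box l u) = emeasure ?P (PiE {..<CARD('n)} (\<lambda>i. {l $ ?g i<..<u $ ?g i}))"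
    by (subst emeasure_distr) auto
  also have "\<dots> = (\<Prod>i<CARD('n). emeasure lborel {l $ ?g i<..<u $ ?g i})"
    by (intro lborel_PiM.emeasure_PiM) auto
  also have "\<dots> = (\<Prod>j\<in>UNIV. emeasure lborel {l $ j<..<u $ j})"
    by (rule prod.reindex_bij_betw[OF e, symmetric, of "\<lambda>i. emeasure lborel {l $ ?g i<..<u $ ?g i}", unfolded g])
  also have "\<dots> = ennreal (\<Prod>j\<in>UNIV. u $ j - l $ j)"
    using le by (simp add: prod_ennreal)
  also have "\<dots> = ennreal (\<Prod>b\<in>Basis. (u - l) \<bullet> b)"
    by (simp add: prod_Basis_cart inner_axis)
  finally show "emeasure (distr ?P borel ?f) (box l u) = ennreal (\<Prod>b\<in>Basis. (u - l) \<bullet> b)" .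
qed simp

text \<open>The shear step of Gaussian elimination: for fixed value of the coordinate along \<open>b i\<close>, the new
  direction only shifts the coordinate along \<open>b j\<close>.\<close>

lemma fiber_integral_add_direction:
  fixes b :: "nat \<Rightarrow> 'a::euclidean_space"
  assumes S: "finite S" "i \<in> S" "j \<in> S" "i \<noteq> j" and [measurable]: "g \<in> borel_measurable borel"
  shows "fiber_integral (b(i := b i + b j)) S g x = fiber_integral b S g x"
proof -
  let ?b = "b(i := b i + b j)"
  have eq: "fiber_integral ?b (S - {i}) g y = fiber_integral b (S - {i}) g y" for y
    unfolding fiber_integral_def by (intro nn_integral_cong arg_cong[where f = g] arg_cong2[where f = "(+)"] sum.cong) auto
  have S_eq: "S = (S - {i}) \<union> {i}" using S by auto
  have [measurable]: "fiber_integral b (S - {i}) g \<in> borel_measurable borel"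
    using S by (intro fiber_integral_measurable) auto
  have split: "fiber_integral d S g x = (\<integral>\<^sup>+ s. fiber_integral d (S - {i}) g (x + s *\<^sub>R d i) \<partial>lborel)"
    if "fiber_integral d (S - {i}) g \<in> borel_measurable borel" for d :: "nat \<Rightarrow> 'a"
    using S fiber_integral_union[of "S - {i}" "{i}" g d x] fiber_integral_singleton[OF that, of d i x] S_eq
    by (auto simp: insert_absorb)
  have "fiber_integral ?b S g x = (\<integral>\<^sup>+ s. fiber_integral b (S - {i}) g (x + s *\<^sub>R b i + s *\<^sub>R b j) \<partial>lborel)"
    by (subst split) (auto simp: eq scaleR_add_right add.assoc cong: measurable_cong)
  also have "\<dots> = (\<integral>\<^sup>+ s. fiber_integral b (S - {i}) g (x + s *\<^sub>R b i) \<partial>lborel)"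
    using S by (intro nn_integral_cong fiber_integral_shift1) auto
  also have "\<dots> = fiber_integral b S g x" by (rule split[symmetric]) measurable
  finally show ?thesis .
qed

lemma nn_integral_cart:
  fixes e :: "'n::finite \<Rightarrow> nat"
  assumes e: "bij_betw e UNIV {..<CARD('n)}" and [measurable]: "g \<in> borel_measurable borel"
  shows "(\<integral>\<^sup>+ x. g (x :: real ^ 'n) \<partial>lborel) = (\<integral>\<^sup>+ t. g (\<chi> j. t (e j)) \<partial>(\<Pi>\<^sub>M i\<in>{..<CARD('n)}. lborel))"
proof -
  let ?P = "\<Pi>\<^sub>M i\<in>{..<CARD('n)}. lborel :: real measure"
  have eN: "e j < CARD('n)" for j using e by (auto simp: bij_betw_def)
  have f_eq: "(\<chi> j. t (e j)) = (\<Sum>j\<in>UNIV. t (e j) *\<^sub>R axis j (1::real))" for t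
    by (simp add: vec_eq_iff axis_def if_distrib cong: if_cong)
  have comp: "(\<lambda>t. t (e j)) \<in> borel_measurable ?P" for j
    using measurable_component_singleton[of "e j" "{..<CARD('n)}" "\<lambda>_. lborel :: real measure"] eN by simp
  have [measurable]: "(\<lambda>t. (\<chi> j. t (e j)) :: real ^ 'n) \<in> borel_measurable ?P"
    unfolding f_eq by (intro borel_measurable_sum borel_measurable_scaleR comp borel_measurable_const)
  have "(\<integral>\<^sup>+ x. g x \<partial>(distr ?P borel (\<lambda>t. \<chi> j. t (e j)))) = (\<integral>\<^sup>+ t. g (\<chi> j. t (e j)) \<partial>?P)"
    by (rule nn_integral_distr) measurable
  then show ?thesis by (simp only: lborel_eq_distr_PiM[OF e, symmetric])
qed

lemma finite_type_bij: "\<exists>e :: 'n::finite \<Rightarrow> nat. bij_betw e UNIV {..<CARD('n)}"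
  using ex_bij_betw_finite_nat[of "UNIV :: 'n set"] by (simp add: atLeast0LessThan)

lemma linear_measurable_cart:
  fixes T :: "real ^ 'n \<Rightarrow> real ^ 'n"
  shows "linear T \<Longrightarrow> T \<in> borel_measurable borel"
  by (simp add: borel_measurable_continuous_onI linear_continuous_on linear_linear)

text \<open>By Gaussian elimination it is enough to treat diagonal maps, transpositions of coordinates and
  elementary shears.\<close>

lemma nn_integral_linear:
  fixes T :: "real ^ 'n \<Rightarrow> real ^ 'n"
  assumes T: "linear T" "bij T" and g: "g \<in> borel_measurable borel"
  shows "(\<integral>\<^sup>+ x. g x \<partial>lborel) = ennreal \<bar>det (matrix T)\<bar> * (\<integral>\<^sup>+ x. g (T x) \<partial>lborel)"
proof -
  obtain e :: "'n \<Rightarrow> nat" where e: "bij_betw e UNIV {..<CARD('n)}" using finite_type_bij by blast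
  have "bij T \<longrightarrow> (\<forall>g. g \<in> borel_measurable borel \<longrightarrow>
      (\<integral>\<^sup>+ x. g x \<partial>lborel) = ennreal \<bar>det (matrix T)\<bar> * (\<integral>\<^sup>+ x. g (T x) \<partial>lborel))"
  proof (induction rule: induct_linear_elementary[OF T(1)])
    case (1 f h)
    show ?case
    proof (intro impI allI)
      fix g :: "real ^ 'n \<Rightarrow> ennreal" assume bij: "bij (f \<circ> h)" and gm [measurable]: "g \<in> borel_measurable borel"
      have "surj f" unfolding surj_def using surjD[OF bij_is_surj[OF bij]] by (metis comp_apply)
      moreover have "inj h" using bij_is_inj[OF bij] by (rule inj_on_imageI2)
      ultimately have "bij f" "bij h"
        using linear_surj_imp_inj[OF 1(1)] linear_inj_imp_surj[OF 1(2)] by (simp_all add: bij_def)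
      moreover have [simp]: "(\<lambda>x. g (f x)) \<in> borel_measurable borel"
        by (rule measurable_compose[OF linear_measurable_cart[OF 1(1)] gm])
      moreover have "det (matrix (f \<circ> h)) = det (matrix f) * det (matrix h)"
        using 1 by (simp add: matrix_compose det_mul)
      ultimately show "(\<integral>\<^sup>+ x. g x \<partial>lborel) = ennreal \<bar>det (matrix (f \<circ> h))\<bar> * (\<integral>\<^sup>+ x. g ((f \<circ> h) x) \<partial>lborel)"
        using 1(3)[rule_format, OF \<open>bij f\<close> gm] 1(4)[rule_format, OF \<open>bij h\<close>, of "\<lambda>x. g (f x)"]
        by (simp only: abs_mult ennreal_mult abs_ge_zero mult.assoc comp_apply simp_thms)
    qed
  next
    case (2 f i)
    have "\<not> surj f"
    proof
      assume "surj f"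
      then obtain x where "f x = axis i 1" by (metis surjD)
      then show False using 2(2)[of x] by simp
    qed
    then show ?case by (simp add: bij_def)
  next
    case (3 c)
    show ?case
    proof (intro impI allI)
      let ?f = "\<lambda>x :: real ^ 'n. \<chi> i. c i * x $ i"
      fix g :: "real ^ 'n \<Rightarrow> ennreal" assume bij: "bij ?f" and [measurable]: "g \<in> borel_measurable borel"
      have c: "c i \<noteq> 0" for i
      proof
        assume "c i = 0"
        then have "?f (axis i 1) = ?f 0" by (auto simp: vec_eq_iff axis_def)
        then have "axis i 1 = (0 :: real ^ 'n)" by (rule injD[OF bij_is_inj[OF bij]])
        then have "(axis i 1 :: real ^ 'n) $ i = 0" by simp
        then show False by (simp add: axis_def)
      qed
      let ?c = "\<lambda>b :: real ^ 'n. c (axis_index b)"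
      have f_eq: "?f x = 0 + (\<Sum>j\<in>Basis. (?c j * (x \<bullet> j)) *\<^sub>R j)" for x
      proof -
        have "(\<Sum>j\<in>Basis. (?c j * (x \<bullet> j)) *\<^sub>R j) = (\<Sum>i\<in>UNIV. (c i * x $ i) *\<^sub>R axis i 1)"
          unfolding Basis_cart by (subst sum.reindex) (auto simp: inj_on_def axis_eq_axis inner_axis)
        then show ?thesis by (simp add: vec_eq_iff axis_def if_distrib cong: if_cong)
      qed
      have linf: "linear ?f" by (intro linearI) (simp_all add: vec_eq_iff algebra_simps)
      note [measurable] = linear_measurable_cart[OF linf]
      have "lborel = density (distr lborel borel ?f) (\<lambda>_. (\<Prod>j\<in>Basis. \<bar>?c j\<bar>))"
        unfolding f_eq by (rule lborel_affine_euclidean) (use c in auto)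
      moreover have "(\<Prod>j\<in>(Basis :: (real ^ 'n) set). \<bar>?c j\<bar>) = \<bar>det (matrix ?f)\<bar>"
      proof -
        have "matrix ?f $ i $ j = (if i = j then c i else 0)" for i j by (simp add: matrix_def axis_def)
        then show ?thesis
          by (subst det_diagonal) (auto simp: prod_Basis_cart axis_index_axis abs_prod)
      qed
      ultimately have lb: "lborel = density (distr lborel borel ?f) (\<lambda>_. ennreal \<bar>det (matrix ?f)\<bar>)" by simp
      have "(\<integral>\<^sup>+ x. g x \<partial>lborel) = (\<integral>\<^sup>+ x. g x \<partial>density (distr lborel borel ?f) (\<lambda>_. ennreal \<bar>det (matrix ?f)\<bar>))"
        using lb by simp
      also have "\<dots> = ennreal \<bar>det (matrix ?f)\<bar> * (\<integral>\<^sup>+ x. g (?f x) \<partial>lborel)"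
        by (subst nn_integral_density) (auto simp: nn_integral_cmult nn_integral_distr)
      finally show "(\<integral>\<^sup>+ x. g x \<partial>lborel) = ennreal \<bar>det (matrix ?f)\<bar> * (\<integral>\<^sup>+ x. g (?f x) \<partial>lborel)" .
    qed
  next
    case (4 m n)
    let ?\<sigma> = "Transposition.transpose m n"
    let ?f = "\<lambda>x :: real ^ 'n. \<chi> i. x $ ?\<sigma> i"
    have perm: "?\<sigma> permutes UNIV" by (simp add: permutes_swap_id)
    have "matrix ?f = (\<chi> i. mat 1 $ ?\<sigma> i)" by (simp add: matrix_def axis_def mat_def vec_eq_iff)
    then have det: "\<bar>det (matrix ?f)\<bar> = 1"
      using det_permute_rows[OF perm, of "mat 1 :: real ^ 'n ^ 'n"] by (simp add: abs_mult sign_def)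
    have linf: "linear ?f" by (intro linearI) (simp_all add: vec_eq_iff)
    have "(\<integral>\<^sup>+ x. g x \<partial>lborel) = (\<integral>\<^sup>+ x. g (?f x) \<partial>lborel)" if [measurable]: "g \<in> borel_measurable borel" for g
    proof -
      have e': "bij_betw (e \<circ> ?\<sigma>) UNIV {..<CARD('n)}"
        using e perm by (intro bij_betw_trans[of _ _ UNIV]) (auto simp: permutes_imp_bij)
      have "(\<integral>\<^sup>+ x. g (?f x) \<partial>lborel) = (\<integral>\<^sup>+ t. g (?f (\<chi> j. t (e j))) \<partial>(\<Pi>\<^sub>M i\<in>{..<CARD('n)}. lborel))"
        using measurable_compose[OF linear_measurable_cart[OF linf] that] by (intro nn_integral_cart[OF e]) simp
      also have "\<dots> = (\<integral>\<^sup>+ x. g x \<partial>lborel)"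
        using nn_integral_cart[OF e' that] by simp
      finally show ?thesis by simp
    qed
    then show ?case by (simp add: det)
  next
    case (5 m n)
    let ?f = "\<lambda>x :: real ^ 'n. \<chi> i. if i = m then x $ m + x $ n else x $ i"
    have "matrix ?f = (\<chi> k. if k = m then row m (mat 1) + 1 *s row n (mat 1) else row k (mat 1))"
      by (auto simp: matrix_def axis_def mat_def vec_eq_iff row_def)
    then have det: "det (matrix ?f) = 1"
      using det_row_operation[OF 5, of "mat 1 :: real ^ 'n ^ 'n" 1] by simp
    have linf: "linear ?f" by (intro linearI) (auto simp: vec_eq_iff algebra_simps)
    have "(\<integral>\<^sup>+ x. g x \<partial>lborel) = (\<integral>\<^sup>+ x. g (?f x) \<partial>lborel)" if [measurable]: "g \<in> borel_measurable borel" for g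
    proof -
      define b where "b i = axis (inv e i) (1::real)" for i
      have inve: "inv e (e j) = j" for j using e by (simp add: bij_betw_def)
      have b: "b (e j) = axis j 1" for j by (simp add: b_def inve)
      have sum_b: "(\<Sum>i<CARD('n). t i *\<^sub>R b i) = (\<chi> j. t (e j))" for t
      proof -
        have "(\<Sum>i<CARD('n). t i *\<^sub>R b i) = (\<Sum>j\<in>UNIV. t (e j) *\<^sub>R b (e j))"
          using sum.reindex_bij_betw[OF e, of "\<lambda>i. t i *\<^sub>R b i"] by simp
        then show ?thesis by (simp add: b vec_eq_iff axis_def if_distrib cong: if_cong)
      qed
      have eN: "e j < CARD('n)" for j using e by (auto simp: bij_betw_def)
      let ?b = "b(e n := b (e n) + b (e m))"
      have sum_b': "(\<Sum>i<CARD('n). t i *\<^sub>R ?b i) = ?f (\<chi> j. t (e j))" for t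
      proof -
        have "(\<Sum>i<CARD('n). t i *\<^sub>R ?b i) = (\<Sum>i<CARD('n). t i *\<^sub>R b i + (if i = e n then t i *\<^sub>R b (e m) else 0))"
          by (intro sum.cong) (auto simp: scaleR_add_right)
        also have "\<dots> = (\<chi> j. t (e j)) + t (e n) *\<^sub>R axis m 1"
          using eN by (simp add: sum.distrib sum_b b)
        also have "\<dots> = ?f (\<chi> j. t (e j))" by (auto simp: vec_eq_iff axis_def)
        finally show ?thesis .
      qed
      have "(\<integral>\<^sup>+ x. g (?f x) \<partial>lborel) = (\<integral>\<^sup>+ t. g (?f (\<chi> j. t (e j))) \<partial>(\<Pi>\<^sub>M i\<in>{..<CARD('n)}. lborel))"
        using measurable_compose[OF linear_measurable_cart[OF linf] that] by (intro nn_integral_cart[OF e]) simp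
      also have "\<dots> = fiber_integral ?b {..<CARD('n)} g 0" unfolding fiber_integral_def sum_b' by simp
      also have "\<dots> = fiber_integral b {..<CARD('n)} g 0"
        using 5 eN inve by (intro fiber_integral_add_direction) (auto, metis)
      also have "\<dots> = (\<integral>\<^sup>+ x. g x \<partial>lborel)"
        unfolding fiber_integral_def sum_b using nn_integral_cart[OF e that] by simp
      finally show ?thesis by simp
    qed
    then show ?case by (simp add: det)
  qed
  then show ?thesis using T(2) g by blast
qed

lemma coordinates_bij:
  fixes b :: "nat \<Rightarrow> real ^ 'n" and e :: "'n \<Rightarrow> nat"
  assumes e: "bij_betw e UNIV {..<CARD('n)}" and sp: "span (b ` {..<CARD('n)}) = UNIV"
  shows "linear (\<lambda>x :: real ^ 'n. \<Sum>j\<in>UNIV. x $ j *\<^sub>R b (e j))"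
    and "bij (\<lambda>x :: real ^ 'n. \<Sum>j\<in>UNIV. x $ j *\<^sub>R b (e j))"
proof -
  let ?T = "\<lambda>x :: real ^ 'n. \<Sum>j\<in>UNIV. x $ j *\<^sub>R b (e j)"
  show lin: "linear ?T"
    by (intro linearI) (simp_all add: scaleR_add_left sum.distrib scaleR_sum_right)
  have "b i \<in> range ?T" if "i < CARD('n)" for i
  proof -
    have "i \<in> range e" using e that by (simp add: bij_betw_def)
    then obtain j where j: "i = e j" by blast
    have "?T (axis j 1) = (\<Sum>i\<in>UNIV. if i = j then b (e i) else 0)"
      by (intro sum.cong) (auto simp: axis_def)
    then have "?T (axis j 1) = b (e j)" by simp
    then show ?thesis unfolding j by (rule range_eqI[OF sym])
  qed
  moreover have "subspace (range ?T)" using lin by (simp add: linear_subspace_image)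
  ultimately have "UNIV \<subseteq> range ?T" unfolding sp[symmetric] by (intro span_minimal) auto
  then have "surj ?T" by auto
  then show "bij ?T" using lin linear_surjective_imp_injective by (auto simp: bij_def)
qed

lemma nn_integral_coordinates:
  fixes b :: "nat \<Rightarrow> real ^ 'n" and e :: "'n \<Rightarrow> nat"
  assumes e: "bij_betw e UNIV {..<CARD('n)}" and sp: "span (b ` {..<CARD('n)}) = UNIV"
    and [measurable]: "g \<in> borel_measurable borel"
  shows "(\<integral>\<^sup>+ x. g x \<partial>lborel)
    = ennreal \<bar>det (matrix (\<lambda>x :: real ^ 'n. \<Sum>j\<in>UNIV. x $ j *\<^sub>R b (e j)))\<bar> * fiber_integral b {..<CARD('n)} g 0"
proof -
  let ?T = "\<lambda>x :: real ^ 'n. \<Sum>j\<in>UNIV. x $ j *\<^sub>R b (e j)"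
  let ?P = "\<Pi>\<^sub>M i\<in>{..<CARD('n)}. lborel :: real measure"
  note T = coordinates_bij[OF e sp]
  have "(\<lambda>x. g (?T x)) \<in> borel_measurable borel"
    using measurable_compose[OF linear_measurable_cart[OF T(1)] assms(3)] by simp
  then have "(\<integral>\<^sup>+ x. g (?T x) \<partial>lborel) = (\<integral>\<^sup>+ t. g (?T (\<chi> j. t (e j))) \<partial>?P)"
    by (rule nn_integral_cart[OF e])
  also have "\<dots> = fiber_integral b {..<CARD('n)} g 0"
    unfolding fiber_integral_def
  proof (rule nn_integral_cong)
    fix t
    show "g (?T (\<chi> j. t (e j))) = g (0 + (\<Sum>i<CARD('n). t i *\<^sub>R b i))"
      using sum.reindex_bij_betw[OF e, of "\<lambda>i. t i *\<^sub>R b i"] by simp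
  qed
  finally show ?thesis using nn_integral_linear[OF T assms(3)] by (simp only:)
qed

lemma nn_integral_independent_coordinates:
  fixes b :: "nat \<Rightarrow> real ^ 'n"
  assumes sp: "span (b ` {..<CARD('n)}) = UNIV"
  obtains c where "c > 0" "\<And>g. g \<in> borel_measurable borel \<Longrightarrow>
    (\<integral>\<^sup>+ x. g x \<partial>lborel) = ennreal c * fiber_integral b {..<CARD('n)} g 0"
proof -
  obtain e :: "'n \<Rightarrow> nat" where e: "bij_betw e UNIV {..<CARD('n)}" using finite_type_bij by blast
  note T = coordinates_bij[OF e sp]
  have "det (matrix (\<lambda>x :: real ^ 'n. \<Sum>j\<in>UNIV. x $ j *\<^sub>R b (e j))) \<noteq> 0"
    using T det_nz_iff_inj by (auto simp: bij_def)
  then show thesis using nn_integral_coordinates[OF e sp] by (intro that) auto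
qed

text \<open>The coordinates of \<open>E \<times> \<real>\<close> used for the affine subspace through \<open>a\<close>: a direction \<open>b i\<close> of \<open>E\<close> that is
  orthogonal to the differences of points of that subspace is lifted to a vector that is orthogonal
  to all its lifted points \<open>(v, - 1)\<close>.\<close>

lemma nn_integral_shear_coordinates:
  fixes b :: "nat \<Rightarrow> real ^ 'n" and a :: "real ^ 'n"
  assumes sp: "span (b ` {..<CARD('n)}) = UNIV"
  defines "B \<equiv> \<lambda>i. if i < CARD('n) then (b i, a \<bullet> b i) else (0, 1 :: real)"
  obtains c where "c > 0" "\<And>g. g \<in> borel_measurable borel \<Longrightarrow>
    (\<integral>\<^sup>+ x. g x \<partial>lborel) = ennreal c * fiber_integral B {..<Suc CARD('n)} g 0"
proof -
  let ?n = "CARD('n)"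
  obtain c where c: "c > 0" "\<And>g. g \<in> borel_measurable borel \<Longrightarrow>
    (\<integral>\<^sup>+ x. g x \<partial>lborel) = ennreal c * fiber_integral b {..<?n} g 0"
    using nn_integral_independent_coordinates[OF sp] by blast
  have "(\<integral>\<^sup>+ z. g z \<partial>lborel) = ennreal c * fiber_integral B {..<Suc ?n} g 0"
    if [measurable]: "g \<in> borel_measurable borel" for g :: "(real ^ 'n) \<times> real \<Rightarrow> ennreal"
  proof -
    have g': "g \<in> borel_measurable (lborel \<Otimes>\<^sub>M lborel)" by (simp add: lborel_prod)
    have [measurable]: "(\<lambda>x. \<integral>\<^sup>+ s. g (x, a \<bullet> x + s) \<partial>lborel) \<in> borel_measurable borel"
    proof -
      have "(\<lambda>z. (fst z, a \<bullet> fst z + snd z)) \<in> (borel :: ((real ^ 'n) \<times> real) measure) \<rightarrow>\<^sub>M borel"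
        by (intro borel_measurable_continuous_onI continuous_intros)
      from measurable_compose[OF this that]
      have "(\<lambda>z. g (fst z, a \<bullet> fst z + snd z)) \<in> borel_measurable (lborel \<Otimes>\<^sub>M lborel)" by (simp add: lborel_prod)
      from lborel.borel_measurable_nn_integral_fst[OF this] show ?thesis by simp
    qed
    have "fiber_integral B {..<Suc ?n} g 0 = fiber_integral B ({?n} \<union> {..<?n}) g 0"
      by (simp add: lessThan_Suc)
    also have "\<dots> = fiber_integral B {..<?n} (fiber_integral B {?n} g) 0"
      by (rule fiber_integral_union) auto
    also have "\<dots> = fiber_integral b {..<?n} (\<lambda>x. \<integral>\<^sup>+ s. g (x, a \<bullet> x + s) \<partial>lborel) 0"
    proof -
      have "(\<Sum>i<?n. t i *\<^sub>R B i) = ((\<Sum>i<?n. t i *\<^sub>R b i), a \<bullet> (\<Sum>i<?n. t i *\<^sub>R b i))" for t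
        by (simp add: B_def prod_eq_iff fst_sum snd_sum inner_sum_right)
      moreover have "fiber_integral B {?n} g z = (\<integral>\<^sup>+ s. g (z + s *\<^sub>R (0, 1)) \<partial>lborel)" for z
        by (subst fiber_integral_singleton) (auto simp: B_def)
      ultimately show ?thesis unfolding fiber_integral_def[of _ "{..<?n}"] by simp
    qed
    also have "ennreal c * \<dots> = (\<integral>\<^sup>+ x. \<integral>\<^sup>+ s. g (x, a \<bullet> x + s) \<partial>lborel \<partial>lborel)"
      by (rule c(2)[symmetric]) measurable
    also have "\<dots> = (\<integral>\<^sup>+ x. \<integral>\<^sup>+ s. g (x, s) \<partial>lborel \<partial>lborel)"
    proof (rule nn_integral_cong)
      fix x
      have "(\<lambda>s. g (x, s)) \<in> borel_measurable borel" by measurable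
      from nn_integral_real_affine[OF this, of 1 "a \<bullet> x"]
      show "(\<integral>\<^sup>+ s. g (x, a \<bullet> x + s) \<partial>lborel) = (\<integral>\<^sup>+ s. g (x, s) \<partial>lborel)" by simp
    qed
    also have "\<dots> = (\<integral>\<^sup>+ z. g z \<partial>lborel)"
      using lborel.nn_integral_fst[OF g'] by (simp add: lborel_prod)
    finally show ?thesis by simp
  qed
  then show thesis using c(1) that by blast
qed

section \<open>The cone over a polytope\<close>

lemma borel_measurable_fst_euclidean [measurable]:
  "(fst :: 'a::euclidean_space \<times> 'b::euclidean_space \<Rightarrow> 'a) \<in> borel_measurable borel"
  by (intro borel_measurable_continuous_onI continuous_intros)

lemma borel_measurable_snd_euclidean [measurable]:
  "(snd :: 'a::euclidean_space \<times> 'b::euclidean_space \<Rightarrow> 'b) \<in> borel_measurable borel"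
  by (intro borel_measurable_continuous_onI continuous_intros)

lemma nn_integral_scale_euclidean:
  fixes g :: "'a::euclidean_space \<Rightarrow> ennreal"
  assumes [measurable]: "g \<in> borel_measurable borel" and s: "s > 0"
  shows "(\<integral>\<^sup>+ x. g x \<partial>lborel) = ennreal (s ^ DIM('a)) * (\<integral>\<^sup>+ x. g (s *\<^sub>R x) \<partial>lborel)"
proof -
  have "(\<integral>\<^sup>+ x. g x \<partial>lborel) = (\<integral>\<^sup>+ x. g x \<partial>density (distr lborel borel (\<lambda>x. 0 + s *\<^sub>R x)) (\<lambda>_. \<bar>s\<bar> ^ DIM('a)))"
    using s lborel_affine[of s "0::'a"] by simp
  also have "\<dots> = ennreal (s ^ DIM('a)) * (\<integral>\<^sup>+ x. g (s *\<^sub>R x) \<partial>lborel)"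
    using s by (subst nn_integral_density) (auto simp: nn_integral_cmult nn_integral_distr)
  finally show ?thesis .
qed

lemma integral_scale_euclidean:
  fixes g :: "'a::euclidean_space \<Rightarrow> real"
  assumes [measurable]: "g \<in> borel_measurable borel" and s: "s > 0"
  shows "(LINT x|lborel. g x) = s ^ DIM('a) * (LINT x|lborel. g (s *\<^sub>R x))"
proof -
  have "(LINT x|lborel. g x) = (LINT x|density (distr lborel borel (\<lambda>x. 0 + s *\<^sub>R x)) (\<lambda>_. \<bar>s\<bar> ^ DIM('a)). g x)"
    using s lborel_affine[of s "0::'a"] by simp
  also have "\<dots> = s ^ DIM('a) * (LINT x|lborel. g (s *\<^sub>R x))"
    using s by (subst integral_density) (auto simp: integral_distr)
  finally show ?thesis .
qed

lemma has_bochner_integral_power_exp: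
  "has_bochner_integral lborel (\<lambda>s::real. s ^ k * exp (- s) * indicator {0..} s) (fact k)"
  using nn_intergal_power_times_exp_Ici[of k]
  by (intro has_bochner_integral_nn_integral) (auto simp: nn_integral_set_ennreal split: split_indicator)

lemma nn_integral_exp_atMost: "(\<integral>\<^sup>+ t. ennreal (exp t) * indicator {..c} t \<partial>lborel) = ennreal (exp (c::real))"
proof -
  have "(\<integral>\<^sup>+ t. ennreal (exp t) * indicator {..c} t \<partial>lborel)
      = (\<integral>\<^sup>+ s. ennreal (exp (c - s)) * indicator {..c} (c - s) \<partial>lborel)"
    using nn_integral_real_affine[of "\<lambda>t. ennreal (exp t) * indicator {..c} t" "-1" c] by simp
  also have "\<dots> = (\<integral>\<^sup>+ s. ennreal (exp c) * (ennreal (s ^ 0 * exp (- s)) * indicator {0..} s) \<partial>lborel)"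
    by (intro nn_integral_cong) (auto simp: ennreal_mult[symmetric] exp_diff exp_minus divide_inverse split: split_indicator)
  also have "\<dots> = ennreal (exp c)"
    by (subst nn_integral_cmult) (use nn_intergal_power_times_exp_Ici[of 0] in auto)
  finally show ?thesis .
qed

text \<open>The normals are scaled so that every inequality reads \<open>- 1 \<le> v \<bullet> x\<close>, as for a reflexive polytope. The
  barycenter condition is stated for all linear forms and without division by the volume.\<close>

locale centered_normals =
  fixes V :: "(real ^ 'n) set"
  assumes finV: "finite V" and bdd: "bounded {x. \<forall>v\<in>V. - 1 \<le> v \<bullet> x}"
    and centered: "\<And>l. (LINT x|lborel. indicator {x. \<forall>v\<in>V. - 1 \<le> v \<bullet> x} x * (l \<bullet> x)) = 0"
begin

definition P :: "(real ^ 'n) set" where "P = {x. \<forall>v\<in>V. - 1 \<le> v \<bullet> x}"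
definition m :: "real ^ 'n \<Rightarrow> real" where "m x = Min ((\<lambda>v. v \<bullet> x) ` V)"
definition C :: "((real ^ 'n) \<times> real) set" where "C = {z. \<forall>v\<in>V. 0 \<le> (v, - 1) \<bullet> z}"
definition wt :: "(real ^ 'n) \<times> real \<Rightarrow> real" where "wt z = (if z \<in> C then exp (snd z) else 0)"
text \<open>The weighted mass of the part of the cone that belongs to the normals in \<open>S\<close>, after integration
  over the height.\<close>

definition mass_on :: "(real ^ 'n) set \<Rightarrow> ennreal" where
  "mass_on S = (\<integral>\<^sup>+ x. ennreal (exp (m x)) * indicator {x. \<exists>v\<in>S. v \<bullet> x = m x} x \<partial>lborel)"

lemma C_iff: "(x, t) \<in> C \<longleftrightarrow> (\<forall>v\<in>V. t \<le> v \<bullet> x)"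
  by (auto simp: C_def)

lemma recession_zero: assumes "\<forall>v\<in>V. 0 \<le> v \<bullet> x" shows "x = 0"
proof (rule ccontr)
  assume x: "x \<noteq> 0"
  obtain B where B: "\<And>y. y \<in> P \<Longrightarrow> norm y \<le> B" using bdd by (auto simp: P_def bounded_iff)
  define s where "s = (\<bar>B\<bar> + 1) / norm x"
  have s: "s > 0" using x by (simp add: s_def add_nonneg_pos)
  have "s *\<^sub>R x \<in> P" unfolding P_def
  proof (intro CollectI ballI)
    fix v assume "v \<in> V"
    then have "0 \<le> v \<bullet> (s *\<^sub>R x)" using assms s by simp
    then show "- 1 \<le> v \<bullet> (s *\<^sub>R x)" by linarith
  qed
  from B[OF this] show False using x s by (simp add: s_def)
qed

lemma V_ne: "V \<noteq> {}"
proof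
  assume "V = {}"
  then have "axis undefined 1 = (0 :: real ^ 'n)" by (intro recession_zero) auto
  then have "(axis undefined 1 :: real ^ 'n) $ undefined = 0" by simp
  then show False by (simp add: axis_def)
qed

lemma C_m: "(x, t) \<in> C \<longleftrightarrow> t \<le> m x"
  using finV V_ne by (simp add: C_iff m_def)

lemma m_attained: "\<exists>v\<in>V. v \<bullet> x = m x"
proof -
  have "m x \<in> (\<lambda>v. v \<bullet> x) ` V" unfolding m_def using finV V_ne by (intro Min_in) auto
  then show ?thesis by force
qed

lemma m_le: "v \<in> V \<Longrightarrow> m x \<le> v \<bullet> x"
  unfolding m_def using finV by (intro Min_le) auto

lemma m_measurable [measurable]: "m \<in> borel_measurable borel"
proof -
  have "(\<lambda>x. Min ((\<lambda>v. v \<bullet> x) ` V)) \<in> borel_measurable borel"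
    using finV by (intro borel_measurable_Min) auto
  then show ?thesis by (simp add: m_def[abs_def])
qed

lemma m_nonpos: "m x \<le> 0"
proof (rule ccontr)
  assume "\<not> ?thesis"
  then have "\<forall>v\<in>V. 0 \<le> v \<bullet> x" using m_le[of _ x] by force
  then have "x = 0" by (rule recession_zero)
  then show False using \<open>\<not> m x \<le> 0\<close> m_attained[of x] by auto
qed

lemma C_nonpos: "(x, t) \<in> C \<Longrightarrow> t \<le> 0"
  using m_nonpos[of x] by (simp add: C_m)

lemma slice: "s > 0 \<Longrightarrow> (s *\<^sub>R x, - s) \<in> C \<longleftrightarrow> x \<in> P"
proof -
  assume s: "s > 0"
  have "- s \<le> v \<bullet> (s *\<^sub>R x) \<longleftrightarrow> - 1 \<le> v \<bullet> x" for v
    using s mult_le_cancel_left_pos[OF s, of "-1" "v \<bullet> x"] by simp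
  then show ?thesis by (simp add: C_iff P_def)
qed

lemma P_bound: obtains R where "R > 0" "\<And>x. x \<in> P \<Longrightarrow> norm x \<le> R"
  using bdd by (auto simp: P_def bounded_pos)

lemma C_bound: obtains R where "R > 0" "\<And>x t. (x, t) \<in> C \<Longrightarrow> norm x \<le> R * (- t)"
proof -
  obtain R where R: "R > 0" "\<And>x. x \<in> P \<Longrightarrow> norm x \<le> R" using P_bound by blast
  have "norm x \<le> R * (- t)" if xt: "(x, t) \<in> C" for x t
  proof (cases "t = 0")
    case True
    then have "x = 0" using xt by (intro recession_zero) (simp add: C_iff)
    then show ?thesis using True by simp
  next
    case False
    then have t: "- t > 0" using C_nonpos[OF xt] by simp
    then have "(1 / - t) *\<^sub>R x \<in> P" using slice[OF t, of "(1 / - t) *\<^sub>R x"] xt by simp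
    from R(2)[OF this] show ?thesis using t by (simp add: field_simps)
  qed
  then show thesis using that R(1) by blast
qed

lemma closed_C: "closed C"
proof -
  have "C = (\<Inter>v\<in>V. {z. 0 \<le> (v, - 1) \<bullet> z})" by (auto simp: C_def)
  then show ?thesis by (auto intro!: closed_INT closed_halfspace_ge)
qed

lemma C_sets [measurable]: "C \<in> sets borel"
  using closed_C by (rule borel_closed)

lemma closed_P: "closed P"
proof -
  have "P = (\<Inter>v\<in>V. {x. - 1 \<le> v \<bullet> x})" by (auto simp: P_def)
  then show ?thesis by (auto intro!: closed_INT closed_halfspace_ge)
qed

lemma P_sets [measurable]: "P \<in> sets borel"
  using closed_P by (rule borel_closed)

lemma bounded_P: "bounded P" using bdd by (simp add: P_def)

lemma wt_measurable [measurable]: "wt \<in> borel_measurable borel"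
  unfolding wt_def[abs_def] by measurable

lemma wt_slice_measurable: "(\<lambda>x. wt (x, t)) \<in> borel_measurable borel"
proof -
  have "(\<lambda>x. (x, t)) \<in> (borel :: (real ^ 'n) measure) \<rightarrow>\<^sub>M borel"
    by (intro borel_measurable_continuous_onI continuous_intros)
  from measurable_compose[OF this wt_measurable] show ?thesis .
qed

lemma wt_nonneg: "0 \<le> wt z" by (simp add: wt_def)

lemma wt_slice: "s > 0 \<Longrightarrow> wt (s *\<^sub>R x, - s) = exp (- s) * indicator P x"
  using slice[of s x] by (simp add: wt_def)

lemma wt_pos_slice: "t > 0 \<Longrightarrow> wt (x, t) = 0"
  using C_nonpos[of x t] by (auto simp: wt_def)

lemma nn_integral_wt: "(\<integral>\<^sup>+ z. ennreal (wt z) * g z \<partial>lborel)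
    = (\<integral>\<^sup>+ x. \<integral>\<^sup>+ t. ennreal (exp t) * indicator {..m x} t * g (x, t) \<partial>lborel \<partial>lborel)"
  if [measurable]: "g \<in> borel_measurable borel"
proof -
  have "(\<lambda>z. ennreal (wt z) * g z) \<in> borel_measurable (lborel \<Otimes>\<^sub>M lborel)" unfolding lborel_prod by simp
  from lborel.nn_integral_fst[OF this]
  have "(\<integral>\<^sup>+ z. ennreal (wt z) * g z \<partial>lborel)
      = (\<integral>\<^sup>+ x. \<integral>\<^sup>+ t. ennreal (wt (x, t)) * g (x, t) \<partial>lborel \<partial>lborel)"
    by (simp add: lborel_prod)
  also have "\<dots> = (\<integral>\<^sup>+ x. \<integral>\<^sup>+ t. ennreal (exp t) * indicator {..m x} t * g (x, t) \<partial>lborel \<partial>lborel)"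
    by (intro nn_integral_cong) (auto simp: wt_def C_m split: split_indicator)
  finally show ?thesis .
qed

lemma mass_on_V: "mass_on V = (\<integral>\<^sup>+ x. ennreal (exp (m x)) \<partial>lborel)"
  unfolding mass_on_def using m_attained by (intro nn_integral_cong) auto

lemma mass_eq: "(\<integral>\<^sup>+ z. ennreal (wt z) \<partial>lborel) = mass_on V"
  using nn_integral_wt[of "\<lambda>_. 1"] by (simp add: mass_on_V nn_integral_exp_atMost)

text \<open>The slice of the cone at height \<open>- t\<close> is \<open>t\<close> times the polytope, so that the integral is bounded by
  values of the gamma function.\<close>

lemma wt_linear_integrable:
  "integrable lborel (\<lambda>z. wt z * (\<alpha> + l \<bullet> fst z + \<beta> * snd z))"
proof (rule integrableI_bounded)
  show [measurable]: "(\<lambda>z. wt z * (\<alpha> + l \<bullet> fst z + \<beta> * snd z)) \<in> borel_measurable lborel" by measurable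
  obtain R where R: "R > 0" "\<And>x t. (x, t) \<in> C \<Longrightarrow> norm x \<le> R * (- t)" using C_bound by blast
  define K where "K = \<bar>\<alpha>\<bar> + norm l * R + \<bar>\<beta>\<bar>"
  have K: "K \<ge> 0" using R(1) by (simp add: K_def)
  have bound: "norm (wt z * (\<alpha> + l \<bullet> fst z + \<beta> * snd z)) \<le> K * (wt z * (1 - snd z))" for z
  proof (cases "z \<in> C")
    case True
    obtain x t where z: "z = (x, t)" by fastforce
    have xt: "(x, t) \<in> C" using True z by simp
    have t: "t \<le> 0" using C_nonpos[OF xt] .
    have "\<bar>\<alpha> + l \<bullet> x + \<beta> * t\<bar> \<le> \<bar>\<alpha>\<bar> + norm l * (R * (- t)) + \<bar>\<beta>\<bar> * (- t)"
    proof -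
      have "\<bar>l \<bullet> x\<bar> \<le> norm l * (R * (- t))"
        using Cauchy_Schwarz_ineq2[of l x] mult_left_mono[OF R(2)[OF xt] norm_ge_zero[of l]] by linarith
      moreover have "\<bar>\<beta> * t\<bar> = \<bar>\<beta>\<bar> * (- t)" using t by (simp add: abs_mult)
      ultimately show ?thesis by linarith
    qed
    also have "\<dots> \<le> K * (1 - t)"
    proof -
      have "K * (1 - t) = (\<bar>\<alpha>\<bar> + norm l * (R * (- t)) + \<bar>\<beta>\<bar> * (- t)) + (\<bar>\<alpha>\<bar> * (- t) + norm l * R + \<bar>\<beta>\<bar>)"
        by (simp add: K_def algebra_simps)
      moreover have "0 \<le> \<bar>\<alpha>\<bar> * (- t) + norm l * R + \<bar>\<beta>\<bar>"
        using t R(1) by (intro add_nonneg_nonneg mult_nonneg_nonneg) auto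
      ultimately show ?thesis by linarith
    qed
    finally have "wt z * \<bar>\<alpha> + l \<bullet> x + \<beta> * t\<bar> \<le> wt z * (K * (1 - t))" by (rule mult_left_mono[OF _ wt_nonneg])
    then show ?thesis using wt_nonneg[of z] by (simp add: z abs_mult mult_ac)
  qed (simp add: wt_def)
  have "(\<integral>\<^sup>+ z. ennreal (norm (wt z * (\<alpha> + l \<bullet> fst z + \<beta> * snd z))) \<partial>lborel)
      \<le> (\<integral>\<^sup>+ z. ennreal K * ennreal (wt z * (1 - snd z)) \<partial>lborel)"
    using K bound by (intro nn_integral_mono) (simp add: ennreal_mult'[symmetric] ennreal_leI)
  also have "\<dots> = ennreal K * (\<integral>\<^sup>+ z. ennreal (wt z * (1 - snd z)) \<partial>lborel)"
    by (rule nn_integral_cmult) measurable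
  also have "(\<integral>\<^sup>+ z. ennreal (wt z * (1 - snd z)) \<partial>lborel)
      = (\<integral>\<^sup>+ t. \<integral>\<^sup>+ x. ennreal (wt (x, t) * (1 - t)) \<partial>lborel \<partial>lborel)"
  proof -
    have "(\<lambda>z. ennreal (wt z * (1 - snd z))) \<in> borel_measurable (lborel \<Otimes>\<^sub>M lborel)" unfolding lborel_prod by measurable
    from lborel_pair.nn_integral_snd[OF this] show ?thesis by (simp add: lborel_prod)
  qed
  also have "\<dots> = (\<integral>\<^sup>+ t. \<integral>\<^sup>+ x. ennreal (wt (x, - t) * (1 + t)) \<partial>lborel \<partial>lborel)"
  proof -
    have "(\<lambda>z. ennreal (wt (snd z, fst z) * (1 - fst z))) \<in> borel_measurable (lborel \<Otimes>\<^sub>M lborel)"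
    proof -
      have "(\<lambda>z. (snd z, fst z)) \<in> (borel :: (real \<times> (real ^ 'n)) measure) \<rightarrow>\<^sub>M borel"
        by (intro borel_measurable_continuous_onI continuous_intros)
      from measurable_compose[OF this wt_measurable] have [measurable]:
        "(\<lambda>z. wt (snd z, fst z)) \<in> borel_measurable (borel :: (real \<times> (real ^ 'n)) measure)" .
      show ?thesis unfolding lborel_prod by measurable
    qed
    from lborel.borel_measurable_nn_integral_fst[OF this]
    have "(\<lambda>t. \<integral>\<^sup>+ x. ennreal (wt (x, t) * (1 - t)) \<partial>lborel) \<in> borel_measurable borel" by simp
    from nn_integral_real_affine[OF this, of "-1" 0] show ?thesis by simp
  qed
  also have "\<dots> = (\<integral>\<^sup>+ t. emeasure lborel P * (ennreal (t ^ CARD('n) * exp (- t)) * indicator {0..} t + ennreal (t ^ Suc CARD('n) * exp (- t)) * indicator {0..} t) \<partial>lborel)"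
  proof (rule nn_integral_cong_AE)
    have "AE t in lborel. t \<noteq> (0::real)" by (rule AE_lborel_singleton)
    then show "AE t in lborel. (\<integral>\<^sup>+ x. ennreal (wt (x, - t) * (1 + t)) \<partial>lborel)
       = emeasure lborel P * (ennreal (t ^ CARD('n) * exp (- t)) * indicator {0..} t + ennreal (t ^ Suc CARD('n) * exp (- t)) * indicator {0..} t)"
    proof (rule AE_mp, intro AE_I2 impI)
      fix t :: real assume "t \<noteq> 0"
      show "(\<integral>\<^sup>+ x. ennreal (wt (x, - t) * (1 + t)) \<partial>lborel)
       = emeasure lborel P * (ennreal (t ^ CARD('n) * exp (- t)) * indicator {0..} t + ennreal (t ^ Suc CARD('n) * exp (- t)) * indicator {0..} t)"
      proof (cases "t > 0")
        case True
        note wt_slice_measurable [measurable]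
        have "(\<integral>\<^sup>+ x. ennreal (wt (x, - t) * (1 + t)) \<partial>lborel)
            = ennreal (t ^ CARD('n)) * (\<integral>\<^sup>+ x. ennreal (wt (t *\<^sub>R x, - t) * (1 + t)) \<partial>lborel)"
          using nn_integral_scale_euclidean[of "\<lambda>x. ennreal (wt (x, - t) * (1 + t))" t] True by simp
        also have "(\<integral>\<^sup>+ x. ennreal (wt (t *\<^sub>R x, - t) * (1 + t)) \<partial>lborel) = (\<integral>\<^sup>+ x. ennreal (exp (- t) * (1 + t)) * indicator P x \<partial>lborel)"
          using True by (intro nn_integral_cong) (simp add: wt_slice split: split_indicator)
        also have "\<dots> = ennreal (exp (- t) * (1 + t)) * emeasure lborel P"
          by (subst nn_integral_cmult) auto
        also have "ennreal (t ^ CARD('n)) * (ennreal (exp (- t) * (1 + t)) * emeasure lborel P)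
           = emeasure lborel P * ennreal (t ^ CARD('n) * exp (- t) + t ^ Suc CARD('n) * exp (- t))"
        proof -
          have "t ^ CARD('n) * (exp (- t) * (1 + t)) = t ^ CARD('n) * exp (- t) + t ^ Suc CARD('n) * exp (- t)"
            by (simp add: algebra_simps)
          moreover have "ennreal (t ^ CARD('n) * (exp (- t) * (1 + t))) = ennreal (t ^ CARD('n)) * ennreal (exp (- t) * (1 + t))"
            using True by (intro ennreal_mult) auto
          ultimately show ?thesis by (simp only: mult_ac)
        qed
        finally show ?thesis using True by (simp add: ennreal_plus)
      next
        case False
        then have "t < 0" using \<open>t \<noteq> 0\<close> by simp
        then show ?thesis using wt_pos_slice[of "- t"] by simp
      qed
    qed
  qed
  also have "\<dots> = emeasure lborel P * (ennreal (fact CARD('n)) + ennreal (fact (Suc CARD('n))))"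
    using nn_intergal_power_times_exp_Ici[of "CARD('n)"] nn_intergal_power_times_exp_Ici[of "Suc CARD('n)"]
    by (subst nn_integral_cmult, measurable, subst nn_integral_add) (auto simp del: power_Suc fact_Suc)
  finally have le: "(\<integral>\<^sup>+ z. ennreal (norm (wt z * (\<alpha> + l \<bullet> fst z + \<beta> * snd z))) \<partial>lborel)
     \<le> ennreal K * (emeasure lborel P * (ennreal (fact CARD('n)) + ennreal (fact (Suc CARD('n)))))" .
  have "emeasure lborel P < \<infinity>" using bounded_P by (rule emeasure_bounded_finite)
  then have "ennreal K * (emeasure lborel P * (ennreal (fact CARD('n)) + ennreal (fact (Suc CARD('n))))) < \<infinity>"
    by (simp add: ennreal_mult_less_top)
  then show "(\<integral>\<^sup>+ z. ennreal (norm (wt z * (\<alpha> + l \<bullet> fst z + \<beta> * snd z))) \<partial>lborel) < \<infinity>" using le by (rule le_less_trans[rotated])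
qed

lemma P_linear_integrable: "integrable lborel (\<lambda>x. indicator P x * (l \<bullet> x))"
proof -
  have "integrable lborel (\<lambda>x. indicator P x *\<^sub>R (l \<bullet> x))"
    using bounded_P closed_P
    by (intro borel_integrable_compact) (auto simp: compact_eq_bounded_closed intro!: continuous_intros)
  then show ?thesis by simp
qed

text \<open>The slice at height \<open>- t\<close> is a multiple of the polytope and has its barycenter above the origin. The
  height has mean \<open>- (n + 1)\<close>, since its distribution is proportional to \<open>t ^ n * exp (- t)\<close>. So the
  centroid of the weighted cone is \<open>(0, - (n + 1))\<close>, which is the content of this identity.\<close>

lemma wt_linear_integral:
  "(LINT z|lborel. wt z * (real (CARD('n) + 1) * \<beta> + l \<bullet> fst z + \<beta> * snd z)) = 0"
proof -
  let ?\<alpha> = "real (CARD('n) + 1) * \<beta>"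
  let ?f = "\<lambda>x t. wt (x, t) * (?\<alpha> + l \<bullet> x + \<beta> * t)"
  have "integrable (lborel \<Otimes>\<^sub>M lborel) (\<lambda>(x, t). ?f x t)"
    using wt_linear_integrable[of ?\<alpha> l \<beta>] by (simp add: lborel_prod case_prod_unfold)
  from lborel_pair.integral_snd[OF this]
  have "(LINT z|lborel. wt z * (?\<alpha> + l \<bullet> fst z + \<beta> * snd z)) = (LINT t|lborel. LINT x|lborel. ?f x t)"
    by (simp add: lborel_prod case_prod_unfold)
  also have "\<dots> = (LINT t|lborel. LINT x|lborel. ?f x (- t))"
    using lborel_integral_real_affine[of "-1" "\<lambda>t. LINT x|lborel. ?f x t" 0] by simp
  also have "\<dots> = (LINT t|lborel. measure lborel P * \<beta> * (real (CARD('n) + 1) * (t ^ CARD('n) * exp (- t) * indicator {0..} t) - t ^ Suc CARD('n) * exp (- t) * indicator {0..} t))"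
  proof (rule integral_cong_AE)
    have "AE t in lborel. t \<noteq> (0::real)" by (rule AE_lborel_singleton)
    then show "AE t in lborel. (LINT x|lborel. ?f x (- t))
       = measure lborel P * \<beta> * (real (CARD('n) + 1) * (t ^ CARD('n) * exp (- t) * indicator {0..} t) - t ^ Suc CARD('n) * exp (- t) * indicator {0..} t)"
    proof (rule AE_mp, intro AE_I2 impI)
      fix t :: real assume "t \<noteq> 0"
      show "(LINT x|lborel. ?f x (- t))
       = measure lborel P * \<beta> * (real (CARD('n) + 1) * (t ^ CARD('n) * exp (- t) * indicator {0..} t) - t ^ Suc CARD('n) * exp (- t) * indicator {0..} t)"
      proof (cases "t > 0")
        case True
        note wt_slice_measurable [measurable]
        have "(LINT x|lborel. ?f x (- t)) = t ^ CARD('n) * (LINT x|lborel. ?f (t *\<^sub>R x) (- t))"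
          using integral_scale_euclidean[of "\<lambda>x. ?f x (- t)" t] True by simp
        also have "(LINT x|lborel. ?f (t *\<^sub>R x) (- t))
            = (LINT x|lborel. exp (- t) * (?\<alpha> - \<beta> * t) * indicator P x + exp (- t) * t * (indicator P x * (l \<bullet> x)))"
          using True by (intro Bochner_Integration.integral_cong) (simp_all add: wt_slice algebra_simps)
        also have "\<dots> = exp (- t) * (?\<alpha> - \<beta> * t) * measure lborel P + exp (- t) * t * (LINT x|lborel. indicator P x * (l \<bullet> x))"
          using P_linear_integrable[of l] emeasure_bounded_finite[OF bounded_P]
          by (subst Bochner_Integration.integral_add) (auto simp: integrable_real_indicator)
        also have "(LINT x|lborel. indicator P x * (l \<bullet> x)) = 0" using centered by (simp add: P_def)
        finally show ?thesis using True by (simp add: algebra_simps)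
      next
        case False
        then have "t < 0" using \<open>t \<noteq> 0\<close> by simp
        then show ?thesis using wt_pos_slice[of "- t"] by simp
      qed
    qed
    show "(\<lambda>t. LINT x|lborel. ?f x (- t)) \<in> borel_measurable lborel"
    proof -
      have "(\<lambda>z. (snd z, - fst z)) \<in> (borel :: (real \<times> (real ^ 'n)) measure) \<rightarrow>\<^sub>M borel"
        by (intro borel_measurable_continuous_onI continuous_intros)
      from measurable_compose[OF this wt_measurable] have [measurable]:
        "(\<lambda>z. wt (snd z, - fst z)) \<in> borel_measurable (borel :: (real \<times> (real ^ 'n)) measure)" .
      have "(\<lambda>z. ?f (snd z) (- fst z)) \<in> borel_measurable (lborel \<Otimes>\<^sub>M lborel)" unfolding lborel_prod by measurable
      from lborel.borel_measurable_lebesgue_integral[of "\<lambda>t x. ?f x (- t)", unfolded case_prod_unfold, OF this]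
      show ?thesis by simp
    qed
  qed measurable
  also have "\<dots> = measure lborel P * \<beta> * (real (CARD('n) + 1) * fact CARD('n) - fact (Suc CARD('n)))"
    using has_bochner_integral_power_exp[of "CARD('n)"] has_bochner_integral_power_exp[of "Suc CARD('n)"]
    by (simp add: has_bochner_integral_iff del: power_Suc fact_Suc)
  also have "\<dots> = 0" by simp
  finally show ?thesis .
qed

lemma mass_finite: "mass_on V < \<infinity>"
proof -
  have "integrable lborel wt" using wt_linear_integrable[of 1 0 0] by simp
  then have "(\<integral>\<^sup>+ z. ennreal (wt z) \<partial>lborel) < \<infinity>"
    using wt_nonneg by (simp add: integrable_iff_bounded)
  then show ?thesis by (simp add: mass_eq)
qed

end

section \<open>The concentration inequality for centered polytopes\<close>

lemma adapted_basis:
  fixes S :: "(real ^ 'n) set"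
  assumes S: "subspace S"
  obtains b :: "nat \<Rightarrow> real ^ 'n"
  where "span (b ` {..<dim S}) = S" "span (b ` {..<CARD('n)}) = UNIV"
proof -
  obtain Bs where Bs: "Bs \<subseteq> S" "independent Bs" "S \<subseteq> span Bs" "card Bs = dim S"
    using basis_exists by blast
  obtain B where B: "Bs \<subseteq> B" "B \<subseteq> UNIV" "independent B" "UNIV \<subseteq> span B"
    using maximal_independent_subset_extend[OF subset_UNIV Bs(2)] by blast
  have fB: "finite B" "finite Bs" using B(3) Bs(2) by (auto intro: independent_imp_finite)
  have cB: "card B = CARD('n)" using basis_card_eq_dim[of B UNIV] B by simp
  let ?k = "dim S"
  obtain h1 where h1: "bij_betw h1 {0..<?k} Bs" using ex_bij_betw_nat_finite[OF fB(2)] Bs(4) by auto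
  obtain h2 where h2: "bij_betw h2 {0..<card (B - Bs)} (B - Bs)"
    using ex_bij_betw_nat_finite[of "B - Bs"] fB by auto
  have card: "card (B - Bs) = CARD('n) - ?k" "?k \<le> CARD('n)"
    using card_Diff_subset[OF fB(2) B(1)] cB Bs(4) card_mono[OF fB(1) B(1)] by auto
  define b where "b i = (if i < ?k then h1 i else h2 (i - ?k))" for i
  have "b ` {..<?k} = h1 ` {0..<?k}" by (intro image_cong) (auto simp: b_def)
  then have b1: "b ` {..<?k} = Bs" using h1 by (simp add: bij_betw_def)
  have "b ` {?k..<CARD('n)} = h2 ` ((\<lambda>i. i - ?k) ` {?k..<CARD('n)})"
    unfolding image_image by (intro image_cong) (auto simp: b_def)
  also have "(\<lambda>i. i - ?k) ` {?k..<CARD('n)} = {0..<card (B - Bs)}"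
    using card(2) by (auto simp: card(1) image_iff intro!: bexI[of _ "_ + ?k"])
  finally have b2: "b ` {?k..<CARD('n)} = B - Bs" using h2 by (simp add: bij_betw_def)
  have "{..<CARD('n)} = {..<?k} \<union> {?k..<CARD('n)}" using card(2) by auto
  then have "b ` {..<CARD('n)} = B" using b1 b2 B(1) by (simp only: image_Un) auto
  moreover have "span Bs = S" using Bs S by (simp add: span_subspace)
  ultimately show thesis using that[of b] b1 B(4) by auto
qed

lemma spanning_family_basis:
  fixes b :: "nat \<Rightarrow> 'a::euclidean_space"
  assumes sp: "span (b ` {..<DIM('a)}) = UNIV"
  shows "inj_on b {..<DIM('a)}" "independent (b ` {..<DIM('a)})"
proof -
  have "DIM('a) \<le> card (b ` {..<DIM('a)})"
    using span_card_ge_dim[of "b ` {..<DIM('a)}" UNIV] sp by simp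
  then have c: "card (b ` {..<DIM('a)}) = DIM('a)" using card_image_le[of "{..<DIM('a)}" b] by simp
  then show "inj_on b {..<DIM('a)}" by (intro eq_card_imp_inj_on) auto
  show "independent (b ` {..<DIM('a)})" using sp c by (intro card_le_dim_spanning[of _ UNIV]) auto
qed

text \<open>Both sides agree at \<open>e = 0\<close>, so that the inequality passes to the derivatives at \<open>0\<close>.\<close>

lemma first_order_inequality:
  fixes W U \<sigma> q :: real and D :: nat
  assumes le: "\<And>e. 0 < e \<Longrightarrow> e < 1 \<Longrightarrow> W + e * \<sigma> \<le> (1 / (1 - e)) ^ D * (W - (1 - exp (- (q * e))) * U)"
  shows "q * U + \<sigma> \<le> D * W"
proof (rule ccontr)
  assume neg: "\<not> ?thesis"
  define g where "g e = (W - (1 - exp (- (q * e))) * U) - (1 - e) ^ D * (W + e * \<sigma>)" for e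
  have "(g has_real_derivative (- (q * U) + D * W - \<sigma>)) (at 0)"
    unfolding g_def[abs_def] by (auto intro!: derivative_eq_intros simp: algebra_simps)
  from DERIV_neg_dec_right[OF this] neg
  obtain d where d: "d > 0" "\<And>h. h > 0 \<Longrightarrow> h < d \<Longrightarrow> g (0 + h) < g 0" by auto
  define h where "h = min (d / 2) (1 / 2)"
  have h: "0 < h" "h < d" "h < 1" using d(1) by (auto simp: h_def)
  have "(1 - h) ^ D * (W + h * \<sigma>) \<le> (1 - h) ^ D * ((1 / (1 - h)) ^ D * (W - (1 - exp (- (q * h))) * U))"
    using le[OF h(1,3)] h by (intro mult_left_mono) auto
  also have "\<dots> = W - (1 - exp (- (q * h))) * U" using h by (simp add: power_divide)
  finally have "0 \<le> g h" by (simp add: g_def)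
  moreover have "g 0 = 0" by (simp add: g_def)
  ultimately show False using d(2)[OF h(1,2)] by simp
qed

context centered_normals
begin

definition lift :: "real ^ 'n \<Rightarrow> (real ^ 'n) \<times> real" where "lift v = (v, - 1)"

text \<open>The contraction inequality on the cone, for \<open>M\<close> the orthogonal complement of \<open>lift ` A\<close>. The part of
  the cone over the contracted support lies at depth at least \<open>(n + 1) * e\<close> below each facet with
  normal in \<open>A\<close>; above the points \<open>x\<close> where the minimum is attained in \<open>A\<close> this costs the factor
  \<open>exp (- ((n + 1) * e))\<close> in the integral over the height.\<close>

theorem affine_concentration:
  assumes A: "affine A" "A \<noteq> {}"
  shows "(real CARD('n) + 1) * enn2real (mass_on (V \<inter> A)) \<le> (real_of_int (aff_dim A) + 1) * enn2real (mass_on V)" (is ?ineq)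
    and "(real CARD('n) + 1) * enn2real (mass_on (V \<inter> A)) = (real_of_int (aff_dim A) + 1) * enn2real (mass_on V)
      \<longrightarrow> (\<forall>v\<in>V. \<exists>x. v \<bullet> x = - 1 \<and> (\<forall>u\<in>V - {v}. - 1 < u \<bullet> x))
      \<longrightarrow> int (dim (lift ` (V - A))) \<le> int CARD('n) - aff_dim A" (is "?eq \<longrightarrow> ?facets \<longrightarrow> ?dim")
proof -
  obtain a0 where a0: "a0 \<in> A" using A(2) by blast
  define D where "D = (\<lambda>x. x - a0) ` A"
  have sD: "subspace D"
  proof -
    have "D = (+) (- a0) ` A" by (auto simp: D_def image_iff)
    then show ?thesis using affine_diffs_subspace[OF A(1) a0] by simp
  qed
  have dD: "aff_dim A = int (dim D)" unfolding D_def by (intro aff_dim_eq_dim_subtract) (simp add: a0 hull_inc)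
  define S where "S = orthogonal_comp D"
  have sS: "subspace S" by (simp add: S_def subspace_orthogonal_comp)
  let ?k = "dim S"
  have dS: "?k + dim D = CARD('n)"
    using dim_subspace_orthogonal_to_vectors[OF sD subspace_UNIV] by (simp add: S_def orthogonal_comp_def)
  obtain b where b: "span (b ` {..<?k}) = S" "span (b ` {..<CARD('n)}) = UNIV" using adapted_basis[OF sS] by blast
  define B where "B = (\<lambda>i. if i < CARD('n) then (b i, a0 \<bullet> b i) else (0, 1 :: real))"
  obtain c where c: "c > 0" "\<And>g. g \<in> borel_measurable borel \<Longrightarrow>
      (\<integral>\<^sup>+ x. g x \<partial>lborel) = ennreal c * fiber_integral B {..<Suc CARD('n)} g 0"
    by (rule nn_integral_shear_coordinates[OF b(2), of a0, folded B_def]) blast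
  have dimX: "DIM((real ^ 'n) \<times> real) = Suc CARD('n)" by simp
  have spB: "span (B ` {..<Suc CARD('n)}) = UNIV"
  proof -
    have sub: "subspace {x. (x, a0 \<bullet> x) \<in> span (B ` {..<Suc CARD('n)})}"
    proof (rule subspaceI)
      show "0 \<in> {x. (x, a0 \<bullet> x) \<in> span (B ` {..<Suc CARD('n)})}" by (simp add: span_zero flip: zero_prod_def)
      fix x y :: "real ^ 'n" and s :: real
      assume "x \<in> {x. (x, a0 \<bullet> x) \<in> span (B ` {..<Suc CARD('n)})}"
      then have x: "(x, a0 \<bullet> x) \<in> span (B ` {..<Suc CARD('n)})" by simp
      show "s *\<^sub>R x \<in> {x. (x, a0 \<bullet> x) \<in> span (B ` {..<Suc CARD('n)})}"
        using span_scale[OF x, of s] by simp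
      assume "y \<in> {x. (x, a0 \<bullet> x) \<in> span (B ` {..<Suc CARD('n)})}"
      then show "x + y \<in> {x. (x, a0 \<bullet> x) \<in> span (B ` {..<Suc CARD('n)})}"
        using span_add[OF x, of "(y, a0 \<bullet> y)"] by (simp add: inner_add_right)
    qed
    have "b ` {..<CARD('n)} \<subseteq> {x. (x, a0 \<bullet> x) \<in> span (B ` {..<Suc CARD('n)})}"
    proof
      fix z assume "z \<in> b ` {..<CARD('n)}"
      then obtain i where i: "i < CARD('n)" "z = b i" by blast
      then have "B i \<in> span (B ` {..<Suc CARD('n)})" by (intro span_base imageI) simp
      then show "z \<in> {x. (x, a0 \<bullet> x) \<in> span (B ` {..<Suc CARD('n)})}" using i by (simp add: B_def)
    qed
    from span_minimal[OF this sub] b(2) have 1: "(x, a0 \<bullet> x) \<in> span (B ` {..<Suc CARD('n)})" for x by auto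
    have "B CARD('n) \<in> span (B ` {..<Suc CARD('n)})" by (intro span_base imageI) simp
    then have 2: "(0, 1) \<in> span (B ` {..<Suc CARD('n)})" by (simp add: B_def)
    have "(x, t) \<in> span (B ` {..<Suc CARD('n)})" for x t
      using span_add[OF 1[of x] span_scale[OF 2, of "t - a0 \<bullet> x"]] by simp
    then show ?thesis by auto
  qed
  note basisB = spanning_family_basis[OF spB[folded dimX]]
  have kn: "?k \<le> CARD('n)" using dS by simp
  \<comment> \<open>Orthogonality to \<open>M\<close> recognizes the lifts of the points of \<open>A\<close>.\<close>
  have memA: "(\<forall>i<?k. lift v \<bullet> B i = 0) \<longleftrightarrow> v \<in> A" for v
  proof -
    have "(\<forall>i<?k. lift v \<bullet> B i = 0) \<longleftrightarrow> (\<forall>i<?k. (v - a0) \<bullet> b i = 0)"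
      using kn by (auto simp: lift_def B_def inner_diff_left)
    also have "\<dots> \<longleftrightarrow> (\<forall>z\<in>S. (v - a0) \<bullet> z = 0)"
    proof
      assume *: "\<forall>i<?k. (v - a0) \<bullet> b i = 0"
      show "\<forall>z\<in>S. (v - a0) \<bullet> z = 0"
      proof
        fix z assume "z \<in> S"
        then have "z \<in> span (b ` {..<?k})" using b(1) by simp
        then show "(v - a0) \<bullet> z = 0"
          by (induction rule: span_induct_alt) (use * in \<open>auto simp: inner_add_right\<close>)
      qed
    next
      assume *: "\<forall>z\<in>S. (v - a0) \<bullet> z = 0"
      have "b i \<in> S" if "i < ?k" for i using that b(1) by (metis imageI lessThan_iff span_base)
      then show "\<forall>i<?k. (v - a0) \<bullet> b i = 0" using * by blast
    qed
    also have "\<dots> \<longleftrightarrow> v - a0 \<in> orthogonal_comp S"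
      by (auto simp: orthogonal_comp_def orthogonal_def inner_commute)
    also have "\<dots> \<longleftrightarrow> v - a0 \<in> D" using orthogonal_comp_self[OF sD] by (simp add: S_def)
    also have "\<dots> \<longleftrightarrow> v \<in> A" by (auto simp: D_def)
    finally show ?thesis .
  qed
  obtain R where R: "R > 0" "\<And>x t. (x, t) \<in> C \<Longrightarrow> norm x \<le> R * (- t)" using C_bound by blast
  let ?\<tau> = "(0, - 1) :: (real ^ 'n) \<times> real" and ?p = "(0, - (real CARD('n) + 1)) :: (real ^ 'n) \<times> real"
  have wt_eq: "(if \<forall>u\<in>lift ` V. 0 \<le> u \<bullet> z then exp (- (?\<tau> \<bullet> z)) else 0) = wt z" for z
    by (cases z) (auto simp: wt_def C_def lift_def)
  interpret X: marginal_setting B ?k "lift ` V" ?\<tau> ?p c "1 / (R + 1)"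
  proof
    show "independent (B ` {..<DIM((real ^ 'n) \<times> real)})" "inj_on B {..<DIM((real ^ 'n) \<times> real)}" by (rule basisB)+
    show "?k \<le> DIM((real ^ 'n) \<times> real)" using kn by simp
    show "(\<integral>\<^sup>+ x. g x \<partial>lborel) = ennreal c * fiber_integral B {..<DIM((real ^ 'n) \<times> real)} g 0"
      if "g \<in> borel_measurable borel" for g using c(2)[OF that] by (simp only: dimX)
    show "finite (lift ` V)" using finV by simp
    show "1 / (R + 1) * norm z \<le> ?\<tau> \<bullet> z" if "\<forall>u\<in>lift ` V. 0 \<le> u \<bullet> z" for z
    proof -
      obtain x t where z: "z = (x, t)" by fastforce
      have xt: "(x, t) \<in> C" using that by (simp add: C_def lift_def z)
      have "norm z \<le> norm x + norm t" unfolding z by (rule norm_Pair_le)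
      also have "\<dots> \<le> (R + 1) * (- t)" using R(2)[OF xt] C_nonpos[OF xt] by (simp add: algebra_simps)
      finally show ?thesis using R(1) by (simp add: z field_simps)
    qed
    show "0 < u \<bullet> ?p" if "u \<in> lift ` V" for u using that by (auto simp: lift_def)
    show "has_bochner_integral lborel (\<lambda>z. (if \<forall>u\<in>lift ` V. 0 \<le> u \<bullet> z then exp (- (?\<tau> \<bullet> z)) else 0) * (l \<bullet> (z - ?p))) 0" for l
    proof -
      obtain l1 \<beta> where l: "l = (l1, \<beta>)" by fastforce
      have "l \<bullet> (z - ?p) = real (CARD('n) + 1) * \<beta> + l1 \<bullet> fst z + \<beta> * snd z" for z
        by (cases z) (simp add: l algebra_simps)
      then show ?thesis unfolding wt_eq
        using wt_linear_integrable[of "real (CARD('n) + 1) * \<beta>" l1 \<beta>] wt_linear_integral[of \<beta> l1]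
        by (simp add: has_bochner_integral_iff)
    qed
  qed (use R c in auto)
  have weight_eq: "X.weight = wt" by (rule ext) (simp only: X.weight_alt wt_eq)
  obtain l s where ls: "\<And>i. i < ?k \<Longrightarrow> l \<bullet> B i = 0" "s \<in> borel_measurable borel" "\<And>x. 0 \<le> s x"
    "\<And>x. X.marg x > 0 \<Longrightarrow> ln (X.marg x) = ln (X.marg ?p) + l \<bullet> (x - ?p) - s x"
    and contr: "\<And>e. 0 < e \<Longrightarrow> e < 1 \<Longrightarrow>
      (\<integral>\<^sup>+ x. ennreal (X.weight x) \<partial>lborel) + ennreal e * (\<integral>\<^sup>+ x. ennreal (X.weight x) * ennreal (s x) \<partial>lborel)
      \<le> ennreal ((1 / (1 - e)) ^ (DIM((real ^ 'n) \<times> real) - ?k)) *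
         (\<integral>\<^sup>+ x. ennreal (X.weight x) *
           indicator {x. \<forall>v\<in>lift ` V. (\<forall>i<?k. v \<bullet> B i = 0) \<longrightarrow> e * (v \<bullet> ?p) \<le> v \<bullet> x} x \<partial>lborel)"
    by (rule X.contraction_inequality) blast
  let ?q = "real CARD('n) + 1"
  let ?D = "Suc (dim D)"
  have D_eq: "DIM((real ^ 'n) \<times> real) - ?k = ?D" using dS by simp
  define W where "W = enn2real (mass_on V)"
  define U where "U = enn2real (mass_on (V \<inter> A))"
  have Um [measurable]: "{x. \<exists>v\<in>V \<inter> A. v \<bullet> x = m x} \<in> sets borel"
  proof -
    have "{x. \<exists>v\<in>V \<inter> A. v \<bullet> x = m x} = (\<Union>v\<in>V \<inter> A. {x \<in> space borel. v \<bullet> x = m x})" by auto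
    also have "\<dots> \<in> sets borel"
    proof (rule sets.finite_UN)
      show "{x \<in> space borel. v \<bullet> x = m x} \<in> sets borel" for v by measurable
    qed (use finV in simp)
    finally show ?thesis .
  qed
  have U_fin: "mass_on (V \<inter> A) < \<infinity>"
  proof -
    have "mass_on (V \<inter> A) \<le> mass_on V" unfolding mass_on_def
      by (intro nn_integral_mono) (auto split: split_indicator)
    then show ?thesis using mass_finite by (rule le_less_trans)
  qed
  have U: "mass_on (V \<inter> A) = ennreal U" "0 \<le> U" and W: "mass_on V = ennreal W" "0 \<le> W"
    using U_fin mass_finite by (simp_all add: U_def W_def)
  define \<sigma> where "\<sigma> = (\<integral>\<^sup>+ x. ennreal (X.weight x) * ennreal (s x) \<partial>lborel)"
  have shell: "mass_on V + ennreal e * \<sigma> \<le> ennreal ((1 / (1 - e)) ^ ?D) * ennreal (W - (1 - exp (- (?q * e))) * U)"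
    if e: "0 < e" "e < 1" for e
  proof -
    let ?E = "{z. \<forall>v\<in>lift ` V. (\<forall>i<?k. v \<bullet> B i = 0) \<longrightarrow> e * (v \<bullet> ?p) \<le> v \<bullet> z}"
    let ?F = "\<lambda>x. if \<exists>v\<in>V \<inter> A. v \<bullet> x = m x then exp (- (?q * e)) * exp (m x) else exp (m x)"
    have E_iff: "(x, t) \<in> ?E \<longleftrightarrow> (\<forall>v\<in>V \<inter> A. t \<le> v \<bullet> x - ?q * e)" for x t
      using memA by (auto simp: lift_def algebra_simps)
    have "closed ?E"
    proof -
      have "?E = (\<Inter>v\<in>{v \<in> lift ` V. \<forall>i<?k. v \<bullet> B i = 0}. {z. e * (v \<bullet> ?p) \<le> v \<bullet> z})" by auto
      then show ?thesis by (auto intro!: closed_INT closed_halfspace_ge)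
    qed
    then have Em: "?E \<in> sets borel" by (rule borel_closed)
    let ?G = "\<integral>\<^sup>+ z. ennreal (wt z) * indicator ?E z \<partial>lborel"
    have "?G = (\<integral>\<^sup>+ x. \<integral>\<^sup>+ t. ennreal (exp t) * indicator {..m x} t * indicator ?E (x, t) \<partial>lborel \<partial>lborel)"
      by (rule nn_integral_wt) (use Em in measurable)
    also have "\<dots> \<le> (\<integral>\<^sup>+ x. ennreal (?F x) \<partial>lborel)"
    proof (rule nn_integral_mono)
      fix x
      show "(\<integral>\<^sup>+ t. ennreal (exp t) * indicator {..m x} t * indicator ?E (x, t) \<partial>lborel) \<le> ennreal (?F x)"
      proof (cases "\<exists>v\<in>V \<inter> A. v \<bullet> x = m x")
        case True
        then obtain v where v: "v \<in> V \<inter> A" "v \<bullet> x = m x" by blast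
        have "(\<integral>\<^sup>+ t. ennreal (exp t) * indicator {..m x} t * indicator ?E (x, t) \<partial>lborel)
            \<le> (\<integral>\<^sup>+ t. ennreal (exp t) * indicator {..m x - ?q * e} t \<partial>lborel)"
        proof (rule nn_integral_mono)
          fix t
          have "t \<le> m x - ?q * e" if "(x, t) \<in> ?E" using that v unfolding E_iff by force
          then show "ennreal (exp t) * indicator {..m x} t * indicator ?E (x, t) \<le> ennreal (exp t) * indicator {..m x - ?q * e} t"
            by (auto split: split_indicator)
        qed
        then show ?thesis using True by (simp add: nn_integral_exp_atMost exp_diff exp_minus divide_inverse mult.commute)
      next
        case False
        have "(\<integral>\<^sup>+ t. ennreal (exp t) * indicator {..m x} t * indicator ?E (x, t) \<partial>lborel)
            \<le> (\<integral>\<^sup>+ t. ennreal (exp t) * indicator {..m x} t \<partial>lborel)"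
          by (intro nn_integral_mono) (auto split: split_indicator)
        then show ?thesis using False by (simp add: nn_integral_exp_atMost)
      qed
    qed
    finally have G_le: "?G \<le> (\<integral>\<^sup>+ x. ennreal (?F x) \<partial>lborel)" .
    have Fm [measurable]: "?F \<in> borel_measurable borel"
    proof (rule measurable_If)
      show "{x \<in> space borel. \<exists>v\<in>V \<inter> A. v \<bullet> x = m x} \<in> sets borel" using Um by simp
    qed measurable
    let ?r = "1 - exp (- (?q * e))"
    have r: "0 \<le> ?r" using e by simp
    have "(\<integral>\<^sup>+ x. ennreal (?F x) \<partial>lborel) + ennreal ?r * mass_on (V \<inter> A)
       = (\<integral>\<^sup>+ x. ennreal (?F x) + ennreal ?r * (ennreal (exp (m x)) * indicator {x. \<exists>v\<in>V \<inter> A. v \<bullet> x = m x} x) \<partial>lborel)"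
      unfolding mass_on_def
      by (subst nn_integral_add) (auto simp: nn_integral_cmult)
    also have "\<dots> = (\<integral>\<^sup>+ x. ennreal (exp (m x)) \<partial>lborel)"
    proof (rule nn_integral_cong)
      fix x
      show "ennreal (?F x) + ennreal ?r * (ennreal (exp (m x)) * indicator {x. \<exists>v\<in>V \<inter> A. v \<bullet> x = m x} x) = ennreal (exp (m x))"
        using r by (auto simp: ennreal_mult[symmetric] ennreal_plus[symmetric] left_diff_distrib simp del: ennreal_plus)
    qed
    finally have sum: "(\<integral>\<^sup>+ x. ennreal (?F x) \<partial>lborel) + ennreal ?r * mass_on (V \<inter> A) = mass_on V"
      by (simp add: mass_on_V)
    have F_fin: "(\<integral>\<^sup>+ x. ennreal (?F x) \<partial>lborel) \<noteq> \<infinity>"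
      using sum mass_finite by (metis add.commute ennreal_add_eq_top infinity_ennreal_def less_irrefl)
    define f where "f = enn2real (\<integral>\<^sup>+ x. ennreal (?F x) \<partial>lborel)"
    have f: "(\<integral>\<^sup>+ x. ennreal (?F x) \<partial>lborel) = ennreal f" "0 \<le> f" using F_fin by (auto simp: f_def less_top)
    have "ennreal (f + ?r * U) = ennreal W"
      using sum r unfolding f(1) U(1) W(1) by (simp add: ennreal_mult[symmetric] ennreal_plus[symmetric] f(2) U(2) del: ennreal_plus)
    then have "f + ?r * U = W" using f(2) r U(2) W(2) by (subst (asm) ennreal_inj) (auto intro!: add_nonneg_nonneg mult_nonneg_nonneg)
    then have "f = W - ?r * U" by linarith
    then have G: "?G \<le> ennreal (W - ?r * U)" using G_le unfolding f(1) by (simp only:)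
    have "mass_on V + ennreal e * \<sigma> \<le> ennreal ((1 / (1 - e)) ^ ?D) * ?G"
      using contr[OF e] unfolding weight_eq D_eq mass_eq \<sigma>_def .
    also have "\<dots> \<le> ennreal ((1 / (1 - e)) ^ ?D) * ennreal (W - ?r * U)"
      by (rule mult_left_mono[OF G]) simp
    finally show ?thesis .
  qed
  have \<sigma>_fin: "\<sigma> \<noteq> \<infinity>"
  proof
    assume "\<sigma> = \<infinity>"
    then have "mass_on V + ennreal (1/2) * \<sigma> = \<infinity>" by (simp add: ennreal_mult_top)
    moreover have "mass_on V + ennreal (1/2) * \<sigma>
        \<le> ennreal ((1 / (1 - 1/2)) ^ ?D) * ennreal (W - (1 - exp (- (?q * (1/2)))) * U)" by (rule shell) auto
    moreover have "ennreal ((1 / (1 - 1/2)) ^ ?D) * ennreal (W - (1 - exp (- (?q * (1/2)))) * U) < \<infinity>"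
      by (simp add: ennreal_mult_less_top)
    ultimately show False by (metis leD)
  qed
  define \<sigma>' where "\<sigma>' = enn2real \<sigma>"
  have \<sigma>': "\<sigma> = ennreal \<sigma>'" "0 \<le> \<sigma>'" using \<sigma>_fin by (auto simp: \<sigma>'_def less_top)
  have final: "?q * U + \<sigma>' \<le> real ?D * W"
  proof (rule first_order_inequality)
    fix e :: real assume e: "0 < e" "e < 1"
    have UW: "U \<le> W" unfolding U_def W_def
    proof (rule enn2real_mono)
      show "mass_on (V \<inter> A) \<le> mass_on V" unfolding mass_on_def
        by (intro nn_integral_mono) (auto split: split_indicator)
    qed (use mass_finite in \<open>simp add: less_top\<close>)
    have "(1 - exp (- (?q * e))) * U \<le> 1 * U" by (intro mult_right_mono) (use U(2) in auto)
    then have nn: "0 \<le> W - (1 - exp (- (?q * e))) * U" using UW by linarith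
    have "ennreal (W + e * \<sigma>') \<le> ennreal ((1 / (1 - e)) ^ ?D * (W - (1 - exp (- (?q * e))) * U))"
    proof -
      have "0 \<le> (1 / (1 - e)) ^ ?D" using e by simp
      then have "ennreal ((1 / (1 - e)) ^ ?D * (W - (1 - exp (- (?q * e))) * U))
          = ennreal ((1 / (1 - e)) ^ ?D) * ennreal (W - (1 - exp (- (?q * e))) * U)"
        using nn by (rule ennreal_mult)
      moreover have "ennreal (W + e * \<sigma>') = mass_on V + ennreal e * \<sigma>"
        using e \<sigma>'(2) W(2) unfolding W(1) \<sigma>'(1) by (simp add: ennreal_mult ennreal_plus)
      ultimately show ?thesis using shell[OF e] by (simp only:)
    qed
    then show "W + e * \<sigma>' \<le> (1 / (1 - e)) ^ ?D * (W - (1 - exp (- (?q * e))) * U)"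
      using e nn by (subst (asm) ennreal_le_iff) auto
  qed
  have real_D: "real ?D = real_of_int (aff_dim A) + 1" by (simp add: dD)
  show ?ineq using final \<sigma>'(2) unfolding real_D U_def[symmetric] W_def[symmetric] by linarith
  show "?eq \<longrightarrow> ?facets \<longrightarrow> ?dim"
  proof (intro impI)
    assume eq: ?eq and facets: ?facets
    have "\<sigma>' = 0" using final \<sigma>'(2) eq unfolding real_D U_def[symmetric] W_def[symmetric] by linarith
    then have "\<sigma> = 0" using \<sigma>'(1) by simp
    have "dim {v \<in> lift ` V. \<exists>i<?k. v \<bullet> B i \<noteq> 0} \<le> ?k"
    proof (rule X.rigidity[OF ls])
      show "(\<integral>\<^sup>+ x. ennreal (X.weight x) * ennreal (s x) \<partial>lborel) = 0" using \<open>\<sigma> = 0\<close> by (simp add: \<sigma>_def)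
      fix u assume "u \<in> lift ` V"
      then obtain v where v: "v \<in> V" "u = lift v" by blast
      obtain x where x: "v \<bullet> x = - 1" "\<forall>u\<in>V - {v}. - 1 < u \<bullet> x" using facets v(1) by blast
      show "\<exists>x. u \<bullet> x = 0 \<and> (\<forall>w\<in>lift ` V - {u}. 0 < w \<bullet> x)"
      proof (intro exI[of _ "(x, - 1)"] conjI ballI)
        show "u \<bullet> (x, - 1) = 0" using x(1) v(2) by (simp add: lift_def)
        fix w assume "w \<in> lift ` V - {u}"
        then obtain v' where v': "v' \<in> V" "v' \<noteq> v" "w = lift v'" using v(2) by blast
        then have "- 1 < v' \<bullet> x" using x(2) by blast
        then show "0 < w \<bullet> (x, - 1)" using v'(3) by (simp add: lift_def)
      qed
    qed
    moreover have "{v \<in> lift ` V. \<exists>i<?k. v \<bullet> B i \<noteq> 0} = lift ` (V - A)" using memA by blast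
    ultimately show ?dim using dS dD by simp
  qed
qed

end

section \<open>Lattices\<close>

lemma int_lattice_add: "x \<in> int_lattice \<Longrightarrow> y \<in> int_lattice \<Longrightarrow> x + y \<in> int_lattice"
  and int_lattice_diff: "x \<in> int_lattice \<Longrightarrow> y \<in> int_lattice \<Longrightarrow> x - y \<in> int_lattice"
  and int_lattice_zero: "0 \<in> int_lattice"
  and int_lattice_scale: "k \<in> \<int> \<Longrightarrow> x \<in> int_lattice \<Longrightarrow> k *\<^sub>R x \<in> int_lattice"
  and int_lattice_axis: "axis i 1 \<in> int_lattice"
  by (auto simp: int_lattice_def axis_def)

lemma int_lattice_inner: "x \<in> int_lattice \<Longrightarrow> y \<in> int_lattice \<Longrightarrow> x \<bullet> y \<in> \<int>"
  by (auto simp: inner_vec_def int_lattice_def intro!: Ints_sum Ints_mult)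

lemma int_lattice_coordinate: "x \<in> int_lattice \<Longrightarrow> \<exists>z. x $ i = of_int z"
  by (auto simp: int_lattice_def elim: Ints_cases)

definition subgroup_set :: "'a::real_vector set \<Rightarrow> bool" where
  "subgroup_set G \<longleftrightarrow> 0 \<in> G \<and> (\<forall>x\<in>G. \<forall>y\<in>G. x - y \<in> G)"

lemma subgroup_set_int_scale:
  assumes G: "subgroup_set G" and x: "x \<in> G"
  shows "of_int k *\<^sub>R x \<in> G"
proof -
  have neg: "- y \<in> G" if "y \<in> G" for y using G that unfolding subgroup_set_def by (metis diff_0)
  have add: "y + z \<in> G" if "y \<in> G" "z \<in> G" for y z
    using G that neg unfolding subgroup_set_def by (metis diff_minus_eq_add)
  have nat: "of_nat j *\<^sub>R x \<in> G" for j
    by (induction j) (use G x add in \<open>auto simp: subgroup_set_def scaleR_add_left\<close>)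
  show ?thesis
  proof (cases "k \<ge> 0")
    case True then show ?thesis using nat[of "nat k"] by simp
  next
    case False then show ?thesis using neg[OF nat[of "nat (- k)"]] by simp
  qed
qed

text \<open>Induction on the set of coordinates that may be nonzero. The values of one further coordinate form
  a subgroup of the integers, hence are the multiples of the least positive one; one vector with this
  value is added to the basis.\<close>

lemma subgroup_of_int_lattice_generators:
  fixes G :: "(real ^ 'n) set"
  assumes G: "subgroup_set G" "G \<subseteq> int_lattice" and S: "finite S"
  shows "\<exists>B. finite B \<and> independent B \<and> B \<subseteq> {x \<in> G. \<forall>i. i \<notin> S \<longrightarrow> x $ i = 0}
     \<and> (\<forall>x\<in>G. (\<forall>i. i \<notin> S \<longrightarrow> x $ i = 0) \<longrightarrow> (\<exists>c :: real ^ 'n \<Rightarrow> int. x = (\<Sum>b\<in>B. of_int (c b) *\<^sub>R b)))"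
  using S
proof (induction S)
  case empty
  have "x = 0" if "\<forall>i. i \<notin> {} \<longrightarrow> x $ i = 0" for x :: "real ^ 'n" using that by (simp add: vec_eq_iff)
  then show ?case by (intro exI[of _ "{}"]) (auto simp: independent_empty)
next
  case (insert j S)
  let ?G = "\<lambda>S. {x \<in> G. \<forall>i. i \<notin> S \<longrightarrow> x $ i = 0}"
  obtain B where B: "finite B" "independent B" "B \<subseteq> ?G S"
    "\<And>x. x \<in> ?G S \<Longrightarrow> \<exists>c :: real ^ 'n \<Rightarrow> int. x = (\<Sum>b\<in>B. of_int (c b) *\<^sub>R b)"
    using insert.IH by blast
  show ?case
  proof (cases "\<forall>x\<in>?G (insert j S). x $ j = 0")
    case True
    then have "?G (insert j S) = ?G S" by auto
    show ?thesis
    proof (intro exI[of _ B] conjI ballI impI)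
      show "B \<subseteq> ?G (insert j S)" using B(3) by auto
      fix x assume "x \<in> G" "\<forall>i. i \<notin> insert j S \<longrightarrow> x $ i = 0"
      then have "x \<in> ?G S" using \<open>?G (insert j S) = ?G S\<close> by blast
      then show "\<exists>c :: real ^ 'n \<Rightarrow> int. x = (\<Sum>b\<in>B. of_int (c b) *\<^sub>R b)" by (rule B(4))
    qed (use B in auto)
  next
    case False
    \<comment> \<open>The positive values of the coordinate \<open>j\<close> on the subgroup.\<close>
    let ?Q = "\<lambda>d::nat. 0 < d \<and> (\<exists>x\<in>?G (insert j S). x $ j = real d)"
    obtain x where x: "x \<in> ?G (insert j S)" "x $ j \<noteq> 0" using False by blast
    have sub: "subgroup_set (?G (insert j S))" using G(1) by (auto simp: subgroup_set_def)
    obtain z where z: "x $ j = of_int z" using x(1) G(2) int_lattice_coordinate by blast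
    have "\<exists>d. ?Q d"
    proof (cases "z > 0")
      case True
      then show ?thesis using x z by (intro exI[of _ "nat z"]) auto
    next
      case False
      have "of_int (-1) *\<^sub>R x \<in> ?G (insert j S)" by (rule subgroup_set_int_scale[OF sub x(1)])
      then show ?thesis using False x z by (intro exI[of _ "nat (- z)"]) force
    qed
    then have Q: "?Q (LEAST d. ?Q d)" by (rule LeastI_ex)
    define d where "d = (LEAST d. ?Q d)"
    obtain g where g: "g \<in> ?G (insert j S)" "g $ j = real d" and d: "0 < d" using Q unfolding d_def by blast
    have least: "d \<le> e" if "?Q e" for e unfolding d_def using that by (rule Least_le)
    have gB: "g \<notin> span B"
    proof
      assume "g \<in> span B"
      moreover have "subspace {x :: real ^ 'n. x $ j = 0}" by (auto simp: subspace_def)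
      moreover have "B \<subseteq> {x. x $ j = 0}" using B(3) insert.hyps by auto
      ultimately have "g $ j = 0" using span_minimal by blast
      then show False using g d by simp
    qed
    have gnB: "g \<notin> B" using gB span_base by blast
    have comb: "\<exists>c :: real ^ 'n \<Rightarrow> int. y = (\<Sum>b\<in>insert g B. of_int (c b) *\<^sub>R b)" if y: "y \<in> ?G (insert j S)" for y
    proof -
      obtain w where w: "y $ j = of_int w" using y G(2) int_lattice_coordinate by blast
      define q where "q = w div int d"
      define u where "u = y - of_int q *\<^sub>R g"
      have uG: "u \<in> ?G (insert j S)" unfolding u_def
        using sub subgroup_set_int_scale[OF sub g(1), of q] y by (simp only: subgroup_set_def)
      have "u $ j = of_int (w - q * int d)" by (simp add: u_def w g)
      also have "w - q * int d = w mod int d" by (simp add: q_def minus_div_mult_eq_mod)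
      finally have uj: "u $ j = of_int (w mod int d)" .
      have "w mod int d = 0"
      proof (rule ccontr)
        assume "w mod int d \<noteq> 0"
        then have pos: "0 < w mod int d" using d pos_mod_sign[of "int d" w] by linarith
        have "?Q (nat (w mod int d))"
        proof
          show "\<exists>x\<in>?G (insert j S). x $ j = real (nat (w mod int d))"
            using pos by (intro bexI[OF _ uG]) (simp add: uj)
        qed (use pos in simp)
        then have "d \<le> nat (w mod int d)" by (rule least)
        then have "int d \<le> w mod int d" using pos by linarith
        moreover have "w mod int d < int d" using d by (intro pos_mod_bound) simp
        ultimately show False by linarith
      qed
      then have "u \<in> ?G S" using uG uj by (auto simp: insert_iff)
      then obtain c :: "real ^ 'n \<Rightarrow> int" where c: "u = (\<Sum>b\<in>B. of_int (c b) *\<^sub>R b)" using B(4) by blast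
      have "(\<Sum>b\<in>insert g B. of_int ((c(g := q)) b) *\<^sub>R b) = of_int q *\<^sub>R g + (\<Sum>b\<in>B. of_int ((c(g := q)) b) *\<^sub>R b)"
        using B(1) gnB by simp
      also have "(\<Sum>b\<in>B. of_int ((c(g := q)) b) *\<^sub>R b) = (\<Sum>b\<in>B. of_int (c b) *\<^sub>R b)"
        using gnB by (intro sum.cong) auto
      also have "of_int q *\<^sub>R g + \<dots> = y" by (simp add: c[symmetric] u_def)
      finally have y_eq: "(\<Sum>b\<in>insert g B. of_int ((c(g := q)) b) *\<^sub>R b) = y" .
      show ?thesis by (rule exI[of _ "c(g := q)"]) (rule y_eq[symmetric])
    qed
    show ?thesis
    proof (intro exI[of _ "insert g B"] conjI)
      show "independent (insert g B)" using gB B(2) by (rule independent_insertI)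
      show "insert g B \<subseteq> ?G (insert j S)" using g(1) B(3) by auto
    qed (use B(1) comb in auto)
  qed
qed

lemma subgroup_of_int_lattice_basis:
  fixes G :: "(real ^ 'n) set"
  assumes G: "subgroup_set G" "G \<subseteq> int_lattice"
  obtains B where "finite B" "independent B" "B \<subseteq> G"
    "\<And>x. x \<in> G \<Longrightarrow> \<exists>c :: real ^ 'n \<Rightarrow> int. x = (\<Sum>b\<in>B. of_int (c b) *\<^sub>R b)"
proof -
  obtain B where B: "finite B" "independent B" "B \<subseteq> {x \<in> G. \<forall>i. i \<notin> UNIV \<longrightarrow> x $ i = 0}"
    "\<forall>x\<in>G. (\<forall>i. i \<notin> UNIV \<longrightarrow> x $ i = 0) \<longrightarrow> (\<exists>c :: real ^ 'n \<Rightarrow> int. x = (\<Sum>b\<in>B. of_int (c b) *\<^sub>R b))"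
    using subgroup_of_int_lattice_generators[OF G, of UNIV] by auto
  show thesis by (rule that[of B]) (use B in auto)
qed

lemma subgroup_set_sum:
  assumes G: "subgroup_set G" and B: "B \<subseteq> G" "finite B"
  shows "(\<Sum>b\<in>B. of_int (c b) *\<^sub>R b) \<in> G"
  using B(2,1)
proof (induction B)
  case empty then show ?case using G by (simp add: subgroup_set_def)
next
  case (insert x B)
  have "- (of_int (- c x) *\<^sub>R x) = of_int (c x) *\<^sub>R x" by simp
  moreover have "(\<Sum>b\<in>B. of_int (c b) *\<^sub>R b) - of_int (- c x) *\<^sub>R x \<in> G"
    using G insert subgroup_set_int_scale[OF G, of x "- c x"] unfolding subgroup_set_def by blast
  ultimately show ?case using insert by (simp add: add.commute)
qed

text \<open>Gram--Schmidt orthogonalization over the rationals, with cleared denominators.\<close>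

lemma integral_orthogonal_projection:
  fixes W :: "(real ^ 'n) set"
  assumes "finite W" "W \<subseteq> int_lattice" "x \<in> int_lattice"
  shows "\<exists>q y. q \<in> \<int> \<and> q > 0 \<and> y \<in> int_lattice \<and> (\<forall>w\<in>W. y \<bullet> w = 0) \<and> q *\<^sub>R x - y \<in> span W"
  using assms
proof (induction W arbitrary: x)
  case empty
  then show ?case by (intro exI[of _ 1] exI[of _ x]) auto
next
  case (insert w W)
  obtain q1 y1 where 1: "q1 \<in> \<int>" "q1 > 0" "y1 \<in> int_lattice" "\<forall>u\<in>W. y1 \<bullet> u = 0" "q1 *\<^sub>R w - y1 \<in> span W"
    using insert by (metis insert_subset)
  obtain q y where 2: "q \<in> \<int>" "q > 0" "y \<in> int_lattice" "\<forall>u\<in>W. y \<bullet> u = 0" "q *\<^sub>R x - y \<in> span W"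
    using insert by (metis insert_subset)
  have orth_span: "z \<bullet> u = 0" if "\<forall>u\<in>W. z \<bullet> u = 0" "u \<in> span W" for z u
    using that(2) by (induction rule: span_induct_alt) (use that(1) in \<open>auto simp: inner_add_right\<close>)
  have spW: "u \<in> span (insert w W)" if "u \<in> span W" for u using that span_mono[of W "insert w W"] by blast
  show ?case
  proof (cases "y1 = 0")
    case True
    have "q1 * (y \<bullet> w) = y \<bullet> (q1 *\<^sub>R w - y1)" by (simp add: True)
    also have "\<dots> = 0" using orth_span[OF 2(4) 1(5)] .
    finally have "y \<bullet> w = 0" using 1(2) by simp
    then show ?thesis using 2 spW by (intro exI[of _ q] exI[of _ y]) auto
  next
    case False
    define y' where "y' = (y1 \<bullet> y1) *\<^sub>R y - (y \<bullet> y1) *\<^sub>R y1"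
    have y': "y' \<in> int_lattice" unfolding y'_def
      using 1 2 by (intro int_lattice_diff int_lattice_scale int_lattice_inner)
    have y'W: "y' \<bullet> u = 0" if "u \<in> W" for u using 1(4) 2(4) that by (simp add: y'_def inner_diff_left)
    have "y' \<bullet> y1 = 0" by (simp add: y'_def inner_diff_left)
    moreover have "y' \<bullet> (q1 *\<^sub>R w - y1) = 0" using orth_span[OF _ 1(5)] y'W by blast
    ultimately have "q1 * (y' \<bullet> w) = 0" by (simp add: inner_diff_right)
    then have y'w: "y' \<bullet> w = 0" using 1(2) by simp
    have y1s: "y1 \<in> span (insert w W)"
    proof -
      have "q1 *\<^sub>R w - (q1 *\<^sub>R w - y1) \<in> span (insert w W)"
        by (rule span_diff[OF span_scale[OF span_base] spW[OF 1(5)]]) simp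
      then show ?thesis by simp
    qed
    have "((y1 \<bullet> y1) * q) *\<^sub>R x - y' = (y1 \<bullet> y1) *\<^sub>R (q *\<^sub>R x - y) + (y \<bullet> y1) *\<^sub>R y1"
      by (simp add: y'_def scaleR_diff_right)
    also have "\<dots> \<in> span (insert w W)" by (rule span_add[OF span_scale[OF spW[OF 2(5)]] span_scale[OF y1s]])
    finally show ?thesis using 1 2 False y' y'W y'w
      by (intro exI[of _ "(y1 \<bullet> y1) * q"] exI[of _ y']) (auto intro!: Ints_mult int_lattice_inner)
  qed
qed

lemma integral_orthogonal_vector:
  fixes W :: "(real ^ 'n) set"
  assumes W: "finite W" "W \<subseteq> int_lattice" "span W \<noteq> UNIV"
  obtains y where "y \<in> int_lattice" "y \<noteq> 0" "\<And>w. w \<in> W \<Longrightarrow> y \<bullet> w = 0"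
proof -
  have "\<exists>i. axis i 1 \<notin> span W"
  proof (rule ccontr)
    assume "\<not> ?thesis"
    then have "Basis \<subseteq> span W" by (auto simp: Basis_cart)
    then have "span Basis \<subseteq> span W" by (rule span_minimal) simp
    then show False using W(3) by (simp add: top.extremum_unique)
  qed
  then obtain i where i: "axis i 1 \<notin> span W" by blast
  obtain q y where y: "q > 0" "y \<in> int_lattice" "\<forall>w\<in>W. y \<bullet> w = 0" "q *\<^sub>R axis i 1 - y \<in> span W"
    using integral_orthogonal_projection[OF W(1,2) int_lattice_axis[of i]] by blast
  have "y \<noteq> 0"
  proof
    assume "y = 0"
    then have "q *\<^sub>R axis i 1 \<in> span W" using y(4) by simp
    from span_scale[OF this, of "1 / q"] show False using i y(1) by simp
  qed
  then show thesis using that y by blast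
qed

text \<open>Divide by the largest possible positive integer.\<close>

lemma primitive_multiple:
  fixes w :: "real ^ 'n"
  assumes w: "w \<in> int_lattice" "w \<noteq> 0"
  obtains g :: nat and v where "g > 0" "w = real g *\<^sub>R v" "primitive_vector int_lattice v"
proof -
  define K where "K = {g::nat. g > 0 \<and> (1 / real g) *\<^sub>R w \<in> int_lattice}"
  obtain i where i: "w $ i \<noteq> 0" using w(2) by (auto simp: vec_eq_iff)
  have le: "real g \<le> \<bar>w $ i\<bar>" if "g \<in> K" for g
  proof -
    have "w $ i / real g \<in> \<int>" using that by (simp add: K_def int_lattice_def)
    moreover have "w $ i / real g \<noteq> 0" using i that by (simp add: K_def)
    ultimately have "1 \<le> \<bar>w $ i / real g\<bar>" by (rule Ints_nonzero_abs_ge1)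
    then show ?thesis using that by (simp add: K_def field_simps)
  qed
  have "finite K"
  proof (rule finite_subset)
    show "K \<subseteq> {..nat \<lceil>\<bar>w $ i\<bar>\<rceil>}" using le by (fastforce simp: le_nat_iff le_ceiling_iff)
  qed simp
  moreover have "1 \<in> K" using w(1) by (simp add: K_def)
  ultimately have max: "Max K \<in> K" "\<And>g. g \<in> K \<Longrightarrow> g \<le> Max K" by (auto intro: Max_in)
  define g where "g = Max K"
  define v where "v = (1 / real g) *\<^sub>R w"
  have g: "g > 0" and vL: "v \<in> int_lattice" using max(1) by (auto simp: K_def g_def v_def)
  have wv: "w = real g *\<^sub>R v" using g by (simp add: v_def)
  have "primitive_vector int_lattice v" unfolding primitive_vector_def
  proof (intro conjI ballI allI impI)
    show "v \<in> int_lattice" by fact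
    show v0: "v \<noteq> 0" using wv w(2) by auto
    fix u :: "real ^ 'n" and k :: int assume u: "u \<in> int_lattice" "v = of_int k *\<^sub>R u"
    have k: "k \<noteq> 0" using u v0 by auto
    have "(1 / real (g * nat \<bar>k\<bar>)) *\<^sub>R w = of_int (sgn k) *\<^sub>R u"
    proof -
      have "w = (real g * of_int k) *\<^sub>R u" using wv u(2) by simp
      then show ?thesis using g k by (simp add: sgn_if field_simps)
    qed
    also have "\<dots> \<in> int_lattice" using u(1) by (intro int_lattice_scale) auto
    finally have "g * nat \<bar>k\<bar> \<in> K" using g k by (simp add: K_def)
    then have "g * nat \<bar>k\<bar> \<le> g" using max(2) by (simp add: g_def)
    then show "\<bar>k\<bar> = 1" using g k by simp
  qed
  then show thesis using that g wv by blast
qed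

text \<open>The factor \<open>\<rho>\<close> is rational. Written in lowest terms as \<open>a / b\<close>, it yields the vector \<open>w / b\<close>, of
  which both vectors are integral multiples, and which is integral by Bezout's identity.\<close>

lemma primitive_parallel_eq:
  fixes v w :: "real ^ 'n"
  assumes v: "primitive_vector int_lattice v" and w: "primitive_vector int_lattice w"
    and par: "v = \<rho> *\<^sub>R w" "\<rho> > 0"
  shows "v = w"
proof -
  have vL: "v \<in> int_lattice" "v \<noteq> 0" and wL: "w \<in> int_lattice" "w \<noteq> 0"
    using v w by (auto simp: primitive_vector_def)
  obtain i where i: "w $ i \<noteq> 0" using wL(2) by (auto simp: vec_eq_iff)
  obtain z where z: "v $ i = of_int z" using vL int_lattice_coordinate by blast
  obtain z' where z': "w $ i = of_int z'" using wL int_lattice_coordinate by blast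
  have z'0: "z' \<noteq> 0" using i z' by simp
  have \<rho>: "\<rho> * of_int z' = of_int z" using par(1) z z' by simp
  define g where "g = gcd z z'"
  have g0: "g \<noteq> 0" using z'0 by (simp add: g_def)
  obtain a where a: "z = g * a" unfolding g_def by (meson dvdE gcd_dvd1)
  obtain b where b: "z' = g * b" unfolding g_def by (meson dvdE gcd_dvd2)
  have b0: "b \<noteq> 0" using b z'0 by auto
  have \<rho>b: "\<rho> * of_int b = of_int a"
  proof -
    have "of_int g * (\<rho> * of_int b) = of_int g * (of_int a :: real)" using \<rho> a b by (simp add: mult_ac)
    then show ?thesis using g0 by simp
  qed
  obtain x y where xy: "x * z + y * z' = g" using bezout_int[of z z'] by (auto simp: g_def)
  then have "g * (x * a + y * b) = g * 1" by (simp add: a b algebra_simps)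
  then have bez: "x * a + y * b = 1" using g0 by (simp only: mult_cancel_left) simp
  define u where "u = (1 / of_int b) *\<^sub>R w"
  have wu: "w = of_int b *\<^sub>R u" using b0 by (simp add: u_def)
  have vu: "v = of_int a *\<^sub>R u" unfolding par(1) wu using \<rho>b by simp
  have "u = of_int (x * a + y * b) *\<^sub>R u" by (simp add: bez)
  also have "\<dots> = of_int x *\<^sub>R v + of_int y *\<^sub>R w" by (simp add: vu wu scaleR_add_left)
  also have "\<dots> \<in> int_lattice" using vL wL by (intro int_lattice_add int_lattice_scale) auto
  finally have uL: "u \<in> int_lattice" .
  have "\<bar>a\<bar> = 1" using v uL vu by (auto simp: primitive_vector_def)
  moreover have "\<bar>b\<bar> = 1" using w uL wu by (auto simp: primitive_vector_def)
  ultimately have "\<bar>\<rho>\<bar> = 1" using \<rho>b by (metis abs_mult mult.right_neutral of_int_1 of_int_abs)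
  then show ?thesis using par by simp
qed

lemma det_Ints: "(\<And>i j. M $ i $ j \<in> \<int>) \<Longrightarrow> det (M :: real ^ 'n ^ 'n) \<in> \<int>"
  unfolding det_def by (intro Ints_sum Ints_mult Ints_prod) auto

section \<open>Facets of lattice polytopes\<close>

lemma facet_affine_hull:
  fixes P :: "'a::euclidean_space set"
  assumes F: "F facet_of P" and P: "affine hull P = UNIV" and a: "a \<noteq> 0" "F \<subseteq> {x. a \<bullet> x = b}"
  shows "affine hull F = {x. a \<bullet> x = b}"
proof (rule affine_dim_equal)
  have "aff_dim P = DIM('a)" using P aff_dim_affine_hull[of P] by simp
  then show "aff_dim (affine hull F) = aff_dim {x. a \<bullet> x = b}"
    using F a(1) by (simp add: facet_of_def aff_dim_hyperplane)
  show "affine hull F \<subseteq> {x. a \<bullet> x = b}" using a(2) by (intro hull_minimal affine_hyperplane)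
  show "affine hull F \<noteq> {}" using F by (simp add: facet_of_def)
qed (auto simp: affine_hyperplane)

lemma polytope_facet_representation:
  fixes P :: "'a::euclidean_space set"
  assumes P: "polytope P" "affine hull P = UNIV"
  obtains H a b where "finite H" "P = \<Inter>H" "\<And>h. h \<in> H \<Longrightarrow> a h \<noteq> 0 \<and> h = {x. a h \<bullet> x \<le> b h}"
    "\<And>F. F facet_of P \<longleftrightarrow> (\<exists>h. h \<in> H \<and> F = P \<inter> {x. a h \<bullet> x = b h})"
proof -
  obtain H where H: "finite H" "P = affine hull P \<inter> \<Inter>H"
    "\<forall>h\<in>H. \<exists>a b. a \<noteq> 0 \<and> h = {x. a \<bullet> x \<le> b}" "\<forall>F'. F' \<subset> H \<longrightarrow> P \<subset> affine hull P \<inter> \<Inter>F'"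
    using polytope_imp_polyhedron[OF P(1)] unfolding polyhedron_Int_affine_minimal by blast
  obtain a where a: "\<forall>h\<in>H. \<exists>b. a h \<noteq> 0 \<and> h = {x. a h \<bullet> x \<le> b}" using bchoice[OF H(3)] by blast
  obtain b where b: "\<forall>h\<in>H. a h \<noteq> 0 \<and> h = {x. a h \<bullet> x \<le> b h}" using bchoice[OF a] by blast
  show thesis
  proof (rule that[OF H(1)])
    show "P = \<Inter>H" using H(2) P(2) by simp
    show "a h \<noteq> 0 \<and> h = {x. a h \<bullet> x \<le> b h}" if "h \<in> H" for h using b that by blast
    show "F facet_of P \<longleftrightarrow> (\<exists>h. h \<in> H \<and> F = P \<inter> {x. a h \<bullet> x = b h})" for F
    proof (rule facet_of_polyhedron_explicit[OF H(1,2)])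
      show "a h \<noteq> 0 \<and> h = {x. a h \<bullet> x \<le> b h}" if "h \<in> H" for h using b that by blast
      show "P \<subset> affine hull P \<inter> \<Inter>F'" if "F' \<subset> H" for F' using H(4) that by simp
    qed
  qed
qed

lemma facet_supporting_halfspace:
  fixes P :: "'a::euclidean_space set"
  assumes P: "polytope P" "affine hull P = UNIV" and F: "F facet_of P"
  obtains a b where "a \<noteq> 0" "P \<subseteq> {x. a \<bullet> x \<le> b}" "F = P \<inter> {x. a \<bullet> x = b}"
proof -
  obtain H a b where H: "P = \<Inter>H" "\<And>h. h \<in> H \<Longrightarrow> a h \<noteq> 0 \<and> h = {x. a h \<bullet> x \<le> b h}"
    "\<And>F. F facet_of P \<longleftrightarrow> (\<exists>h. h \<in> H \<and> F = P \<inter> {x. a h \<bullet> x = b h})"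
    using polytope_facet_representation[OF P] by metis
  obtain h where h: "h \<in> H" "F = P \<inter> {x. a h \<bullet> x = b h}" using F H(3) by blast
  have "P \<subseteq> h" using H(1) h(1) by blast
  then show thesis using that[of "a h" "b h"] H(2)[OF h(1)] h(2) by auto
qed

lemma constant_on_hyperplane:
  fixes a v :: "'a::euclidean_space"
  assumes a: "a \<noteq> 0" and F: "affine hull F = {x. a \<bullet> x = b}" and v: "\<And>u. u \<in> F \<Longrightarrow> v \<bullet> u = \<beta>"
  obtains \<kappa> where "v = \<kappa> *\<^sub>R a" "\<beta> = \<kappa> * b"
proof -
  have "affine hull F \<subseteq> {x. v \<bullet> x = \<beta>}" using v by (intro hull_minimal affine_hyperplane) auto
  then have v': "v \<bullet> x = \<beta>" if "a \<bullet> x = b" for x using that F by blast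
  define f where "f = (b / (a \<bullet> a)) *\<^sub>R a"
  have f: "a \<bullet> f = b" using a by (simp add: f_def)
  define \<kappa> where "\<kappa> = (a \<bullet> v) / (a \<bullet> a)"
  define x where "x = v - \<kappa> *\<^sub>R a"
  have ax: "a \<bullet> x = 0" using a by (simp add: x_def \<kappa>_def inner_diff_right)
  have "v \<bullet> (f + x) = \<beta>" using f ax by (intro v') (simp add: inner_add_right)
  then have "v \<bullet> x = 0" using v'[OF f] by (simp add: inner_add_right)
  then have "x \<bullet> x = 0" using ax by (simp add: x_def inner_diff_left)
  then have "v = \<kappa> *\<^sub>R a" by (simp add: x_def)
  moreover have "\<beta> = \<kappa> * b" using v'[OF f] f calculation by simp
  ultimately show thesis by (rule that)
qed

lemma polytope_of_lattice_polytope: "lattice_polytope P \<Longrightarrow> polytope P"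
  unfolding lattice_polytope_def polytope_def by blast

lemma point_off_facet:
  fixes a :: "'a::euclidean_space"
  assumes "affine hull P = UNIV" "a \<noteq> 0" "P \<subseteq> {x. a \<bullet> x \<le> b}"
  obtains u where "u \<in> P" "a \<bullet> u < b"
proof -
  have "\<not> P \<subseteq> {x. a \<bullet> x = b}"
  proof
    assume "P \<subseteq> {x. a \<bullet> x = b}"
    then have "affine hull P \<subseteq> {x. a \<bullet> x = b}" by (intro hull_minimal affine_hyperplane)
    then have "a \<bullet> x = b" for x using assms(1) by auto
    from this[of 0] this[of a] show False using assms(2) by simp
  qed
  then show thesis using assms(3) that by force
qed

lemma facet_presentation_parallel:
  assumes P: "affine hull P = UNIV" and F: "F facet_of P"
    and a: "a \<noteq> 0" "P \<subseteq> {x. a \<bullet> x \<le> b}" "F = P \<inter> {x. a \<bullet> x = b}"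
    and v: "facet_presentation P F v c"
  obtains \<mu> where "\<mu> > 0" "v = - \<mu> *\<^sub>R a" "of_int c = \<mu> * b"
proof -
  have hull: "affine hull F = {x. a \<bullet> x = b}" using a(3) by (intro facet_affine_hull[OF F P a(1)]) blast
  have vF: "v \<bullet> u = - of_int c" if "u \<in> F" for u
    using v that by (auto simp: facet_presentation_def inner_commute)
  obtain \<kappa> where l: "v = \<kappa> *\<^sub>R a" "- of_int c = \<kappa> * b" using constant_on_hyperplane[OF a(1) hull vF] .
  obtain u where u: "u \<in> P" "a \<bullet> u < b" using point_off_facet[OF P a(1,2)] .
  have "u \<notin> F" using u(2) a(3) by auto
  then have "u \<bullet> v \<noteq> - of_int c" "u \<bullet> v \<ge> - of_int c" using v u(1) by (auto simp: facet_presentation_def)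
  moreover have "u \<bullet> v = \<kappa> * (a \<bullet> u)" by (simp add: l(1) inner_commute)
  ultimately have "\<kappa> * b < \<kappa> * (a \<bullet> u)" using l(2) by linarith
  then have "\<kappa> < 0" using u(2) by (smt (verit) mult_less_cancel_left)
  then show thesis using that[of "- \<kappa>"] l by simp
qed

text \<open>The hyperplane of a facet is spanned by lattice points, hence has an integral normal vector, which
  can be made primitive.\<close>

lemma facet_presentation_exists:
  fixes P :: "(real ^ 'n) set"
  assumes P: "lattice_polytope P" "affine hull P = UNIV" and F: "F facet_of P"
  shows "\<exists>v c. facet_presentation P F v c"
proof -
  obtain S where S: "finite S" "S \<subseteq> int_lattice" "P = convex hull S" using P(1) by (auto simp: lattice_polytope_def)
  obtain a b where a: "a \<noteq> 0" "P \<subseteq> {x. a \<bullet> x \<le> b}" "F = P \<inter> {x. a \<bullet> x = b}"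
    using facet_supporting_halfspace[OF polytope_of_lattice_polytope[OF P(1)] P(2) F] .
  have hull: "affine hull F = {x. a \<bullet> x = b}" using a(3) by (intro facet_affine_hull[OF F P(2) a(1)]) blast
  obtain S' where S': "S' \<subseteq> S" "F = convex hull S'"
    using face_of_convex_hull_subset[of S F] finite_imp_compact[OF S(1)] F S(3) by (auto simp: facet_of_def)
  have "S' \<noteq> {}" using F S'(2) by (auto simp: facet_of_def)
  then obtain s0 where s0: "s0 \<in> S'" by blast
  have S'F: "S' \<subseteq> F" using S'(2) by (simp add: hull_subset)
  define W where "W = (\<lambda>s. s - s0) ` S'"
  have W: "finite W" "W \<subseteq> int_lattice"
    using S S'(1) s0 finite_subset[OF S'(1) S(1)] by (auto simp: W_def intro!: int_lattice_diff)
  have "span W \<noteq> UNIV"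
  proof
    assume sp: "span W = UNIV"
    have aS: "a \<bullet> s = b" if "s \<in> S'" for s using S'F that a(3) by blast
    have "a \<bullet> w = 0" if "w \<in> W" for w using that s0 by (auto simp: W_def inner_diff_right aS)
    then have "span W \<subseteq> {x. a \<bullet> x = 0}" by (intro span_minimal) (auto simp: subspace_hyperplane)
    then have "a \<bullet> a = 0" using sp by blast
    then show False using a(1) by simp
  qed
  then obtain y where y: "y \<in> int_lattice" "y \<noteq> 0" "\<And>w. w \<in> W \<Longrightarrow> y \<bullet> w = 0"
    using integral_orthogonal_vector[OF W] by blast
  have "S' \<subseteq> {x. y \<bullet> x = y \<bullet> s0}"
  proof
    fix s assume "s \<in> S'"
    then have "y \<bullet> (s - s0) = 0" using y(3) by (simp add: W_def)
    then show "s \<in> {x. y \<bullet> x = y \<bullet> s0}" by (simp add: inner_diff_right)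
  qed
  then have "F \<subseteq> {x. y \<bullet> x = y \<bullet> s0}" unfolding S'(2) by (intro hull_minimal convex_hyperplane)
  then have yF: "y \<bullet> u = y \<bullet> s0" if "u \<in> F" for u using that by blast
  obtain \<kappa> where l: "y = \<kappa> *\<^sub>R a" "y \<bullet> s0 = \<kappa> * b" using constant_on_hyperplane[OF a(1) hull yF] .
  have l0: "\<kappa> \<noteq> 0" using l(1) y(2) by auto
  \<comment> \<open>The sign makes it an inner normal.\<close>
  define w where "w = (- sgn \<kappa>) *\<^sub>R y"
  have w: "w \<in> int_lattice" unfolding w_def using y(1) by (intro int_lattice_scale) (simp_all add: sgn_if)
  have w': "w \<noteq> 0" "w = - \<bar>\<kappa>\<bar> *\<^sub>R a"
    using y(2) l l0 by (auto simp: w_def sgn_if)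
  obtain g :: nat and v where g: "g > 0" "w = real g *\<^sub>R v" "primitive_vector int_lattice v"
    using primitive_multiple[OF w w'(1)] .
  define \<mu> where "\<mu> = \<bar>\<kappa>\<bar> / real g"
  have \<mu>: "\<mu> > 0" using l0 g(1) by (simp add: \<mu>_def)
  have v: "v = - \<mu> *\<^sub>R a"
  proof -
    have "v = (1 / real g) *\<^sub>R w" using g by simp
    then show ?thesis by (simp add: w'(2) \<mu>_def)
  qed
  have "s0 \<bullet> v \<in> \<int>" using s0 S' S(2) g(3) by (intro int_lattice_inner) (auto simp: primitive_vector_def)
  then obtain z where z: "s0 \<bullet> v = of_int z" by (auto elim: Ints_cases)
  have as0: "a \<bullet> s0 = b" using s0 S'F a(3) by auto
  have zb: "of_int z = - \<mu> * b" using z as0 by (simp add: v inner_commute)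
  have uv: "u \<bullet> v = - \<mu> * (a \<bullet> u)" for u by (simp add: v inner_commute)
  have "facet_presentation P F v (- z)"
    unfolding facet_presentation_def
  proof (intro conjI ballI)
    show "F = {u \<in> P. u \<bullet> v = - of_int (- z)}" using \<mu> by (auto simp: uv a(3) zb)
    show "u \<bullet> v \<ge> - of_int (- z)" if "u \<in> P" for u
      using that a(2) \<mu> by (auto simp: uv zb intro!: mult_left_mono)
  qed (rule g(3))
  then show ?thesis by blast
qed

lemma facet_presentation_unique:
  fixes P :: "(real ^ 'n) set"
  assumes P: "lattice_polytope P" "affine hull P = UNIV" and F: "F facet_of P"
    and v: "facet_presentation P F v c" and w: "facet_presentation P F w d"
  shows "v = w" "c = d"
proof -
  obtain a b where a: "a \<noteq> 0" "P \<subseteq> {x. a \<bullet> x \<le> b}" "F = P \<inter> {x. a \<bullet> x = b}"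
    using facet_supporting_halfspace[OF polytope_of_lattice_polytope[OF P(1)] P(2) F] .
  obtain \<mu> where \<mu>: "\<mu> > 0" "v = - \<mu> *\<^sub>R a" "of_int c = \<mu> * b" using facet_presentation_parallel[OF P(2) F a v] .
  obtain \<nu> where \<nu>: "\<nu> > 0" "w = - \<nu> *\<^sub>R a" "of_int d = \<nu> * b" using facet_presentation_parallel[OF P(2) F a w] .
  show vw: "v = w"
  proof (rule primitive_parallel_eq)
    show "v = (\<mu> / \<nu>) *\<^sub>R w" using \<mu> \<nu> by simp
  qed (use v w \<mu> \<nu> in \<open>auto simp: facet_presentation_def\<close>)
  obtain f where f: "f \<in> F" using F by (auto simp: facet_of_def)
  then have "f \<in> {u \<in> P. u \<bullet> v = - of_int c}" "f \<in> {u \<in> P. u \<bullet> w = - of_int d}"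
    using v w unfolding facet_presentation_def by blast+
  then have "(of_int c :: real) = of_int d" using vw by simp
  then show "c = d" by simp
qed

lemma facet_presentation_inner_normal:
  fixes P :: "(real ^ 'n) set"
  assumes P: "lattice_polytope P" "affine hull P = UNIV" and F: "F facet_of P"
  shows "facet_presentation P F (inner_normal P F) (facet_constant P F)"
proof -
  obtain v c where vc: "facet_presentation P F v c" using facet_presentation_exists[OF P F] by blast
  have "inner_normal P F = v" unfolding inner_normal_def
    using vc facet_presentation_unique(1)[OF P F] by (intro the_equality) blast+
  moreover have "facet_constant P F = c" unfolding facet_constant_def
    using vc facet_presentation_unique(2)[OF P F] by (intro the_equality) blast+
  ultimately show ?thesis using vc by simp
qed

text \<open>A facet that meets the relative interior of \<open>F\<close> contains \<open>F\<close>.\<close>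

lemma facet_avoiding_point:
  fixes P :: "'a::euclidean_space set"
  assumes P: "polytope P" and F: "F facet_of P"
  obtains x where "x \<in> F" "\<And>G. G facet_of P \<Longrightarrow> G \<noteq> F \<Longrightarrow> x \<notin> G"
proof -
  have "convex F" using F face_of_imp_convex[of F P] by (simp add: facet_of_def polytope_imp_convex[OF P])
  then obtain x where x: "x \<in> rel_interior F" using F rel_interior_eq_empty[of F] by (auto simp: facet_of_def)
  have "x \<notin> G" if G: "G facet_of P" "G \<noteq> F" for G
  proof
    assume "x \<in> G"
    then have "F \<subseteq> G" using x F G(1) by (intro subset_of_face_of[of G P F]) (auto simp: facet_of_def face_of_imp_subset)
    moreover have "F face_of G" using F G(1) \<open>F \<subseteq> G\<close> face_of_subset[of F P G] by (auto simp: facet_of_def face_of_imp_subset)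
    moreover have "convex G" using G face_of_imp_convex[of G P] by (simp add: facet_of_def polytope_imp_convex[OF P])
    ultimately have "aff_dim F < aff_dim G" using G(2) by (intro face_of_aff_dim_lt) auto
    then show False using F G(1) by (simp add: facet_of_def)
  qed
  then show thesis using that x rel_interior_subset by blast
qed

section \<open>Lattice volumes of facets\<close>

text \<open>The matrix of a lattice basis and its inverse are both integral, so its determinant is \<open>1\<close> or \<open>- 1\<close>.\<close>

lemma unimodular_coordinates:
  fixes b :: "nat \<Rightarrow> real ^ 'n"
  assumes b: "\<And>i. i < CARD('n) \<Longrightarrow> b i \<in> int_lattice"
    and gen: "\<And>x. x \<in> int_lattice \<Longrightarrow> \<exists>c :: nat \<Rightarrow> int. x = (\<Sum>i<CARD('n). of_int (c i) *\<^sub>R b i)"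
    and [measurable]: "g \<in> borel_measurable borel"
  shows "(\<integral>\<^sup>+ x. g x \<partial>lborel) = fiber_integral b {..<CARD('n)} g 0"
proof -
  obtain e :: "'n \<Rightarrow> nat" where e: "bij_betw e UNIV {..<CARD('n)}" using finite_type_bij by blast
  have eN: "e j < CARD('n)" for j using e by (auto simp: bij_betw_def)
  have "Basis \<subseteq> span (b ` {..<CARD('n)})"
  proof
    fix x :: "real ^ 'n" assume "x \<in> Basis"
    then have "x \<in> int_lattice" by (auto simp: Basis_cart int_lattice_axis)
    then obtain c :: "nat \<Rightarrow> int" where "x = (\<Sum>i<CARD('n). of_int (c i) *\<^sub>R b i)" using gen by blast
    also have "\<dots> \<in> span (b ` {..<CARD('n)})" by (intro span_sum span_scale span_base) auto
    finally show "x \<in> span (b ` {..<CARD('n)})" .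
  qed
  then have "span (Basis :: (real ^ 'n) set) \<subseteq> span (b ` {..<CARD('n)})" by (rule span_minimal) simp
  then have sp: "span (b ` {..<CARD('n)}) = UNIV" by (simp add: top.extremum_unique)
  let ?T = "\<lambda>x :: real ^ 'n. \<Sum>j\<in>UNIV. x $ j *\<^sub>R b (e j)"
  obtain c :: "'n \<Rightarrow> nat \<Rightarrow> int" where c: "\<And>j. axis j 1 = (\<Sum>i<CARD('n). of_int (c j i) *\<^sub>R b i)"
    using gen[OF int_lattice_axis] by metis
  define N :: "real ^ 'n ^ 'n" where "N = (\<chi> i j. of_int (c j (e i)))"
  have T: "matrix ?T $ i $ j = b (e j) $ i" for i j
  proof -
    have "?T (axis j 1) = (\<Sum>k\<in>UNIV. if k = j then b (e k) else 0)"
      by (intro sum.cong) (auto simp: axis_def)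
    then have "?T (axis j 1) = b (e j)" by simp
    then show ?thesis unfolding matrix_def by (simp only: vec_lambda_beta)
  qed
  have "matrix ?T ** N = mat 1"
  proof -
    have "(matrix ?T ** N) $ i $ j = axis j 1 $ i" for i j
    proof -
      have "(matrix ?T ** N) $ i $ j = (\<Sum>k\<in>UNIV. of_int (c j (e k)) *\<^sub>R b (e k)) $ i"
        by (simp add: matrix_matrix_mult_def T N_def mult.commute)
      also have "(\<Sum>k\<in>UNIV. of_int (c j (e k)) *\<^sub>R b (e k)) = (\<Sum>i<CARD('n). of_int (c j i) *\<^sub>R b i)"
        by (rule sum.reindex_bij_betw[OF e])
      finally show ?thesis by (simp add: c[symmetric])
    qed
    then show ?thesis by (simp add: vec_eq_iff mat_def axis_def)
  qed
  then have "det (matrix ?T ** N) = det (mat 1 :: real ^ 'n ^ 'n)" by (rule arg_cong)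
  then have "det (matrix ?T) * det N = 1" by (simp only: det_mul det_I)
  moreover have "det (matrix ?T) \<in> \<int>" using b eN by (intro det_Ints) (simp add: T int_lattice_def)
  moreover have "det N \<in> \<int>" by (intro det_Ints) (simp add: N_def)
  ultimately have "\<bar>det (matrix ?T)\<bar> = 1"
  proof -
    assume *: "det (matrix ?T) * det N = 1" "det (matrix ?T) \<in> \<int>" "det N \<in> \<int>"
    obtain z z' where z: "det (matrix ?T) = of_int z" "det N = of_int z'" using *(2,3) by (auto elim!: Ints_cases)
    have "of_int (z * z') = (1 :: real)" using *(1) z by simp
    then have "z * z' = 1" by linarith
    then have "\<bar>z\<bar> = 1" by (simp add: zmult_eq_1_iff) auto
    then show ?thesis using z(1) by simp
  qed
  then show ?thesis using nn_integral_coordinates[OF e sp assms(3)] by simp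
qed

context centered_normals
begin

text \<open>The mass of the cone over the facet with normal \<open>v\<close>.\<close>

definition face_mass :: "real ^ 'n \<Rightarrow> ennreal" where
  "face_mass v = (\<integral>\<^sup>+ x. ennreal (exp (m x)) * indicator {x. v \<bullet> x = m x} x \<partial>lborel)"

lemma face_set_measurable [measurable]: "{x. v \<bullet> x = m x} \<in> sets borel"
proof -
  have "{x \<in> space borel. v \<bullet> x = m x} \<in> sets borel" by measurable
  then show ?thesis by simp
qed

lemma AE_distinct_normals: "AE x in lborel. \<forall>v\<in>V. \<forall>w\<in>V. v \<noteq> w \<longrightarrow> v \<bullet> x \<noteq> w \<bullet> x"
proof -
  have "AE x in lborel. v \<noteq> w \<longrightarrow> v \<bullet> x \<noteq> w \<bullet> x" for v w :: "real ^ 'n"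
  proof (cases "v = w")
    case False
    have "negligible {x. (v - w) \<bullet> x = 0}" using False by (intro negligible_hyperplane) simp
    moreover have "{x. (v - w) \<bullet> x = 0} \<in> sets borel" by (intro borel_closed closed_hyperplane)
    ultimately have "{x. (v - w) \<bullet> x = 0} \<in> null_sets lborel"
      by (simp add: negligible_iff_null_sets null_sets_completion_iff)
    from AE_not_in[OF this] show ?thesis by eventually_elim (auto simp: inner_diff_left)
  qed simp
  then show ?thesis using finV by (simp add: AE_finite_all)
qed

lemma mass_on_eq_sum: assumes S: "S \<subseteq> V" shows "mass_on S = (\<Sum>v\<in>S. face_mass v)"
proof -
  have fS: "finite S" using S finV finite_subset by blast
  have "mass_on S = (\<integral>\<^sup>+ x. (\<Sum>v\<in>S. ennreal (exp (m x)) * indicator {x. v \<bullet> x = m x} x) \<partial>lborel)"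
    unfolding mass_on_def
  proof (rule nn_integral_cong_AE)
    show "AE x in lborel. ennreal (exp (m x)) * indicator {x. \<exists>v\<in>S. v \<bullet> x = m x} x
        = (\<Sum>v\<in>S. ennreal (exp (m x)) * indicator {x. v \<bullet> x = m x} x)"
      using AE_distinct_normals
    proof eventually_elim
      case (elim x)
      show ?case
      proof (cases "\<exists>v\<in>S. v \<bullet> x = m x")
        case True
        then obtain v where v: "v \<in> S" "v \<bullet> x = m x" by blast
        have "(\<Sum>w\<in>S. ennreal (exp (m x)) * indicator {x. w \<bullet> x = m x} x)
            = (\<Sum>w\<in>S. if w = v then ennreal (exp (m x)) else 0)"
        proof (rule sum.cong)
          fix w assume "w \<in> S"
          then have "w = v \<or> w \<bullet> x \<noteq> m x" using elim v S by (metis subsetD)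
          then show "ennreal (exp (m x)) * indicator {x. w \<bullet> x = m x} x = (if w = v then ennreal (exp (m x)) else 0)"
            using v(2) by auto
        qed simp
        then show ?thesis using True v(1) fS by auto
      next
        case False
        then show ?thesis by (auto intro!: sum.neutral[symmetric])
      qed
    qed
  qed
  also have "\<dots> = (\<Sum>v\<in>S. face_mass v)" unfolding face_mass_def by (rule nn_integral_sum) measurable
  finally show ?thesis .
qed

lemma m_scale: "s > 0 \<Longrightarrow> m (s *\<^sub>R x) = s * m x"
proof -
  assume s: "s > 0"
  obtain v w where v: "v \<in> V" "v \<bullet> x = m x" and w: "w \<in> V" "w \<bullet> (s *\<^sub>R x) = m (s *\<^sub>R x)"
    using m_attained by blast
  have "m (s *\<^sub>R x) \<le> s * m x" using m_le[OF v(1), of "s *\<^sub>R x"] v(2) by simp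
  moreover have "s * m x \<le> s * (w \<bullet> x)" using m_le[OF w(1), of x] s by simp
  ultimately show ?thesis using w(2) by simp
qed

text \<open>As \<open>v \<bullet> p = - 1\<close>, a lattice frame of the facet together with its origin \<open>p\<close> is a basis of the full
  lattice. In these coordinates the region where the minimum is attained by \<open>v\<close> consists of the
  multiples \<open>s F\<close> for \<open>s \<ge> 0\<close>, with weight \<open>exp (- s)\<close>; the factorial is the integral of
  \<open>s ^ (n - 1) * exp (- s)\<close>.\<close>

lemma face_mass_eq_frame_volume:
  assumes v: "v \<in> V" "v \<in> int_lattice" and F: "F = {x \<in> P. v \<bullet> x = - 1}"
    and hull: "affine hull F = {x. v \<bullet> x = - 1}" and frame: "lattice_frame F p b"
  shows "nat (aff_dim F) = CARD('n) - 1"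
    and "face_mass v = ennreal (fact (CARD('n) - 1)) * emeasure (\<Pi>\<^sub>M i\<in>{..<CARD('n) - 1}. lborel)
      {t \<in> space (\<Pi>\<^sub>M i\<in>{..<CARD('n) - 1}. lborel). p + (\<Sum>i<CARD('n) - 1. t i *\<^sub>R b i) \<in> F}"
proof -
  let ?k = "CARD('n) - 1"
  have n: "CARD('n) = Suc ?k" by simp
  have v0: "v \<noteq> 0"
  proof
    assume "v = 0"
    then have "affine hull F = {}" using hull by simp
    moreover have "p \<in> affine hull F" using frame by (simp add: lattice_frame_def)
    ultimately show False by simp
  qed
  have "aff_dim F = aff_dim {x. v \<bullet> x = - 1}" using aff_dim_affine_hull[of F] hull by simp
  then show dim: "nat (aff_dim F) = ?k" using v0 by (simp add: aff_dim_hyperplane nat_diff_distrib)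
  have p: "v \<bullet> p = - 1" "p \<in> int_lattice" using frame hull by (auto simp: lattice_frame_def)
  let ?G = "{x - p |x. x \<in> affine hull F \<inter> int_lattice}"
  have inj: "inj_on b {..<?k}" and zb: "Z_basis (b ` {..<?k}) ?G"
    using frame dim by (auto simp: lattice_frame_def)
  have comb: "\<exists>c :: nat \<Rightarrow> int. y = (\<Sum>i<?k. of_int (c i) *\<^sub>R b i)" if "y \<in> ?G" for y
  proof -
    have "?G = {\<Sum>b\<in>b ` {..<?k}. of_int (c b) *\<^sub>R b |c. True}"
      using zb by (simp add: Z_basis_def)
    with that obtain c :: "real ^ 'n \<Rightarrow> int" where "y = (\<Sum>b\<in>b ` {..<?k}. of_int (c b) *\<^sub>R b)" by blast
    then have "y = (\<Sum>i<?k. of_int (c (b i)) *\<^sub>R b i)" unfolding sum.reindex[OF inj] comp_def .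
    then show ?thesis by (rule exI[of _ "\<lambda>i. c (b i)"])
  qed
  have bG: "b i \<in> ?G" if "i < ?k" for i
  proof -
    have "b i = (\<Sum>u\<in>b ` {..<?k}. of_int (if u = b i then 1 else 0) *\<^sub>R u)"
      using that by (simp add: if_distrib[of of_int] if_distrib[of "\<lambda>c. c *\<^sub>R _"] cong: if_cong)
    then have "b i \<in> {\<Sum>u\<in>b ` {..<?k}. of_int (c u) *\<^sub>R u |c :: real ^ 'n \<Rightarrow> int. True}"
      by (intro CollectI exI[of _ "\<lambda>u. if u = b i then 1 else 0"]) simp
    then show ?thesis using zb by (simp add: Z_basis_def)
  qed
  have vb: "v \<bullet> b i = 0" "b i \<in> int_lattice" if "i < ?k" for i
    using bG[OF that] hull p by (auto simp: inner_diff_right intro: int_lattice_diff)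
  define B where "B i = (if i < ?k then b i else p)" for i
  have BL: "B i \<in> int_lattice" for i using vb p by (simp add: B_def)
  have gen: "\<exists>c :: nat \<Rightarrow> int. x = (\<Sum>i<CARD('n). of_int (c i) *\<^sub>R B i)" if x: "x \<in> int_lattice" for x
  proof -
    obtain z where z: "v \<bullet> x = of_int z" using int_lattice_inner[OF v(2) x] by (auto elim: Ints_cases)
    have "x + of_int z *\<^sub>R p = (x + of_int (z + 1) *\<^sub>R p) - p" by (simp add: scaleR_add_left)
    moreover have "x + of_int (z + 1) *\<^sub>R p \<in> affine hull F \<inter> int_lattice"
      using x p z by (auto simp: hull inner_add_right intro!: int_lattice_add int_lattice_scale)
    ultimately have "x + of_int z *\<^sub>R p \<in> ?G" by blast
    then obtain c :: "nat \<Rightarrow> int" where c: "x + of_int z *\<^sub>R p = (\<Sum>i<?k. of_int (c i) *\<^sub>R b i)" using comb by blast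
    have "(\<Sum>i<Suc ?k. of_int ((c(?k := - z)) i) *\<^sub>R B i) = (\<Sum>i<?k. of_int (c i) *\<^sub>R b i) - of_int z *\<^sub>R p"
    proof -
      have "(\<Sum>i<?k. of_int ((c(?k := - z)) i) *\<^sub>R B i) = (\<Sum>i<?k. of_int (c i) *\<^sub>R b i)"
        by (intro sum.cong) (auto simp: B_def)
      then show ?thesis unfolding sum.lessThan_Suc by (simp add: B_def)
    qed
    also have "\<dots> = x" unfolding c[symmetric] by simp
    finally have "x = (\<Sum>i<CARD('n). of_int ((c(?k := - z)) i) *\<^sub>R B i)" using n by simp
    then show ?thesis by (rule exI[of _ "c(?k := - z)"])
  qed
  have Fm [measurable]: "F \<in> sets borel"
  proof -
    have "F = P \<inter> {x. v \<bullet> x = - 1}" using F by blast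
    then show ?thesis using closed_P closed_hyperplane[of v "- 1"] by (auto intro: borel_closed closed_Int)
  qed
  define g where "g x = ennreal (exp (m x)) * indicator {x. v \<bullet> x = m x} x" for x
  have [measurable]: "g \<in> borel_measurable borel" unfolding g_def by measurable
  define L where "L = fiber_integral B {..<?k} (indicator F) p"
  have vsum: "v \<bullet> (\<Sum>i<?k. t i *\<^sub>R B i) = 0" for t by (simp add: inner_sum_right B_def vb)
  have "face_mass v = fiber_integral B {..<CARD('n)} g 0"
    unfolding face_mass_def g_def by (rule unimodular_coordinates) (use BL gen in auto)
  also have "\<dots> = fiber_integral B ({..<?k} \<union> {?k}) g 0"
  proof -
    have "i < CARD('n) \<longleftrightarrow> i < ?k \<or> i = ?k" for i using n by linarith
    then have "{..<CARD('n)} = {..<?k} \<union> {?k}" by blast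
    then show ?thesis by (simp only:)
  qed
  also have "\<dots> = fiber_integral B {?k} (fiber_integral B {..<?k} g) 0"
    by (rule fiber_integral_union) auto
  also have "\<dots> = (\<integral>\<^sup>+ s. fiber_integral B {..<?k} g (s *\<^sub>R p) \<partial>lborel)"
    by (subst fiber_integral_singleton) (auto simp: B_def intro!: fiber_integral_measurable)
  also have "\<dots> = (\<integral>\<^sup>+ s. (ennreal (s ^ ?k * exp (- s)) * indicator {0..} s) * L \<partial>lborel)"
  proof (rule nn_integral_cong_AE)
    have "AE s in lborel. s \<noteq> (0::real)" by (rule AE_lborel_singleton)
    then show "AE s in lborel. fiber_integral B {..<?k} g (s *\<^sub>R p)
        = (ennreal (s ^ ?k * exp (- s)) * indicator {0..} s) * L"
    proof eventually_elim
      case (elim s)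
      show ?case
      proof (cases "s > 0")
        case True
        have "fiber_integral B {..<?k} g (s *\<^sub>R p) = ennreal (s ^ card {..<?k}) * fiber_integral B {..<?k} (\<lambda>y. g (s *\<^sub>R y)) p"
          by (rule fiber_integral_scale) (use True in auto)
        also have "fiber_integral B {..<?k} (\<lambda>y. g (s *\<^sub>R y)) p = fiber_integral B {..<?k} (\<lambda>y. ennreal (exp (- s)) * indicator F y) p"
        proof (rule fiber_integral_cong)
          fix t
          let ?y = "p + (\<Sum>i<?k. t i *\<^sub>R B i)"
          have vy: "v \<bullet> ?y = - 1" using p vsum by (simp add: inner_add_right)
          have "?y \<in> F \<longleftrightarrow> - 1 \<le> m ?y"
          proof -
            have "?y \<in> F \<longleftrightarrow> (\<forall>u\<in>V. - 1 \<le> u \<bullet> ?y)" using F vy by (auto simp: P_def)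
            also have "\<dots> \<longleftrightarrow> - 1 \<le> m ?y" 
            proof
              assume "\<forall>u\<in>V. - 1 \<le> u \<bullet> ?y"
              moreover obtain u where "u \<in> V" "u \<bullet> ?y = m ?y" using m_attained by blast
              ultimately show "- 1 \<le> m ?y" by fastforce
            next
              assume "- 1 \<le> m ?y"
              then show "\<forall>u\<in>V. - 1 \<le> u \<bullet> ?y" using m_le[of _ ?y] by (blast intro: order_trans)
            qed
            finally show ?thesis .
          qed
          then have iff: "?y \<in> F \<longleftrightarrow> m ?y = - 1" using m_le[OF v(1), of ?y] vy by auto
          have "v \<bullet> (s *\<^sub>R ?y) = m (s *\<^sub>R ?y) \<longleftrightarrow> m ?y = - 1"
          proof -
            have "v \<bullet> (s *\<^sub>R ?y) = m (s *\<^sub>R ?y) \<longleftrightarrow> s * (v \<bullet> ?y) = s * m ?y"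
              using True by (simp only: m_scale inner_scaleR_right)
            also have "\<dots> \<longleftrightarrow> m ?y = - 1" using True unfolding vy mult_cancel_left by auto
            finally show ?thesis .
          qed
          then show "g (s *\<^sub>R ?y) = ennreal (exp (- s)) * indicator F ?y"
            using iff True by (auto simp: g_def m_scale split: split_indicator)
        qed
        also have "\<dots> = ennreal (exp (- s)) * L"
          unfolding L_def by (rule fiber_integral_cmult) measurable
        finally show ?thesis using True by (simp add: ennreal_mult mult.assoc)
      next
        case False
        then have s: "s < 0" using elim by simp
        have "g (s *\<^sub>R p + (\<Sum>i<?k. t i *\<^sub>R B i)) = 0" for t
        proof -
          have "v \<bullet> (s *\<^sub>R p + (\<Sum>i<?k. t i *\<^sub>R B i)) = - s" using p vsum by (simp add: inner_add_right)
          then show ?thesis using s m_nonpos[of "s *\<^sub>R p + (\<Sum>i<?k. t i *\<^sub>R B i)"] by (auto simp: g_def)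
        qed
        then show ?thesis using s by (simp add: fiber_integral_def)
      qed
    qed
  qed
  also have "\<dots> = ennreal (fact ?k) * L"
    using nn_intergal_power_times_exp_Ici[of ?k] by (subst nn_integral_multc) auto
  also have "L = emeasure (\<Pi>\<^sub>M i\<in>{..<?k}. lborel) {t \<in> space (\<Pi>\<^sub>M i\<in>{..<?k}. lborel). p + (\<Sum>i<?k. t i *\<^sub>R b i) \<in> F}"
  proof -
    let ?M = "\<Pi>\<^sub>M i\<in>{..<?k}. lborel :: real measure"
    have "(\<lambda>t. p + (\<Sum>i\<in>{..<?k}. t i *\<^sub>R b i)) \<in> borel_measurable ?M" by measurable
    from measurable_sets[OF this Fm]
    have A: "{t \<in> space ?M. p + (\<Sum>i<?k. t i *\<^sub>R b i) \<in> F} \<in> sets ?M"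
      by (simp add: vimage_def Int_def conj_commute)
    have "L = (\<integral>\<^sup>+ t. indicator {t \<in> space ?M. p + (\<Sum>i<?k. t i *\<^sub>R b i) \<in> F} t \<partial>?M)"
      unfolding L_def fiber_integral_def
    proof (rule nn_integral_cong)
      fix t assume "t \<in> space ?M"
      moreover have "(\<Sum>i<?k. t i *\<^sub>R B i) = (\<Sum>i<?k. t i *\<^sub>R b i)" by (intro sum.cong) (auto simp: B_def)
      ultimately show "indicator F (p + (\<Sum>i<?k. t i *\<^sub>R B i))
          = (indicator {t \<in> space ?M. p + (\<Sum>i<?k. t i *\<^sub>R b i) \<in> F} t :: ennreal)"
        by (simp split: split_indicator)
    qed
    then show ?thesis using A by simp
  qed
  finally show "face_mass v = ennreal (fact ?k) * emeasure (\<Pi>\<^sub>M i\<in>{..<?k}. lborel)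
      {t \<in> space (\<Pi>\<^sub>M i\<in>{..<?k}. lborel). p + (\<Sum>i<?k. t i *\<^sub>R b i) \<in> F}" .
qed

end

text \<open>The lattice vectors orthogonal to \<open>v\<close> have a basis, and with \<open>p\<close> it generates the full lattice, since
  \<open>x + (v \<bullet> x) *\<^sub>R p\<close> is orthogonal to \<open>v\<close>. This determines the number of elements of the basis.\<close>

lemma facet_lattice_frame_exists:
  fixes v :: "real ^ 'n"
  assumes v: "v \<in> int_lattice" "v \<noteq> 0" and hull: "affine hull F = {x. v \<bullet> x = - 1}"
    and p: "p \<in> int_lattice" "v \<bullet> p = - 1"
  shows "\<exists>b. lattice_frame F p b"
proof -
  define G where "G = {x \<in> int_lattice. v \<bullet> x = 0}"
  have G: "subgroup_set G" "G \<subseteq> int_lattice"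
    by (auto simp: G_def subgroup_set_def int_lattice_zero int_lattice_diff inner_diff_right)
  obtain B where B: "finite B" "independent B" "B \<subseteq> G"
    "\<And>x. x \<in> G \<Longrightarrow> \<exists>c :: real ^ 'n \<Rightarrow> int. x = (\<Sum>b\<in>B. of_int (c b) *\<^sub>R b)"
    using subgroup_of_int_lattice_basis[OF G] by metis
  have "subspace {x. v \<bullet> x = 0}" by (rule subspace_hyperplane)
  then have spB: "span B \<subseteq> {x. v \<bullet> x = 0}" using B(3) by (intro span_minimal) (auto simp: G_def)
  then have pB: "p \<notin> span B" using p by auto
  have "Basis \<subseteq> span (insert p B)"
  proof
    fix x :: "real ^ 'n" assume "x \<in> Basis"
    then have x: "x \<in> int_lattice" by (auto simp: Basis_cart int_lattice_axis)
    have "x + (v \<bullet> x) *\<^sub>R p \<in> G"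
      using x p v(1) by (auto simp: G_def inner_add_right intro!: int_lattice_add int_lattice_scale int_lattice_inner)
    then obtain c :: "real ^ 'n \<Rightarrow> int" where c: "x + (v \<bullet> x) *\<^sub>R p = (\<Sum>b\<in>B. of_int (c b) *\<^sub>R b)" using B(4) by blast
    have "(\<Sum>b\<in>B. of_int (c b) *\<^sub>R b) - (v \<bullet> x) *\<^sub>R p \<in> span (insert p B)"
      by (intro span_diff span_sum span_scale span_base) auto
    then show "x \<in> span (insert p B)" by (simp add: c[symmetric])
  qed
  then have "span (Basis :: (real ^ 'n) set) \<subseteq> span (insert p B)" by (rule span_minimal) simp
  then have "card (insert p B) = CARD('n)"
    using basis_card_eq_dim[of "insert p B" UNIV] independent_insertI[OF pB B(2)] by (simp add: top.extremum_unique)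
  moreover have "p \<notin> B" using pB span_base by blast
  ultimately have cB: "card B = CARD('n) - 1" using B(1) by simp
  have "aff_dim F = aff_dim {x. v \<bullet> x = - 1}" using aff_dim_affine_hull[of F] hull by simp
  then have dim: "nat (aff_dim F) = CARD('n) - 1" using v(2) by (simp add: aff_dim_hyperplane nat_diff_distrib)
  obtain b where b: "bij_betw b {0..<CARD('n) - 1} B" using ex_bij_betw_nat_finite[OF B(1)] cB by auto
  then have bB: "b ` {..<CARD('n) - 1} = B" "inj_on b {..<CARD('n) - 1}" by (auto simp: bij_betw_def atLeast0LessThan)
  have G_eq: "{x - p |x. x \<in> affine hull F \<inter> int_lattice} = G"
  proof (intro set_eqI iffI)
    fix y assume "y \<in> G"
    then have "y + p \<in> affine hull F \<inter> int_lattice" using p hull by (auto simp: G_def inner_add_right int_lattice_add)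
    moreover have "y = (y + p) - p" by simp
    ultimately show "y \<in> {x - p |x. x \<in> affine hull F \<inter> int_lattice}" by blast
  qed (use p hull in \<open>auto simp: G_def inner_diff_right int_lattice_diff\<close>)
  have "Z_basis B G"
    unfolding Z_basis_def
  proof (intro conjI allI impI)
    show "\<forall>b\<in>B. c b = 0" if "(\<Sum>b\<in>B. of_int (c b) *\<^sub>R b) = 0" for c :: "real ^ 'n \<Rightarrow> int"
      using independentD[OF B(2,1) subset_refl, of "\<lambda>b. of_int (c b)"] that by auto
    show "G = {\<Sum>b\<in>B. of_int (c b) *\<^sub>R b |c :: real ^ 'n \<Rightarrow> int. True}"
      using B(4) subgroup_set_sum[OF G(1) B(3,1)] by blast
  qed (rule B(1))
  then have "lattice_frame F p b"
    unfolding lattice_frame_def dim G_eq bB(1) using p bB(2) by (simp add: hull)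
  then show ?thesis by blast
qed

context centered_normals
begin

lemma face_mass_finite: "v \<in> V \<Longrightarrow> face_mass v < \<infinity>"
proof -
  assume v: "v \<in> V"
  have "face_mass v \<le> (\<Sum>v\<in>V. face_mass v)" using v finV by (intro member_le_sum) auto
  then show ?thesis using mass_finite by (simp add: mass_on_eq_sum le_less_trans)
qed

lemma lattice_volume_facet:
  assumes v: "v \<in> V" "v \<in> int_lattice" and F: "F = {x \<in> P. v \<bullet> x = - 1}"
    and hull: "affine hull F = {x. v \<bullet> x = - 1}" and p: "p \<in> int_lattice" "v \<bullet> p = - 1"
  shows "lattice_volume F = enn2real (face_mass v) / fact (CARD('n) - 1)"
proof -
  have v0: "v \<noteq> 0" using p by auto
  let ?k = "CARD('n) - 1"
  let ?E = "\<lambda>p b. {t \<in> space (\<Pi>\<^sub>M i\<in>{..<?k}. lborel). p + (\<Sum>i<?k. t i *\<^sub>R b i) \<in> F}"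
  have r: "measure (\<Pi>\<^sub>M i\<in>{..<?k}. lborel) (?E q b) = enn2real (face_mass v) / fact ?k"
    if "lattice_frame F q b" for q b
    using face_mass_eq_frame_volume(2)[OF v F hull that]
    by (simp add: measure_def enn2real_mult)
  obtain b where b: "lattice_frame F p b" using facet_lattice_frame_exists[OF v(2) v0 hull p] by blast
  note dim = face_mass_eq_frame_volume(1)[OF v F hull b]
  show ?thesis unfolding lattice_volume_def dim
  proof (rule the_equality)
    show "\<exists>q b. lattice_frame F q b \<and> enn2real (face_mass v) / fact ?k = measure (\<Pi>\<^sub>M i\<in>{..<?k}. lborel) (?E q b)"
      by (intro exI[of _ p] exI[of _ b] conjI b r[OF b, symmetric])
  qed (use r in auto)
qed

text \<open>A vector orthogonal to all lifted normals and its negative both lie in the cone, which is pointed.\<close>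

lemma lift_span: "span (lift ` V) = UNIV"
proof (rule ccontr)
  assume "span (lift ` V) \<noteq> UNIV"
  then obtain z where z: "z \<noteq> 0" "\<forall>x\<in>span (lift ` V). z \<bullet> x = 0" using span_not_UNIV_orthogonal by blast
  have "lift v \<bullet> z = 0" if "v \<in> V" for v
    using z(2) that span_base[of "lift v" "lift ` V"] by (metis imageI inner_commute)
  then have "z \<in> C" "- z \<in> C" by (auto simp: C_def lift_def)
  obtain R where R: "R > 0" "\<And>x t. (x, t) \<in> C \<Longrightarrow> norm x \<le> R * (- t)" using C_bound by blast
  obtain x t where xt: "z = (x, t)" by fastforce
  have "t \<le> 0" "- t \<le> 0" using C_nonpos[of x t] C_nonpos[of "- x" "- t"] \<open>z \<in> C\<close> \<open>- z \<in> C\<close> by (auto simp: xt)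
  then have "t = 0" by simp
  then have "x = 0" using R(2)[of x t] \<open>z \<in> C\<close> by (simp add: xt)
  then show False using z(1) \<open>t = 0\<close> by (simp add: xt zero_prod_def)
qed

end

section \<open>The complementary subspace and the theorem\<close>

lemma dim_times_singleton:
  fixes S :: "'a::euclidean_space set"
  assumes "S \<noteq> {}"
  shows "int (dim (S \<times> {- 1 :: real})) = aff_dim S + 1"
proof -
  obtain a where a: "a \<in> S" using assms by blast
  let ?f = "\<lambda>x :: 'a. (x, 0 :: real)"
  let ?T = "?f ` ((\<lambda>x. x - a) ` S)"
  have lin: "linear ?f" by (intro linearI) auto
  have "span (S \<times> {- 1}) = span (insert (a, - 1) ?T)"
  proof (intro subset_antisym span_minimal subspace_span)
    show "S \<times> {- 1} \<subseteq> span (insert (a, - 1) ?T)"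
    proof
      fix z assume "z \<in> S \<times> {- 1 :: real}"
      then obtain x where x: "x \<in> S" "z = (x, - 1)" by blast
      have "(a, - 1) + ?f (x - a) \<in> span (insert (a, - 1) ?T)"
        using x(1) by (intro span_add span_base) auto
      then show "z \<in> span (insert (a, - 1) ?T)" by (simp add: x(2))
    qed
    show "insert (a, - 1) ?T \<subseteq> span (S \<times> {- 1})"
    proof
      fix z assume "z \<in> insert (a, - 1) ?T"
      then consider "z = (a, - 1)" | x where "x \<in> S" "z = (x, - 1) - (a, - 1)" by auto
      then show "z \<in> span (S \<times> {- 1})"
      proof cases
        case 1
        then show ?thesis using a by (simp add: span_base)
      next
        case 2
        have "(x, - 1) - (a, - 1) \<in> span (S \<times> {- 1 :: real})"
          by (rule span_diff) (use 2(1) a in \<open>auto intro: span_base\<close>)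
        then show ?thesis using 2(2) by (simp only:)
      qed
    qed
  qed
  then have "dim (S \<times> {- 1 :: real}) = dim (insert (a, - 1 :: real) ?T)" by (metis dim_span)
  also have "(a, - 1) \<notin> span ?T"
  proof
    assume "(a, - 1) \<in> span ?T"
    moreover have "span ?T \<subseteq> {z. snd z = 0}"
      by (intro span_minimal) (auto simp: subspace_def)
    ultimately show False by auto
  qed
  then have "dim (insert (a, - 1 :: real) ?T) = dim ?T + 1" by (simp add: dim_insert)
  also have "dim ?T = dim ((\<lambda>x. x - a) ` S)"
    by (rule dim_image_eq[OF lin]) (auto simp: inj_on_def)
  also have "int (dim ((\<lambda>x. x - a) ` S) + 1) = aff_dim S + 1"
    using aff_dim_eq_dim_subtract[of a S] a by (simp add: hull_inc)
  finally show ?thesis .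
qed

lemma span_affine_hull_times_singleton:
  fixes S :: "'a::euclidean_space set"
  shows "span ((affine hull S) \<times> {- 1 :: real}) = span (S \<times> {- 1})"
proof (intro subset_antisym span_minimal subspace_span)
  have "affine {x :: 'a. (x, - 1 :: real) \<in> span (S \<times> {- 1})}"
    unfolding affine_def
  proof (intro ballI allI impI)
    fix x y :: 'a and u v :: real
    assume *: "x \<in> {x. (x, - 1 :: real) \<in> span (S \<times> {- 1})}" "y \<in> {x. (x, - 1 :: real) \<in> span (S \<times> {- 1})}" "u + v = 1"
    have "u *\<^sub>R (x, - 1 :: real) + v *\<^sub>R (y, - 1) \<in> span (S \<times> {- 1})"
      using * by (intro span_add span_scale) auto
    moreover have "u *\<^sub>R (x, - 1 :: real) + v *\<^sub>R (y, - 1) = (u *\<^sub>R x + v *\<^sub>R y, - 1)"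
      using *(3) by simp
    ultimately show "u *\<^sub>R x + v *\<^sub>R y \<in> {x. (x, - 1 :: real) \<in> span (S \<times> {- 1})}" by simp
  qed
  moreover have "S \<subseteq> {x :: 'a. (x, - 1 :: real) \<in> span (S \<times> {- 1})}" by (auto intro: span_base)
  ultimately have "affine hull S \<subseteq> {x :: 'a. (x, - 1 :: real) \<in> span (S \<times> {- 1})}" by (intro hull_minimal)
  then show "(affine hull S) \<times> {- 1 :: real} \<subseteq> span (S \<times> {- 1})" by auto
  show "S \<times> {- 1 :: real} \<subseteq> span ((affine hull S) \<times> {- 1})"
    using hull_subset[of S affine] by (auto intro: span_base)
qed

context centered_normals
begin

text \<open>The lifted normals span the whole space, so that the bound on the dimension of the span of those
  outside \<open>A\<close> forces a direct sum.\<close>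

theorem concentration_equality_complement:
  assumes A: "affine A" "A \<noteq> {}" "A \<noteq> UNIV"
    and eq: "(real CARD('n) + 1) * enn2real (mass_on (V \<inter> A)) = (real_of_int (aff_dim A) + 1) * enn2real (mass_on V)"
    and facets: "\<forall>v\<in>V. \<exists>x. v \<bullet> x = - 1 \<and> (\<forall>u\<in>V - {v}. - 1 < u \<bullet> x)"
  shows "\<exists>A'. affine A' \<and> A' \<noteq> {} \<and> complementary_affine A A' \<and>
    (real CARD('n) + 1) * enn2real (mass_on (V \<inter> A')) = (real_of_int (aff_dim A') + 1) * enn2real (mass_on V)"
proof -
  define A' where "A' = affine hull (V - A)"
  let ?S = "span (A \<times> {- 1 :: real})" and ?T = "span (A' \<times> {- 1 :: real})"
  have lift_times: "lift ` X = X \<times> {- 1}" for X by (auto simp: lift_def)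
  have T_eq: "?T = span (lift ` (V - A))"
    unfolding A'_def lift_times by (rule span_affine_hull_times_singleton)
  have dimS: "int (dim ?S) = aff_dim A + 1" using dim_times_singleton[OF A(2)] by simp
  have dimT: "int (dim ?T) \<le> int CARD('n) - aff_dim A"
    unfolding T_eq using affine_concentration(2)[OF A(1,2)] eq facets by simp
  let ?sum = "{x + y |x y. x \<in> ?S \<and> y \<in> ?T}"
  have "lift ` V \<subseteq> ?sum"
  proof
    fix z assume "z \<in> lift ` V"
    then obtain v where v: "v \<in> V" "z = lift v" by blast
    show "z \<in> ?sum"
    proof (cases "v \<in> A")
      case True
      then have "z \<in> ?S" by (intro span_base) (simp add: v(2) lift_def)
      moreover have "z = z + 0" "0 \<in> ?T" by (simp_all add: span_zero)
      ultimately show ?thesis by blast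
    next
      case False
      then have "z \<in> ?T" unfolding T_eq using v by (intro span_base) auto
      moreover have "z = 0 + z" "0 \<in> ?S" by (simp_all add: span_zero)
      ultimately show ?thesis by blast
    qed
  qed
  then have "span (lift ` V) \<subseteq> ?sum" by (intro span_minimal subspace_sums subspace_span)
  then have sum: "?sum = UNIV" using lift_span by auto
  have "dim ?sum + dim (?S \<inter> ?T) = dim ?S + dim ?T" by (intro dim_sums_Int subspace_span)
  then have "Suc CARD('n) + dim (?S \<inter> ?T) = dim ?S + dim ?T" unfolding sum by simp
  then have d0: "dim (?S \<inter> ?T) = 0" and dT: "int (dim ?T) = int CARD('n) - aff_dim A"
    using dimS dimT by linarith+
  have Int0: "?S \<inter> ?T = {0}" using d0 by (auto simp: dim_eq_0 span_zero)
  have ne: "V - A \<noteq> {}"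
  proof
    assume "V - A = {}"
    have "dim ?T = 0" unfolding T_eq \<open>V - A = {}\<close> by simp
    then have "aff_dim A = int CARD('n)" using dT by linarith
    then have "affine hull A = UNIV" using aff_dim_eq_full[of A] by simp
    then show False using A by (simp add: hull_same)
  qed
  then have A'_ne: "A' \<noteq> {}" by (simp add: A'_def)
  have dA': "aff_dim A' = int CARD('n) - aff_dim A - 1" using dim_times_singleton[OF A'_ne] dT by simp
  have V_A': "V \<inter> A' = V - A"
  proof
    show "V - A \<subseteq> V \<inter> A'" unfolding A'_def using hull_subset[of "V - A" affine] by blast
    show "V \<inter> A' \<subseteq> V - A"
    proof
      fix v assume v: "v \<in> V \<inter> A'"
      have "v \<notin> A"
      proof
        assume "v \<in> A"
        then have "lift v \<in> ?S" by (intro span_base) (simp add: lift_def)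
        moreover have "lift v \<in> ?T" using v by (intro span_base) (simp add: lift_def)
        ultimately have "lift v = 0" using Int0 by blast
        then show False by (simp add: lift_def zero_prod_def)
      qed
      then show "v \<in> V - A" using v by blast
    qed
  qed
  have "mass_on V = mass_on (V \<inter> A) + mass_on (V - A)"
  proof -
    have "(\<Sum>v\<in>V. face_mass v) = (\<Sum>v\<in>(V \<inter> A) \<union> (V - A). face_mass v)" by (rule sum.cong) auto
    also have "\<dots> = (\<Sum>v\<in>V \<inter> A. face_mass v) + (\<Sum>v\<in>V - A. face_mass v)"
      using finV by (intro sum.union_disjoint) auto
    finally show ?thesis by (simp add: mass_on_eq_sum)
  qed
  moreover have "mass_on (V \<inter> A) < \<infinity>" "mass_on (V - A) < \<infinity>"
    using calculation mass_finite by (auto simp: less_top)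
  ultimately have "enn2real (mass_on V) = enn2real (mass_on (V \<inter> A)) + enn2real (mass_on (V - A))"
    by (simp add: enn2real_plus)
  then have "(real CARD('n) + 1) * enn2real (mass_on (V \<inter> A')) = (real_of_int (aff_dim A') + 1) * enn2real (mass_on V)"
    using eq by (simp add: V_A' dA' algebra_simps)
  moreover have "complementary_affine A A'"
    unfolding complementary_affine_def complementary_subspaces_def using Int0 sum by (simp add: subspace_span)
  moreover have "affine A'" by (simp add: A'_def)
  ultimately show ?thesis using A'_ne by blast
qed

end

lemma weighted_share_iff:
  fixes d n f U W :: real
  assumes "d > 0" "n > 0" "f > 0"
  shows "1 / d * (U / f) = 1 / n * (W / f) \<longleftrightarrow> n * U = d * W"
    and "1 / d * (U / f) \<le> 1 / n * (W / f) \<longleftrightarrow> n * U \<le> d * W"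
proof -
  have "1 / d * (U / f) = (n * U) / (d * n * f)" "1 / n * (W / f) = (d * W) / (d * n * f)" using assms by simp_all
  moreover have "d * n * f > 0" using assms by simp
  ultimately show "1 / d * (U / f) = 1 / n * (W / f) \<longleftrightarrow> n * U = d * W"
    and "1 / d * (U / f) \<le> 1 / n * (W / f) \<longleftrightarrow> n * U \<le> d * W"
    by (simp_all only: divide_cancel_right divide_le_cancel) auto
qed

theorem theoremA:
  fixes P :: "(real ^ 'n) set"
  assumes "lattice_polytope P"
    and "full_dimensional P"
    and "smooth_polytope P"
    and "reflexive_polytope P"
    and "barycenter P = 0"
  shows "\<forall>A. affine A \<and> A \<noteq> {} \<and> A \<noteq> UNIV \<longrightarrow>
     1 / (real_of_int (aff_dim A) + 1) *
         (\<Sum>F | F facet_of P \<and> inner_normal P F \<in> A. lattice_volume F)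
       \<le> 1 / (real CARD('n) + 1) * (\<Sum>F | F facet_of P. lattice_volume F) \<and>
     (1 / (real_of_int (aff_dim A) + 1) *
         (\<Sum>F | F facet_of P \<and> inner_normal P F \<in> A. lattice_volume F)
       = 1 / (real CARD('n) + 1) * (\<Sum>F | F facet_of P. lattice_volume F) \<longrightarrow>
      (\<exists>A'. affine A' \<and> complementary_affine A A' \<and>
        1 / (real_of_int (aff_dim A') + 1) *
            (\<Sum>F | F facet_of P \<and> inner_normal P F \<in> A'. lattice_volume F)
          = 1 / (real CARD('n) + 1) * (\<Sum>F | F facet_of P. lattice_volume F)))"
proof -
  have hull: "affine hull P = UNIV" using assms(2) by (simp add: full_dimensional_def)
  have poly: "polytope P" using assms(1) by (rule polytope_of_lattice_polytope)
  have cvx: "convex P" and cpt: "compact P" using poly by (auto simp: polytope_imp_convex polytope_imp_compact)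
  define \<nu> where "\<nu> = inner_normal P"
  define V where "V = \<nu> ` {F. F facet_of P}"
  have pres: "facet_presentation P F (\<nu> F) 1" if "F facet_of P" for F
    using facet_presentation_inner_normal[OF assms(1) hull that] assms(4) that
    by (simp add: \<nu>_def reflexive_polytope_def)
  have F_eq: "F = {u \<in> P. \<nu> F \<bullet> u = - 1}" and P_ge: "u \<in> P \<Longrightarrow> - 1 \<le> \<nu> F \<bullet> u" if "F facet_of P" for F u
    using pres[OF that] by (auto simp: facet_presentation_def inner_commute)
  \<comment> \<open>The facets suffice to cut out \<open>P\<close>, and their normals are normalized by reflexivity.\<close>
  have P_eq: "P = {x. \<forall>v\<in>V. - 1 \<le> v \<bullet> x}"
  proof
    show "P \<subseteq> {x. \<forall>v\<in>V. - 1 \<le> v \<bullet> x}" using P_ge by (auto simp: V_def)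
    obtain H a b where H: "P = \<Inter>H" "\<And>h. h \<in> H \<Longrightarrow> a h \<noteq> 0 \<and> h = {x. a h \<bullet> x \<le> b h}"
      "\<And>F. F facet_of P \<longleftrightarrow> (\<exists>h. h \<in> H \<and> F = P \<inter> {x. a h \<bullet> x = b h})"
      by (rule polytope_facet_representation[OF poly hull]) blast
    show "{x. \<forall>v\<in>V. - 1 \<le> v \<bullet> x} \<subseteq> P"
    proof
      fix x assume x: "x \<in> {x. \<forall>v\<in>V. - 1 \<le> v \<bullet> x}"
      have "x \<in> h" if h: "h \<in> H" for h
      proof -
        define F where "F = P \<inter> {x. a h \<bullet> x = b h}"
        have F: "F facet_of P" using H(3) h F_def by blast
        have "P \<subseteq> {x. a h \<bullet> x \<le> b h}" using H(1) H(2)[OF h] h by blast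
        then obtain \<mu> where \<mu>: "\<mu> > 0" "\<nu> F = - \<mu> *\<^sub>R a h" "of_int 1 = \<mu> * b h"
          using facet_presentation_parallel[OF hull F _ _ F_def pres[OF F]] H(2)[OF h] by metis
        have "- 1 \<le> \<nu> F \<bullet> x" using x F by (auto simp: V_def)
        then have "\<mu> * (a h \<bullet> x) \<le> \<mu> * b h" using \<mu> by simp
        then have "a h \<bullet> x \<le> b h" using \<mu>(1) by simp
        then show "x \<in> h" using H(2)[OF h] by blast
      qed
      then show "x \<in> P" using H(1) by blast
    qed
  qed
  have finF: "finite {F. F facet_of P}" using poly by (rule finite_polytope_facets)
  have intP: "integrable lborel (\<lambda>x. indicator P x *\<^sub>R x)"
    using cpt by (intro borel_integrable_compact) (auto intro: continuous_intros)
  have P_borel: "P \<in> sets borel" using cpt by (intro borel_closed compact_imp_closed)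
  have "measure lborel P \<noteq> 0"
  proof
    assume 0: "measure lborel P = 0"
    have "emeasure lborel P \<noteq> \<infinity>" using emeasure_bounded_finite[OF compact_imp_bounded[OF cpt]] by (simp add: less_top)
    then have "P \<in> null_sets lborel" using 0 P_borel by (intro null_setsI) (simp_all add: emeasure_eq_ennreal_measure)
    then have "negligible P" using P_borel by (simp add: negligible_iff_null_sets null_sets_completion_iff)
    then have "interior P = {}" using negligible_convex_interior[OF cvx] by simp
    then have "rel_interior P = {}" using rel_interior_interior[OF hull] by simp
    then have "P = {}" using rel_interior_eq_empty[OF cvx] by simp
    then show False using hull by simp
  qed
  then have bary: "(LINT x|lborel. indicator P x *\<^sub>R x) = 0"
    using assms(5) by (simp add: barycenter_def set_lebesgue_integral_def)
  interpret N: centered_normals V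
  proof
    show "finite V" using finF by (simp add: V_def)
    show "bounded {x. \<forall>v\<in>V. - 1 \<le> v \<bullet> x}" unfolding P_eq[symmetric] using cpt by (rule compact_imp_bounded)
    fix l :: "real ^ 'n"
    have "(LINT x|lborel. indicator P x * (l \<bullet> x)) = (LINT x|lborel. l \<bullet> (indicator P x *\<^sub>R x))"
      by (intro Bochner_Integration.integral_cong) auto
    also have "\<dots> = l \<bullet> (LINT x|lborel. indicator P x *\<^sub>R x)" using intP by (intro integral_inner_right) auto
    finally show "(LINT x|lborel. indicator {x. \<forall>v\<in>V. - 1 \<le> v \<bullet> x} x * (l \<bullet> x)) = 0"
      unfolding P_eq[symmetric] by (simp add: bary)
  qed
  have NP: "N.P = P" using P_eq by (simp add: N.P_def)
  have vol: "lattice_volume F = enn2real (N.face_mass (\<nu> F)) / fact (CARD('n) - 1)" if F: "F facet_of P" for F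
  proof -
    have v: "\<nu> F \<in> V" "\<nu> F \<in> int_lattice" "\<nu> F \<noteq> 0"
      using F pres[OF F] by (auto simp: V_def facet_presentation_def primitive_vector_def)
    have hF: "affine hull F = {x. \<nu> F \<bullet> x = - 1}" using F_eq[OF F] by (intro facet_affine_hull[OF F hull v(3)]) blast
    \<comment> \<open>A vertex of the facet serves as the origin of a lattice frame.\<close>
    obtain S where S: "finite S" "S \<subseteq> int_lattice" "P = convex hull S" using assms(1) by (auto simp: lattice_polytope_def)
    obtain S' where S': "S' \<subseteq> S" "F = convex hull S'"
      using face_of_convex_hull_subset[of S F] finite_imp_compact[OF S(1)] F S(3) by (auto simp: facet_of_def)
    have "S' \<noteq> {}" using F S'(2) by (auto simp: facet_of_def)
    then obtain s where s: "s \<in> S'" by blast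
    then have "s \<in> F" using S'(2) hull_subset[of S' convex] by blast
    then have "\<nu> F \<bullet> s = - 1" using F_eq[OF F] by blast
    moreover have "s \<in> int_lattice" using s S'(1) S(2) by blast
    ultimately show ?thesis
      using N.lattice_volume_facet[OF v(1,2) _ hF, of s] F_eq[OF F] by (simp add: NP)
  qed
  have inj: "inj_on \<nu> {F. F facet_of P}"
    using F_eq by (intro inj_onI) (metis mem_Collect_eq)
  have sum_vol: "(\<Sum>F | F facet_of P \<and> inner_normal P F \<in> A. lattice_volume F)
      = enn2real (N.mass_on (V \<inter> A)) / fact (CARD('n) - 1)" for A
  proof -
    let ?I = "{F. F facet_of P \<and> \<nu> F \<in> A}"
    have I: "\<nu> ` ?I = V \<inter> A" "inj_on \<nu> ?I" using inj by (auto simp: V_def inj_on_def)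
    have "(\<Sum>F\<in>?I. lattice_volume F) = (\<Sum>F\<in>?I. enn2real (N.face_mass (\<nu> F))) / fact (CARD('n) - 1)"
      using vol by (simp add: sum_divide_distrib)
    also have "(\<Sum>F\<in>?I. enn2real (N.face_mass (\<nu> F))) = (\<Sum>v\<in>V \<inter> A. enn2real (N.face_mass v))"
      using sum.reindex[OF I(2), of "\<lambda>v. enn2real (N.face_mass v)"] I(1) by simp
    also have "\<dots> = enn2real (N.mass_on (V \<inter> A))"
    proof -
      have "enn2real (sum N.face_mass (V \<inter> A)) = sum (enn2real \<circ> N.face_mass) (V \<inter> A)"
        using N.face_mass_finite by (intro enn2real_sum) auto
      then show ?thesis by (simp add: N.mass_on_eq_sum comp_def)
    qed
    finally show ?thesis by (simp add: \<nu>_def)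
  qed
  have total: "(\<Sum>F | F facet_of P. lattice_volume F) = enn2real (N.mass_on V) / fact (CARD('n) - 1)"
    using sum_vol[of UNIV] by simp
  have facets: "\<forall>v\<in>V. \<exists>x. v \<bullet> x = - 1 \<and> (\<forall>u\<in>V - {v}. - 1 < u \<bullet> x)"
  proof
    fix v assume "v \<in> V"
    then obtain F where F: "F facet_of P" "v = \<nu> F" by (auto simp: V_def)
    obtain x where x: "x \<in> F" "\<And>G. G facet_of P \<Longrightarrow> G \<noteq> F \<Longrightarrow> x \<notin> G"
      by (rule facet_avoiding_point[OF poly F(1)]) blast
    have xP: "x \<in> P" and vx: "v \<bullet> x = - 1" using x(1) F_eq[OF F(1)] F(2) by auto
    have "- 1 < u \<bullet> x" if u: "u \<in> V - {v}" for u
    proof -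
      obtain G where G: "G facet_of P" "u = \<nu> G" using u by (auto simp: V_def)
      have "G \<noteq> F" using u G F by auto
      then have "x \<notin> G" using x(2) G(1) by blast
      then have "u \<bullet> x \<noteq> - 1" using F_eq[OF G(1)] xP G(2) by auto
      then show ?thesis using P_ge[OF G(1) xP] G(2) by simp
    qed
    then show "\<exists>x. v \<bullet> x = - 1 \<and> (\<forall>u\<in>V - {v}. - 1 < u \<bullet> x)" using vx by blast
  qed
  have eq_iff: "1 / (real_of_int (aff_dim A) + 1) * (U / fact (CARD('n) - 1)) = 1 / (real CARD('n) + 1) * (W / fact (CARD('n) - 1))
      \<longleftrightarrow> (real CARD('n) + 1) * U = (real_of_int (aff_dim A) + 1) * W"
    and le_iff: "1 / (real_of_int (aff_dim A) + 1) * (U / fact (CARD('n) - 1)) \<le> 1 / (real CARD('n) + 1) * (W / fact (CARD('n) - 1))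
      \<longleftrightarrow> (real CARD('n) + 1) * U \<le> (real_of_int (aff_dim A) + 1) * W"
    if "A \<noteq> {}" for A :: "(real ^ 'n) set" and U W :: real
  proof -
    have "0 \<le> aff_dim A" using that aff_dim_geq[of A] aff_dim_empty[of A] by linarith
    then have d: "0 < real_of_int (aff_dim A) + 1" by linarith
    show "1 / (real_of_int (aff_dim A) + 1) * (U / fact (CARD('n) - 1)) = 1 / (real CARD('n) + 1) * (W / fact (CARD('n) - 1))
      \<longleftrightarrow> (real CARD('n) + 1) * U = (real_of_int (aff_dim A) + 1) * W"
      by (rule weighted_share_iff(1)[OF d]) simp_all
    show "1 / (real_of_int (aff_dim A) + 1) * (U / fact (CARD('n) - 1)) \<le> 1 / (real CARD('n) + 1) * (W / fact (CARD('n) - 1))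
      \<longleftrightarrow> (real CARD('n) + 1) * U \<le> (real_of_int (aff_dim A) + 1) * W"
      by (rule weighted_share_iff(2)[OF d]) simp_all
  qed
  show ?thesis
  proof (intro allI impI conjI; (elim conjE)?)
    fix A :: "(real ^ 'n) set" assume A: "affine A" "A \<noteq> {}" "A \<noteq> UNIV"
    show "1 / (real_of_int (aff_dim A) + 1) *
         (\<Sum>F | F facet_of P \<and> inner_normal P F \<in> A. lattice_volume F)
       \<le> 1 / (real CARD('n) + 1) * (\<Sum>F | F facet_of P. lattice_volume F)"
      unfolding sum_vol total le_iff[OF A(2)] by (rule N.affine_concentration(1)[OF A(1,2)])
    assume "1 / (real_of_int (aff_dim A) + 1) *
         (\<Sum>F | F facet_of P \<and> inner_normal P F \<in> A. lattice_volume F)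
       = 1 / (real CARD('n) + 1) * (\<Sum>F | F facet_of P. lattice_volume F)"
    then have "(real CARD('n) + 1) * enn2real (N.mass_on (V \<inter> A)) = (real_of_int (aff_dim A) + 1) * enn2real (N.mass_on V)"
      unfolding sum_vol total eq_iff[OF A(2)] .
    from N.concentration_equality_complement[OF A this facets]
    obtain A' where A': "affine A'" "A' \<noteq> {}" "complementary_affine A A'"
      "(real CARD('n) + 1) * enn2real (N.mass_on (V \<inter> A')) = (real_of_int (aff_dim A') + 1) * enn2real (N.mass_on V)"
      by blast
    show "\<exists>A'. affine A' \<and> complementary_affine A A' \<and>
        1 / (real_of_int (aff_dim A') + 1) *
            (\<Sum>F | F facet_of P \<and> inner_normal P F \<in> A'. lattice_volume F)
          = 1 / (real CARD('n) + 1) * (\<Sum>F | F facet_of P. lattice_volume F)"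
      unfolding sum_vol total using A' eq_iff[OF A'(2)] by blast
  qed
qed

end
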